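(* Let $\mu_0,\mu_1$ be probability measures on $\mathbb{R}^d$ with Lebesgue densities $p_0,p_1$, and let $\phi_j=-\log p_j$, $j=0,1$. Assume: (U2) for some real $\beta>2$, each $\phi_j$ is twice differentiable and there are constants $C_m$, $C_\beta<\infty$ such that for $j=0,1$, $$\sup_{x\in\mathbb{R}^d,\,\|k\|_1=m}\Big|\frac{\partial^m\phi_j(x)}{\partial x_1^{k_1}\cdots\partial x_d^{k_d}}\Big|\le C_m,\quad 2\le m\le\lceil\beta\rceil-1,$$ $$\max_{\|k\|_1=\lceil\beta\rceil-1}\sup_{x\ne y}\Big|\frac{\partial^{\|k\|_1}\phi_j(x)}{\partial x_1^{k_1}\cdots\partial x_d^{k_d}}-\frac{\partial^{\|k\|_1}\phi_j(y)}{\partial y_1^{k_1}\cdots\partial y_d^{k_d}}\Big|\le C_\beta\|x-y\|^{\beta-\lceil\beta\rceil+1};$$ (U3) $p_0,p_1$ are strongly log-concave with parameter $\alpha>0$: $\phi_j(x)\ge\phi_j(x')+\nabla\phi_j(x')^\top(x-x')+\frac{\alpha}{2}\|x-x'\|^2$ for all $x,x'\in\mathbb{R}^d$, $j=0,1$. Let $X_0\sim\mu_0$, $X_1\sim\mu_1$ be independent, $X_t=(1-t)X_0+tX_1$, $v(t,z)=\mathbb{E}[X_1-X_0\mid X_t=z]$, and for $x\in\mathbb{R}^d$ let $t\mapsto\mathfrak{R}(t,x)$ solve $\frac{d}{dt}\mathfrak{R}(t,x)=v(t,\mathfrak{R}(t,x))$, $t\in[0,1]$, $\mathfrak{R}(0,x)=x$.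 Then the rectified map $R(x)=\mathfrak{R}(1,x)$ is (well defined and) twice continuously differentiable. Moreover, it satisfies the marginal preserving property: if $X_0\sim\mu_0$, then for each $t\in[0,1]$, $\mathfrak{R}(t,X_0)$ has the same law as $X_t=(1-t)X_0+tX_1$.
   Context: Here $k=(k_1,\dots,k_d)$ ranges over vectors of non-negative integers and $\|k\|_1=\sum_j k_j$. *)

theory Defs
  imports "HOL-Probability.Probability"
begin

definition partial :: "'n::finite \<Rightarrow> (real^'n \<Rightarrow> real) \<Rightarrow> real^'n \<Rightarrow> real" where
  "partial i f x = deriv (\<lambda>s. f (x + s *\<^sub>R axis i 1)) 0"

definition has_partial :: "'n::finite \<Rightarrow> (real^'n \<Rightarrow> real) \<Rightarrow> real^'n \<Rightarrow> bool" where
  "has_partial i f x \<longleftrightarrow> (\<lambda>s. f (x + s *\<^sub>R axis i 1)) differentiable (at 0)"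

text \<open>Iterated partial derivative: pderivs [i1,...,im] f = d_i1 (d_i2 (... (d_im f))).
  A multi-index k with |k|_1 = m corresponds to a list of m coordinate indices.\<close>
fun pderivs :: "'n::finite list \<Rightarrow> (real^'n \<Rightarrow> real) \<Rightarrow> real^'n \<Rightarrow> real" where
  "pderivs [] f = f"
| "pderivs (i # is) f = partial i (pderivs is f)"

definition grad :: "(real^'n::finite \<Rightarrow> real) \<Rightarrow> real^'n \<Rightarrow> real^'n" where
  "grad f x = (\<chi> i. partial i f x)"

definition U2 :: "real \<Rightarrow> (nat \<Rightarrow> real) \<Rightarrow> real \<Rightarrow> (real^'n::finite \<Rightarrow> real) \<Rightarrow> bool" where
  "U2 \<beta> C C\<beta> \<phi> \<longleftrightarrow>
     \<phi> differentiable_on UNIV \<and> grad \<phi> differentiable_on UNIV \<and>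
     (\<forall>is i x. length is < nat \<lceil>\<beta>\<rceil> - 1 \<longrightarrow> has_partial i (pderivs is \<phi>) x) \<and>
     (\<forall>m is x. 2 \<le> m \<and> m \<le> nat \<lceil>\<beta>\<rceil> - 1 \<and> length is = m \<longrightarrow> \<bar>pderivs is \<phi> x\<bar> \<le> C m) \<and>
     (\<forall>is x y. length is = nat \<lceil>\<beta>\<rceil> - 1 \<and> x \<noteq> y \<longrightarrow>
        \<bar>pderivs is \<phi> x - pderivs is \<phi> y\<bar> \<le> C\<beta> * norm (x - y) powr (\<beta> - of_int \<lceil>\<beta>\<rceil> + 1))"

definition U3 :: "real \<Rightarrow> (real^'n::finite \<Rightarrow> real) \<Rightarrow> bool" where
  "U3 \<alpha> \<phi> \<longleftrightarrow> (\<forall>x x'. \<phi> x \<ge> \<phi> x' + grad \<phi> x' \<bullet> (x - x') + \<alpha> / 2 * (norm (x - x'))\<^sup>2)"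

definition meas_of_pot :: "(real^'n::finite \<Rightarrow> real) \<Rightarrow> (real^'n) measure" where
  "meas_of_pot \<phi> = density lborel (\<lambda>x. ennreal (exp (- \<phi> x)))"

definition interp :: "real \<Rightarrow> (real^'n::finite) \<times> (real^'n) \<Rightarrow> real^'n" where
  "interp t = (\<lambda>(a, b). (1 - t) *\<^sub>R a + t *\<^sub>R b)"

text \<open>v(t,.) is the (continuous version of the) conditional expectation E[X_1 - X_0 | X_t = .]
  under P = mu0 x mu1 (independence of X_0, X_1).\<close>
definition is_cond_velocity ::
  "(real^'n::finite) measure \<Rightarrow> (real^'n) measure \<Rightarrow> (real \<Rightarrow> real^'n \<Rightarrow> real^'n) \<Rightarrow> bool" where
  "is_cond_velocity \<mu>0 \<mu>1 v \<longleftrightarrow>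
     (\<forall>t\<in>{0..1}. continuous_on UNIV (v t) \<and>
        integrable (\<mu>0 \<Otimes>\<^sub>M \<mu>1) (\<lambda>\<omega>. v t (interp t \<omega>)) \<and>
        (\<forall>A\<in>sets borel.
           (\<integral>\<omega>. indicator A (interp t \<omega>) *\<^sub>R (snd \<omega> - fst \<omega>) \<partial>(\<mu>0 \<Otimes>\<^sub>M \<mu>1)) =
           (\<integral>\<omega>. indicator A (interp t \<omega>) *\<^sub>R v t (interp t \<omega>) \<partial>(\<mu>0 \<Otimes>\<^sub>M \<mu>1))))"

definition ode_sol :: "(real \<Rightarrow> real^'n::finite \<Rightarrow> real^'n) \<Rightarrow> real^'n \<Rightarrow> (real \<Rightarrow> real^'n) \<Rightarrow> bool" where
  "ode_sol v x f \<longleftrightarrow> f 0 = x \<and>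
     (\<forall>t\<in>{0..1}. (f has_vector_derivative v t (f t)) (at t within {0..1}))"

definition C2 :: "(real^'n::finite \<Rightarrow> real^'n) \<Rightarrow> bool" where
  "C2 f \<longleftrightarrow> (\<exists>f' :: (real^'n) \<Rightarrow> ((real^'n) \<Rightarrow>\<^sub>L (real^'n)).
      \<exists>f'' :: (real^'n) \<Rightarrow> ((real^'n) \<Rightarrow>\<^sub>L ((real^'n) \<Rightarrow>\<^sub>L (real^'n))).
      (\<forall>x. (f has_derivative blinfun_apply (f' x)) (at x)) \<and>
      (\<forall>x. (f' has_derivative blinfun_apply (f'' x)) (at x)) \<and>
      continuous_on UNIV f'')"

end

theory Submission
  imports Defs
begin

text \<open>
  Put \<open>z = (1 - t) x0 + t x1\<close> and \<open>y = x1 - x0\<close>. This linear change of variables has determinant 1 for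
  every \<open>t\<close>, so \<open>(X t, X 1 - X 0)\<close> has density \<open>q t z y = p0 (z - t y) p1 (z + (1 - t) y)\<close> and the
  velocity is \<open>V t z = (\<integral> y q dy) / (\<integral> q dy)\<close>, also at the end points \<open>t = 0, 1\<close>.
  Strong log-concavity gives a Gaussian bound on \<open>q\<close> in \<open>y\<close>, uniform in \<open>z\<close>, hence one may differentiate
  twice in \<open>z\<close> under the integral. The derivative of \<open>V t\<close> is minus a covariance under the
  normalised \<open>q t z\<close>; the variance is bounded because around its mode \<open>q t z\<close> lies between two Gaussians
  with fixed parameters. So \<open>V t\<close> is globally Lipschitz uniformly in \<open>t\<close>, and its flow exists and is
  \<open>C\<^sup>2\<close>.

  For the marginals, let \<open>Z s\<close> be the preimage of \<open>X s\<close> under the flow map at time \<open>s\<close>. For a smooth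
  bounded \<open>g\<close>, the derivative of \<open>g (Z s)\<close> in \<open>s\<close> is a function of \<open>X s\<close> paired with
  \<open>X 1 - X 0 - V s (X s)\<close>, which has expectation zero by the definition of conditional expectation.
  Hence the law of \<open>Z s\<close> is the law of \<open>X 0\<close> for all \<open>s\<close>.
\<close>

subsection \<open>Initial value problems depending on a parameter\<close>

text \<open>The score \<open>G\<close> grows linearly in \<open>z\<close>. Domination that is
  uniform for \<open>z\<close> in a bounded set is enough for two derivatives of \<open>V t\<close>,
  but gives no global Lipschitz constant. Such a constant needs a bound on a covariance that is
  blind to \<open>z\<close>; hence the comparison with Gaussians centred at the mode, where the
  second moment and the normaliser share the same unknown factor and the same unknown centre.

  In time, \<open>V\<close> enters only through joint continuity. So smoothness of the flow in the
  initial value is drawn from the variational equation with coefficients merely continuous in time,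
  and the derivative of \<open>Z s\<close> in \<open>s\<close> must avoid differentiating the
  inverse flow in time. Freezing the flow map at the time of differentiation does this: only
  increments of trajectories and of \<open>X\<close> enter. Transporting the law back to time 0
  takes the place of a uniqueness statement for the continuity equation. What remains is a real
  function on the unit interval with zero derivative, and the fact that C^1 test functions with
  bounded gradient determine a law.\<close>

definition solves_ivp :: "real \<Rightarrow> (real \<Rightarrow> 'a \<Rightarrow> 'a) \<Rightarrow> 'a::real_normed_vector \<Rightarrow> (real \<Rightarrow> 'a) \<Rightarrow> bool"
  where "solves_ivp T F c f \<longleftrightarrow>
    f 0 = c \<and> (\<forall>t\<in>{0..T}. (f has_vector_derivative F t (f t)) (at t within {0..T}))"

lemma solves_ivp_continuous_on: "solves_ivp T F c f \<Longrightarrow> continuous_on {0..T} f"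
  unfolding solves_ivp_def
  by (auto simp: continuous_on_eq_continuous_within intro: has_vector_derivative_continuous)

lemma solves_ivp_cong:
  assumes "solves_ivp T F c f" "\<And>t. t \<in> {0..T} \<Longrightarrow> G t (f t) = F t (f t)"
  shows "solves_ivp T G c f"
  using assms unfolding solves_ivp_def by auto

lemma solves_ivp_reverse:
  fixes G :: "real \<Rightarrow> 'a \<Rightarrow> 'a::real_normed_vector"
  assumes f: "solves_ivp T G x f" and s: "s \<in> {0..T}"
  shows "solves_ivp s (\<lambda>r y. - G (s - r) y) (f s) (\<lambda>r. f (s - r))"
  unfolding solves_ivp_def
proof (intro conjI ballI)
  fix r assume r: "r \<in> {0..s}"
  have "((\<lambda>r. s - r) has_vector_derivative - 1) (at r within {0..s})"
    by (auto intro!: derivative_eq_intros)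
  moreover have "(f has_vector_derivative G (s - r) (f (s - r))) (at (s - r) within (\<lambda>r. s - r) ` {0..s})"
  proof (rule has_vector_derivative_within_subset)
    show "(f has_vector_derivative G (s - r) (f (s - r))) (at (s - r) within {0..T})"
      using f r s by (auto simp: solves_ivp_def)
  qed (use s in auto)
  ultimately have "(f \<circ> (\<lambda>r. s - r) has_vector_derivative (- 1) *\<^sub>R G (s - r) (f (s - r))) (at r within {0..s})"
    by (rule vector_diff_chain_within)
  then show "((\<lambda>r. f (s - r)) has_vector_derivative - G (s - r) (f (s - r))) (at r within {0..s})"
    by (simp add: o_def)
qed simp

lemma solves_ivp_subinterval:
  fixes G :: "real \<Rightarrow> 'a \<Rightarrow> 'a::real_normed_vector"
  assumes "solves_ivp T G x f" "s \<in> {0..T}"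
  shows "solves_ivp s G x f"
  unfolding solves_ivp_def
proof (intro conjI ballI)
  fix r assume r: "r \<in> {0..s}"
  show "(f has_vector_derivative G r (f r)) (at r within {0..s})"
  proof (rule has_vector_derivative_within_subset)
    show "(f has_vector_derivative G r (f r)) (at r within {0..T})"
      using assms r by (auto simp: solves_ivp_def)
  qed (use assms in auto)
qed (use assms in \<open>simp add: solves_ivp_def\<close>)

text \<open>\<open>norm (d t)\<close> need not be differentiable, so the argument runs on the
  majorant \<open>w\<close>, an integral that is. Since \<open>w' = K * norm d\<close> is at most
  \<open>K * w\<close>, the product of \<open>w\<close> with \<open>exp (- (K * t))\<close>
  decreases. Using \<open>e * T\<close> in place of \<open>e * t\<close> keeps the inhomogeneity
  inside the initial value.\<close>

lemma gronwall_norm: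
  fixes d d' :: "real \<Rightarrow> 'a::banach"
  assumes der: "\<And>t. t \<in> {0..T} \<Longrightarrow> (d has_vector_derivative d' t) (at t within {0..T})"
    and bnd: "\<And>t. t \<in> {0..T} \<Longrightarrow> norm (d' t) \<le> K * norm (d t) + e"
    and "K \<ge> 0" "e \<ge> 0" and t: "t \<in> {0..T}"
  shows "norm (d t) \<le> (norm (d 0) + e * T) * exp (K * t)"
proof -
  have cont: "continuous_on {0..T} d"
    using der by (rule continuous_on_vector_derivative)
  define w where "w t = norm (d 0) + e * T + K * integral {0..t} (\<lambda>s. norm (d s))" for t
  have d_le_w: "norm (d s) \<le> w s" if s: "s \<in> {0..T}" for s
  proof -
    have sub: "{0..s} \<subseteq> {0..T}" using s by auto
    have ii: "(\<lambda>s. norm (d s)) integrable_on {0..s}"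
      by (intro integrable_continuous_real continuous_intros continuous_on_subset[OF cont sub])
    have "(d' has_integral (d s - d 0)) {0..s}"
      using s sub by (intro fundamental_theorem_of_calculus)
        (auto intro!: has_vector_derivative_within_subset[OF der sub])
    then have d': "d' integrable_on {0..s}" and "norm (d s - d 0) = norm (integral {0..s} d')"
      by (auto simp: integral_unique)
    note this(2)
    also have "norm (integral {0..s} d') \<le> integral {0..s} (\<lambda>s. K * norm (d s) + e)"
      using sub by (intro integral_norm_bound_integral d' bnd
            integrable_add integrable_on_mult_right ii) auto
    also have "\<dots> = K * integral {0..s} (\<lambda>s. norm (d s)) + e * s"
      using s by (subst integral_add) (auto intro!: integrable_on_mult_right ii)
    also have "\<dots> \<le> K * integral {0..s} (\<lambda>s. norm (d s)) + e * T"
      using s \<open>e \<ge> 0\<close> by (auto intro!: mult_left_mono)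
    finally show ?thesis
      unfolding w_def using norm_triangle_ineq2[of "d s" "d 0"] by linarith
  qed
  have w_der: "(w has_real_derivative K * norm (d s)) (at s within {0..T})" if "s \<in> {0..T}" for s
    unfolding w_def has_real_derivative_iff_has_vector_derivative using that
    by (auto intro!: derivative_eq_intros integral_has_vector_derivative continuous_intros cont)
  have "w t * exp (- (K * t)) \<le> w 0 * exp (- (K * 0))"
  proof (rule DERIV_nonpos_imp_decreasing_open[where f = "\<lambda>s. w s * exp (- (K * s))"])
    fix s assume s: "0 < s" "s < t"
    have "(w has_real_derivative K * norm (d s)) (at s)"
      using w_der[of s] s t at_within_interior[of s "{0..T}"] by auto
    then have "((\<lambda>s. w s * exp (- (K * s))) has_real_derivative
        K * (norm (d s) - w s) * exp (- (K * s))) (at s)"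
      by (auto intro!: derivative_eq_intros simp: algebra_simps)
    moreover have "K * (norm (d s) - w s) * exp (- (K * s)) \<le> 0"
      using d_le_w[of s] s t \<open>K \<ge> 0\<close>
      by (intro mult_nonpos_nonneg mult_nonneg_nonpos) auto
    ultimately show "\<exists>y. ((\<lambda>s. w s * exp (- (K * s))) has_real_derivative y) (at s) \<and> y \<le> 0"
      by blast
  next
    have "continuous_on {0..T} w"
      by (meson DERIV_continuous continuous_on_eq_continuous_within w_der)
    then show "continuous_on {0..t} (\<lambda>s. w s * exp (- (K * s)))"
      using t by (intro continuous_intros) (auto intro: continuous_on_subset)
  qed (use t in auto)
  then have "w t \<le> w 0 * exp (K * t)"
    by (simp add: exp_minus field_simps)
  then show ?thesis using d_le_w[OF t] by (simp add: w_def)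
qed

text \<open>Only \<open>F\<close> has to be Lipschitz, and the defect of \<open>G\<close> is
  measured along the single solution \<open>g\<close>. Equal fields give uniqueness and Lipschitz
  dependence on the initial value; equal initial values give dependence on a parameter.\<close>

lemma ivp_dist_le:
  fixes f g :: "real \<Rightarrow> 'a::banach"
  assumes f: "solves_ivp T F c f" and g: "solves_ivp T G c' g"
    and lip: "\<And>t x y. t \<in> {0..T} \<Longrightarrow> norm (F t x - F t y) \<le> K * norm (x - y)"
    and close: "\<And>t. t \<in> {0..T} \<Longrightarrow> norm (F t (g t) - G t (g t)) \<le> e"
    and "K \<ge> 0" "e \<ge> 0" and t: "t \<in> {0..T}"
  shows "norm (f t - g t) \<le> (norm (c - c') + e * T) * exp (K * t)"
proof -
  have "norm (f t - g t) \<le> (norm (f 0 - g 0) + e * T) * exp (K * t)"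
  proof (rule gronwall_norm[where d' = "\<lambda>t. F t (f t) - G t (g t)"])
    fix s assume s: "s \<in> {0..T}"
    show "((\<lambda>s. f s - g s) has_vector_derivative F s (f s) - G s (g s)) (at s within {0..T})"
      using f g s unfolding solves_ivp_def by (auto intro!: derivative_intros)
    have "norm (F s (f s) - G s (g s)) \<le> norm (F s (f s) - F s (g s)) + norm (F s (g s) - G s (g s))"
      using norm_triangle_ineq[of "F s (f s) - F s (g s)" "F s (g s) - G s (g s)"] by simp
    then show "norm (F s (f s) - G s (g s)) \<le> K * norm (f s - g s) + e"
      using lip[OF s, of "f s" "g s"] close[OF s] by linarith
  qed fact+
  then show ?thesis using f g by (simp add: solves_ivp_def)
qed

lemma ivp_unique:
  fixes f g :: "real \<Rightarrow> 'a::banach"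
  assumes f: "solves_ivp T F c f" and g: "solves_ivp T F c g"
    and lip: "\<And>t x y. t \<in> {0..T} \<Longrightarrow> norm (F t x - F t y) \<le> K * norm (x - y)"
    and "K \<ge> 0" and t: "t \<in> {0..T}"
  shows "f t = g t"
  using ivp_dist_le[OF f g lip, of 0 t] assms by simp

text \<open>Picard iteration is a contraction for the norm weighted by \<open>exp (- (K + 1) t)\<close>.\<close>

lemma ivp_exists:
  fixes F :: "real \<Rightarrow> 'a::banach \<Rightarrow> 'a"
  assumes cont: "continuous_on ({0..T} \<times> UNIV) (\<lambda>(t, x). F t x)"
    and lip: "\<And>t x y. t \<in> {0..T} \<Longrightarrow> norm (F t x - F t y) \<le> K * norm (x - y)"
    and K: "K \<ge> 0" and T: "T \<ge> 0"
  shows "\<exists>f. solves_ivp T F c f"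
proof -
  \<comment> \<open>Any weight above \<open>K\<close> gives the contraction factor
    \<open>K / L < 1\<close>; adding 1 also covers \<open>K = 0\<close>.\<close>
  define L where "L = K + 1"
  have L: "L > 0" "K / L < 1" "K / L \<ge> 0" using K by (auto simp: L_def)
  \<comment> \<open>The unknown \<open>g\<close> is the solution times
    \<open>exp (- (L * t))\<close>, so the plain supremum norm of \<open>g\<close> is the weighted
    norm of the solution.\<close>
  define J where "J g t = c + integral {0..t} (\<lambda>s. F s (exp (L * s) *\<^sub>R g s))" for g :: "real \<Rightarrow> 'a" and t
  have contF: "continuous_on {0..T} (\<lambda>s. F s (exp (L * s) *\<^sub>R g s))"
    if "continuous_on {0..T} g" for g
    by (rule continuous_on_compose2[OF cont, of _ "\<lambda>s. (s, exp (L * s) *\<^sub>R g s)", simplified])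
      (auto intro!: continuous_intros that)
  have J_der: "(J g has_vector_derivative F t (exp (L * t) *\<^sub>R g t)) (at t within {0..T})"
    if "continuous_on {0..T} g" "t \<in> {0..T}" for g t
    unfolding J_def
    by (auto intro!: derivative_eq_intros integral_has_vector_derivative contF that)
  \<comment> \<open>\<open>clamp\<close> extends a function on \<open>{0..T}\<close> constantly to
    the whole line, which makes it a point of the Banach space of bounded continuous
    functions.\<close>
  have "\<exists>h::real \<Rightarrow>\<^sub>C 'a. \<forall>x. h x = exp (- (L * clamp 0 T x)) *\<^sub>R J g (clamp 0 T x)"
    for g :: "real \<Rightarrow>\<^sub>C 'a"
  proof -
    have "continuous_on {0..T} (J g)"
      by (rule continuous_on_vector_derivative[OF J_der]) auto
    then have "continuous_on (cbox 0 T) (\<lambda>t. exp (- (L * t)) *\<^sub>R J g t)"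
      by (auto intro!: continuous_intros)
    then show ?thesis
      by (rule continuous_on_cbox_bcontfunE) auto
  qed
  then obtain P :: "(real \<Rightarrow>\<^sub>C 'a) \<Rightarrow> (real \<Rightarrow>\<^sub>C 'a)"
    where P: "\<And>g x. P g x = exp (- (L * clamp 0 T x)) *\<^sub>R J g (clamp 0 T x)"
    by metis
  have "dist (P g) (P h) \<le> K / L * dist g h" for g h
  proof (rule dist_bound)
    fix x
    define t where "t = clamp 0 T x"
    have t: "t \<in> {0..T}"
      unfolding t_def using T clamp_in_interval[of 0 T x] by auto
    then have sub: "{0..t} \<subseteq> {0..T}" by auto
    have ii: "(\<lambda>s. F s (exp (L * s) *\<^sub>R apply_bcontfun g s)) integrable_on {0..t}" for g :: "real \<Rightarrow>\<^sub>C 'a"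
      by (intro integrable_continuous_real continuous_on_subset[OF contF sub]) auto
    have "((\<lambda>s. exp (L * s)) has_integral (exp (L * t) / L - exp (L * 0) / L)) {0..t}"
      using t L by (intro fundamental_theorem_of_calculus)
        (auto intro!: derivative_eq_intros simp: has_real_derivative_iff_has_vector_derivative[symmetric])
    then have e: "((\<lambda>s. K * dist g h * exp (L * s)) has_integral K * dist g h * ((exp (L * t) - 1) / L)) {0..t}"
      by (auto simp: diff_divide_distrib intro!: has_integral_mult_right)
    have "norm (J g t - J h t) = norm (integral {0..t} (\<lambda>s. F s (exp (L * s) *\<^sub>R g s) - F s (exp (L * s) *\<^sub>R h s)))"
      unfolding J_def by (subst integral_diff) (auto intro!: ii)
    also have "\<dots> \<le> integral {0..t} (\<lambda>s. K * dist g h * exp (L * s))"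
    proof (rule integral_norm_bound_integral)
      fix s assume "s \<in> {0..t}"
      then have "norm (F s (exp (L * s) *\<^sub>R g s) - F s (exp (L * s) *\<^sub>R h s))
          \<le> K * norm (exp (L * s) *\<^sub>R g s - exp (L * s) *\<^sub>R h s)"
        using sub by (intro lip) auto
      also have "\<dots> = K * (exp (L * s) * dist (g s) (h s))"
        by (simp add: dist_norm flip: scaleR_diff_right)
      also have "\<dots> \<le> K * (exp (L * s) * dist g h)"
        using K by (intro mult_left_mono dist_bounded) auto
      finally show "norm (F s (exp (L * s) *\<^sub>R g s) - F s (exp (L * s) *\<^sub>R h s))
          \<le> K * dist g h * exp (L * s)" by (simp add: mult_ac)
    qed (use e in \<open>auto intro!: integrable_diff ii\<close>)
    also have "\<dots> = K * dist g h * ((exp (L * t) - 1) / L)" using e by (rule integral_unique)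
    also have "\<dots> \<le> K * dist g h * (exp (L * t) / L)"
      using K L by (intro mult_left_mono divide_right_mono) auto
    finally have *: "norm (J g t - J h t) \<le> K * dist g h * (exp (L * t) / L)" .
    have "dist (P g x) (P h x) = exp (- (L * t)) * norm (J g t - J h t)"
      by (simp add: P t_def dist_norm flip: scaleR_diff_right)
    also have "\<dots> \<le> exp (- (L * t)) * (K * dist g h * (exp (L * t) / L))"
      using * by (intro mult_left_mono) auto
    also have "\<dots> = K / L * dist g h" by (simp add: exp_minus)
    finally show "dist (P g x) (P h x) \<le> K / L * dist g h" .
  qed
  then obtain g where g: "P g = g"
    using banach_fix_type[of "K / L" P] L by auto
  define f where "f t = exp (L * t) *\<^sub>R apply_bcontfun g t" for t
  have f: "f t = J g t" if "t \<in> {0..T}" for t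
  proof -
    have "clamp 0 T t = t" using that by auto
    then have "g t = exp (- (L * t)) *\<^sub>R J g t"
      using arg_cong[OF g, of "\<lambda>h. apply_bcontfun h t"] P[of g t] by simp
    then show ?thesis unfolding f_def by (simp flip: exp_add)
  qed
  have "solves_ivp T F c f"
    unfolding solves_ivp_def
  proof safe
    show "f 0 = c" using f[of 0] T by (simp add: J_def)
    fix t assume t: "t \<in> {0..T}"
    then have "(J g has_vector_derivative F t (f t)) (at t within {0..T})"
      using J_der[of g t] by (simp add: f_def)
    then show "(f has_vector_derivative F t (f t)) (at t within {0..T})"
      by (rule has_vector_derivative_transform[OF t, rotated]) (simp add: f)
  qed
  then show ?thesis by blast
qed

section \<open>Continuous and differentiable dependence on a parameter\<close>

locale param_ivp =
  fixes T K :: real and F :: "real \<Rightarrow> 'x::real_normed_vector \<Rightarrow> 'e::banach \<Rightarrow> 'e" and c :: 'e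
  assumes T: "T \<ge> 0" and K: "K \<ge> 0"
    and cont: "continuous_on ({0..T} \<times> UNIV) (\<lambda>(t, x, e). F t x e)"
    and lip: "\<And>t x a b. t \<in> {0..T} \<Longrightarrow> norm (F t x a - F t x b) \<le> K * norm (a - b)"
begin

lemma exists_sol: "\<exists>f. solves_ivp T (\<lambda>t. F t x) c f"
proof (rule ivp_exists[OF _ lip K T])
  have "continuous_on ({0..T} \<times> UNIV) (\<lambda>p. (\<lambda>(t, x, e). F t x e) (fst p, x, snd p))"
    by (rule continuous_on_compose2[OF cont]) (auto intro!: continuous_intros)
  then show "continuous_on ({0..T} \<times> UNIV) (\<lambda>(t, e). F t x e)"
    by (simp add: case_prod_beta)
qed

definition sol :: "'x \<Rightarrow> real \<Rightarrow> 'e"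
  where "sol x = (SOME f. solves_ivp T (\<lambda>t. F t x) c f)"

lemma solves: "solves_ivp T (\<lambda>t. F t x) c (sol x)"
  unfolding sol_def using exists_sol by (rule someI_ex)

lemma sol_continuous_on: "continuous_on {0..T} (sol x)"
  by (rule solves_ivp_continuous_on[OF solves])

text \<open>The fields for \<open>x\<close> and \<open>x0\<close> are compared only along the
  trajectory of \<open>x0\<close>. Compactness of the time interval then makes their distance small
  uniformly in \<open>t\<close> for \<open>x\<close> near \<open>x0\<close>, with no compactness in
  the parameter space, and Gronwall carries this over to the solutions.\<close>

lemma sol_uniformly_close:
  assumes "e > 0"
  shows "\<forall>\<^sub>F x in nhds x0. \<forall>t\<in>{0..T}. norm (sol x t - sol x0 t) \<le> e"
proof -
  \<comment> \<open>Gronwall multiplies the defect by at most \<open>T * exp (K * T)\<close>; the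
    added 1 keeps the denominator positive for \<open>T = 0\<close>.\<close>
  define \<epsilon> where "\<epsilon> = e / (T * exp (K * T) + 1)"
  have pos: "T * exp (K * T) + 1 > 0" using T by (simp add: add_nonneg_pos)
  have \<epsilon>: "\<epsilon> > 0" using pos assms by (simp add: \<epsilon>_def)
  have "continuous_on (UNIV \<times> {0..T}) (\<lambda>p. (\<lambda>(t, x, e). F t x e) (snd p, fst p, sol x0 (snd p)))"
    by (rule continuous_on_compose2[OF cont])
      (auto intro!: continuous_intros continuous_on_compose2[OF sol_continuous_on])
  then obtain X where X: "x0 \<in> X" "open X"
    "\<forall>x\<in>X \<inter> UNIV. \<forall>t\<in>{0..T}. dist (F t x (sol x0 t)) (F t x0 (sol x0 t)) \<le> \<epsilon>"
    by (rule continuous_on_prod_compactE[OF _ _ UNIV_I \<epsilon>, where C = "{0..T}"]) auto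
  have "norm (sol x t - sol x0 t) \<le> e" if "x \<in> X" "t \<in> {0..T}" for x t
  proof -
    have "norm (sol x t - sol x0 t) \<le> (norm (c - c) + \<epsilon> * T) * exp (K * t)"
      using X(3) that \<epsilon> K
      by (intro ivp_dist_le[OF solves solves lip]) (auto simp: dist_norm)
    also have "\<dots> \<le> \<epsilon> * T * exp (K * T)"
      using \<epsilon> K T that by (auto intro!: mult_left_mono)
    also have "\<dots> \<le> \<epsilon> * (T * exp (K * T) + 1)" using \<epsilon> by (simp add: algebra_simps)
    also have "\<dots> = e" using pos by (simp add: \<epsilon>_def)
    finally show ?thesis .
  qed
  then show ?thesis using X(1,2) by (auto simp: eventually_nhds)
qed

text \<open>Closeness in \<open>x\<close> is uniform in \<open>t\<close>, so only the continuity in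
  \<open>t\<close> of the one trajectory of \<open>x0\<close> has to be added.\<close>

lemma sol_jointly_continuous_on: "continuous_on ({0..T} \<times> UNIV) (\<lambda>(t, x). sol x t)"
  unfolding continuous_on_def
proof (rule ballI)
  fix p0 :: "real \<times> 'x" assume p0: "p0 \<in> {0..T} \<times> UNIV"
  obtain t0 x0 where p0_eq: "p0 = (t0, x0)" by (cases p0)
  have t0: "t0 \<in> {0..T}" using p0 p0_eq by auto
  let ?F = "at (t0, x0) within {0..T} \<times> UNIV"
  have "((\<lambda>p. sol (snd p) (fst p) - sol x0 (fst p)) \<longlongrightarrow> 0) ?F"
  proof (rule tendstoI)
    fix e :: real assume "e > 0"
    have "(snd \<longlongrightarrow> x0) ?F" using tendsto_snd[OF tendsto_ident_at] by force
    with sol_uniformly_close[of "e / 2" x0] \<open>e > 0\<close>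
    have "\<forall>\<^sub>F p in ?F. \<forall>t\<in>{0..T}. norm (sol (snd p) t - sol x0 t) \<le> e / 2"
      by (auto simp: filterlim_iff)
    moreover have "\<forall>\<^sub>F p in ?F. p \<in> {0..T} \<times> UNIV" by (auto simp: eventually_at_filter)
    ultimately show "\<forall>\<^sub>F p in ?F. dist (sol (snd p) (fst p) - sol x0 (fst p)) 0 < e"
      by eventually_elim (use \<open>e > 0\<close> in \<open>force simp: dist_norm\<close>)
  qed
  moreover have "((\<lambda>p. sol x0 (fst p)) \<longlongrightarrow> sol x0 t0) ?F"
  proof -
    have "continuous_on ({0..T} \<times> UNIV) (\<lambda>p. sol x0 (fst p))"
      by (rule continuous_on_compose2[OF sol_continuous_on]) (auto intro!: continuous_intros)
    then show ?thesis using t0 unfolding continuous_on_def by force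
  qed
  ultimately have "((\<lambda>p. sol (snd p) (fst p) - sol x0 (fst p) + sol x0 (fst p)) \<longlongrightarrow> 0 + sol x0 t0) ?F"
    by (rule tendsto_add)
  then show "((\<lambda>(t, x). sol x t) \<longlongrightarrow> (case p0 of (t, x) \<Rightarrow> sol x t)) (at p0 within {0..T} \<times> UNIV)"
    by (simp add: case_prod_beta' p0_eq)
qed

end

text \<open>A bound is asked of the derivative in the state only. The derivative in the parameter
  stays unbounded, so that the variational equation, whose parameter derivative grows with its
  unknown \<open>Y\<close>, can be an instance of the same locale.\<close>

locale C1_param_ivp =
  fixes T K :: real and F :: "real \<Rightarrow> 'x::real_normed_vector \<Rightarrow> 'e::banach \<Rightarrow> 'e" and c :: 'e
    and Fx :: "real \<Rightarrow> 'x \<Rightarrow> 'e \<Rightarrow> 'x \<Rightarrow>\<^sub>L 'e" and Fe :: "real \<Rightarrow> 'x \<Rightarrow> 'e \<Rightarrow> 'e \<Rightarrow>\<^sub>L 'e"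
  assumes T: "T \<ge> 0" and K: "K \<ge> 0"
    and cont: "continuous_on ({0..T} \<times> UNIV) (\<lambda>(t, x, e). F t x e)"
    and der: "\<And>t x e. t \<in> {0..T} \<Longrightarrow>
      ((\<lambda>p. F t (fst p) (snd p)) has_derivative (\<lambda>p. Fx t x e (fst p) + Fe t x e (snd p))) (at (x, e))"
    and contFx: "continuous_on ({0..T} \<times> UNIV) (\<lambda>(t, x, e). Fx t x e)"
    and contFe: "continuous_on ({0..T} \<times> UNIV) (\<lambda>(t, x, e). Fe t x e)"
    and boundFe: "\<And>t x e. t \<in> {0..T} \<Longrightarrow> norm (Fe t x e) \<le> K"
begin

sublocale param_ivp T K F c
proof
  fix t x a b assume t: "t \<in> {0..T}"
  have "((\<lambda>e. F t x e) has_derivative blinfun_apply (Fe t x e)) (at e)" for e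
  proof -
    have "((\<lambda>e. (x, e)) has_derivative (\<lambda>h. (0, h))) (at e)" by (auto intro!: derivative_eq_intros)
    from has_derivative_compose[OF this der[OF t]] show ?thesis by simp
  qed
  then show "norm (F t x a - F t x b) \<le> K * norm (a - b)"
    using boundFe[OF t]
    by (intro differentiable_bound[where S = UNIV and f' = "\<lambda>e. blinfun_apply (Fe t x e)"])
      (auto simp: norm_blinfun.rep_eq)
qed (rule T K cont)+

text \<open>The variational equation, obtained by formally differentiating the equation for
  \<open>sol x\<close> in \<open>x\<close>. It is affine in the operator \<open>Y\<close> with
  linear part of norm at most \<open>K\<close>, and starts at 0 because the initial value
  \<open>c\<close> does not move with \<open>x\<close>.\<close>

sublocale deriv: param_ivp T K "\<lambda>t x Y. Fx t x (sol x t) + (Fe t x (sol x t) o\<^sub>L Y)" 0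
proof
  fix t x and a b :: "'x \<Rightarrow>\<^sub>L 'e" assume t: "t \<in> {0..T}"
  have "norm (Fe t x (sol x t) o\<^sub>L (a - b)) \<le> norm (Fe t x (sol x t)) * norm (a - b)"
    by (rule norm_blinfun_compose)
  also have "\<dots> \<le> K * norm (a - b)" by (intro mult_right_mono boundFe t) auto
  finally show "norm (Fx t x (sol x t) + (Fe t x (sol x t) o\<^sub>L a) - (Fx t x (sol x t) + (Fe t x (sol x t) o\<^sub>L b)))
      \<le> K * norm (a - b)"
    by (simp add: bounded_bilinear.diff_right[OF bounded_bilinear_blinfun_compose])
next
  have s: "continuous_on ({0..T} \<times> UNIV) (\<lambda>p::real \<times> 'x \<times> ('x \<Rightarrow>\<^sub>L 'e). sol (fst (snd p)) (fst p))"
    by (rule continuous_on_compose2[OF sol_jointly_continuous_on, of _ "\<lambda>p. (fst p, fst (snd p))", simplified])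
      (auto intro!: continuous_intros)
  have "continuous_on ({0..T} \<times> UNIV) (\<lambda>p::real \<times> 'x \<times> ('x \<Rightarrow>\<^sub>L 'e).
      (\<lambda>(t, x, e). Fx t x e) (fst p, fst (snd p), sol (fst (snd p)) (fst p)) +
      ((\<lambda>(t, x, e). Fe t x e) (fst p, fst (snd p), sol (fst (snd p)) (fst p)) o\<^sub>L snd (snd p)))"
    by (intro continuous_intros continuous_on_compose2[OF contFx] continuous_on_compose2[OF contFe] s) auto
  then show "continuous_on ({0..T} \<times> UNIV)
     (\<lambda>(t, x, Y). Fx t x (sol x t) + (Fe t x (sol x t) o\<^sub>L Y))"
    by (simp add: case_prod_beta)
qed (rule T K)+

text \<open>Along the trajectory over a compact time interval, both partial derivatives of
  \<open>F\<close> vary by at most \<open>\<epsilon> / 2\<close> on a tube of fixed radius. The mean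
  value inequality, applied on that ball of increments \<open>(h, k)\<close>, turns this into a
  remainder bound that is uniform in \<open>t\<close>.\<close>

lemma remainder_uniformly_small:
  assumes "\<epsilon> > 0"
  obtains d where "d > 0" "\<And>t h k. t \<in> {0..T} \<Longrightarrow> norm (h, k) < d \<Longrightarrow>
    norm (F t (x + h) (sol x t + k) - F t x (sol x t) - Fx t x (sol x t) h - Fe t x (sol x t) k)
      \<le> \<epsilon> * norm (h, k)"
proof -
  let ?F' = "\<lambda>t x e (p :: 'x \<times> 'e). Fx t x e (fst p) + Fe t x e (snd p)"
  have s: "continuous_on (UNIV \<times> {0..T}) (\<lambda>p::('x \<times> 'e) \<times> real. sol x (snd p))"
    by (rule continuous_on_compose2[OF sol_continuous_on]) (auto intro!: continuous_intros)
  have "continuous_on (UNIV \<times> {0..T}) (\<lambda>p::('x \<times> 'e) \<times> real.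
      ((\<lambda>(t, x, e). Fx t x e) (snd p, x + fst (fst p), sol x (snd p) + snd (fst p)),
       (\<lambda>(t, x, e). Fe t x e) (snd p, x + fst (fst p), sol x (snd p) + snd (fst p))))"
    by (intro continuous_intros continuous_on_compose2[OF contFx] continuous_on_compose2[OF contFe] s) auto
  then obtain X where X: "(0, 0) \<in> X" "open X"
    "\<forall>p\<in>X \<inter> UNIV. \<forall>t\<in>{0..T}. dist
       (Fx t (x + fst p) (sol x t + snd p), Fe t (x + fst p) (sol x t + snd p))
       (Fx t x (sol x t), Fe t x (sol x t)) \<le> \<epsilon> / 2"
    by (rule continuous_on_prod_compactE[of _ _ _ "(0, 0)" "\<epsilon> / 2", where C = "{0..T}"])
      (use assms in auto)
  then obtain d where d: "d > 0" "ball (0, 0) d \<subseteq> X" by (meson open_contains_ball)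
  show ?thesis
  proof (rule that[OF \<open>d > 0\<close>])
    fix t and h :: 'x and k :: 'e assume t: "t \<in> {0..T}" and hk: "norm (h, k) < d"
    define g where "g p = F t (x + fst p) (sol x t + snd p)" for p
    define g' where "g' p = ?F' t (x + fst p) (sol x t + snd p)" for p
    have "norm (g (h, k) - g 0 - g' 0 ((h, k) - 0)) \<le> norm ((h, k) - 0) * \<epsilon>"
    proof (rule differentiable_bound_linearization[where S = "ball 0 d"])
      fix s :: real assume "s \<in> {0..1}"
      then have "\<bar>s\<bar> * norm (h, k) \<le> 1 * norm (h, k)" by (intro mult_right_mono) auto
      then show "0 + s *\<^sub>R ((h, k) - 0) \<in> ball 0 d"
        using hk by (simp flip: scaleR_Pair)
    next
      fix p :: "'x \<times> 'e" assume "p \<in> ball 0 d"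
      have "((\<lambda>p. (x, sol x t) + p) has_derivative (\<lambda>h. h)) (at p within ball 0 d)"
        by (auto intro!: derivative_eq_intros)
      from has_derivative_compose[OF this, of "\<lambda>p. F t (fst p) (snd p)"] der[OF t, of "x + fst p" "sol x t + snd p"]
      show "(g has_derivative g' p) (at p within ball 0 d)"
        by (simp add: plus_prod_def g_def[abs_def] g'_def)
    next
      fix p :: "'x \<times> 'e" assume "p \<in> ball 0 d"
      then have "p \<in> X" using d by (auto simp: zero_prod_def)
      let ?A = "Fx t (x + fst p) (sol x t + snd p) - Fx t x (sol x t)"
      let ?B = "Fe t (x + fst p) (sol x t + snd p) - Fe t x (sol x t)"
      have "dist (Fx t (x + fst p) (sol x t + snd p), Fe t (x + fst p) (sol x t + snd p))
         (Fx t x (sol x t), Fe t x (sol x t)) \<le> \<epsilon> / 2"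
        using X(3) \<open>p \<in> X\<close> t by auto
      then have "norm (?A, ?B) \<le> \<epsilon> / 2" by (simp add: dist_norm)
      then have AB: "norm ?A \<le> \<epsilon> / 2" "norm ?B \<le> \<epsilon> / 2"
        using norm_fst_le[of ?A ?B] norm_snd_le[of ?B ?A] by linarith+
      have "onorm (\<lambda>i. ?A (fst i) + ?B (snd i)) \<le> \<epsilon>"
      proof (rule onorm_bound)
        fix i :: "'x \<times> 'e"
        have "norm (?A (fst i) + ?B (snd i)) \<le> norm ?A * norm (fst i) + norm ?B * norm (snd i)"
          by (intro norm_triangle_le add_mono norm_blinfun)
        also have "\<dots> \<le> \<epsilon> / 2 * norm i + \<epsilon> / 2 * norm i"
          using AB norm_fst_le[of "fst i" "snd i"] norm_snd_le[of "snd i" "fst i"] assms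
          by (intro add_mono mult_mono) auto
        finally show "norm (?A (fst i) + ?B (snd i)) \<le> \<epsilon> * norm i" by simp
      qed (use assms in simp)
      then show "onorm (g' p - g' 0) \<le> \<epsilon>"
        by (simp add: g'_def blinfun.diff_left algebra_simps fun_diff_def)
    next
      show "0 \<in> ball (0::'x \<times> 'e) d" using d by simp
    qed
    then show "norm (F t (x + h) (sol x t + k) - F t x (sol x t) - Fx t x (sol x t) h - Fe t x (sol x t) k)
      \<le> \<epsilon> * norm (h, k)"
      by (simp add: g_def g'_def algebra_simps)
  qed
qed

text \<open>The error \<open>\<rho>\<close> of the linear approximation starts at 0 and solves the
  linearised equation up to the first-order remainder of \<open>F\<close>, which is at most
  \<open>\<epsilon>\<close> times the size of \<open>(h, \<delta>)\<close>. Since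
  \<open>\<delta>\<close> is itself bounded by \<open>\<rho>\<close> plus a multiple of
  \<open>norm h\<close>, Gronwall closes the estimate.\<close>

theorem sol_has_derivative:
  assumes t: "t \<in> {0..T}"
  shows "((\<lambda>x. sol x t) has_derivative blinfun_apply (deriv.sol x t)) (at x)"
  unfolding has_derivative_at_alt
proof safe
  show "bounded_linear (blinfun_apply (deriv.sol x t))" by (rule blinfun.bounded_linear_right)
  fix e :: real assume "e > 0"
  have "bounded (deriv.sol x ` {0..T})"
    by (intro compact_imp_bounded compact_continuous_image deriv.sol_continuous_on) auto
  then obtain B where B: "B > 0" "\<And>s. s \<in> {0..T} \<Longrightarrow> norm (deriv.sol x s) \<le> B"
    by (auto simp: bounded_pos)
  \<comment> \<open>\<open>M - 1\<close> is the factor that Gronwall produces. The rate is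
    \<open>K + 1\<close> because the remainder contributes
    \<open>\<epsilon> * norm (\<rho> s)\<close> with \<open>\<epsilon> \<le> 1\<close>; the final 1
    keeps \<open>M\<close> positive for \<open>T = 0\<close>.\<close>
  define M where "M = (1 + B) * T * exp ((K + 1) * T) + 1"
  have M: "M > 0" using B T by (auto simp: M_def intro!: add_nonneg_pos)
  define \<epsilon> where "\<epsilon> = min 1 (e / M)"
  have \<epsilon>: "\<epsilon> > 0" "\<epsilon> \<le> 1" "\<epsilon> * M \<le> e" using \<open>e > 0\<close> M by (auto simp: \<epsilon>_def min_def field_simps)
  obtain d where d: "d > 0" "\<And>t h k. t \<in> {0..T} \<Longrightarrow> norm (h, k) < d \<Longrightarrow>
    norm (F t (x + h) (sol x t + k) - F t x (sol x t) - Fx t x (sol x t) h - Fe t x (sol x t) k)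
      \<le> \<epsilon> * norm (h, k)"
    by (rule remainder_uniformly_small[OF \<open>\<epsilon> > 0\<close>, of x]) blast
  obtain r where r: "r > 0" "\<And>y s. dist y x < r \<Longrightarrow> s \<in> {0..T} \<Longrightarrow> norm (sol y s - sol x s) \<le> d / 2"
    using sol_uniformly_close[of "d / 2" x] d(1) by (auto simp: eventually_nhds_metric)
  show "\<exists>d>0. \<forall>y. norm (y - x) < d \<longrightarrow>
      norm (sol y t - sol x t - deriv.sol x t (y - x)) \<le> e * norm (y - x)"
  proof (intro exI[of _ "min r (d / 2)"] conjI allI impI)
    show "min r (d / 2) > 0" using r d by auto
    fix y assume y: "norm (y - x) < min r (d / 2)"
    define h where "h = y - x"
    define \<delta> where "\<delta> s = sol y s - sol x s" for s
    define \<rho> where "\<rho> s = \<delta> s - deriv.sol x s h" for s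
    have "norm (\<rho> t) \<le> (norm (\<rho> 0) + \<epsilon> * (1 + B) * norm h * T) * exp ((K + 1) * t)"
    proof (rule gronwall_norm)
      fix s assume s: "s \<in> {0..T}"
      show "(\<rho> has_vector_derivative F s y (sol y s) - F s x (sol x s) -
           (Fx s x (sol x s) + (Fe s x (sol x s) o\<^sub>L deriv.sol x s)) h) (at s within {0..T})"
        unfolding \<rho>_def \<delta>_def
        using solves[of y] solves[of x] deriv.solves[of x] s unfolding solves_ivp_def
        by (auto intro!: has_vector_derivative_diff
            bounded_linear.has_vector_derivative[OF blinfun.bounded_linear_left])
      have hd: "norm (h, \<delta> s) < d"
        using norm_Pair_le[of h "\<delta> s"] y r(2)[of y s] s by (auto simp: h_def \<delta>_def dist_norm)
      let ?r = "F s y (sol y s) - F s x (sol x s) - Fx s x (sol x s) h - Fe s x (sol x s) (\<delta> s)"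
      have "norm ?r \<le> \<epsilon> * norm (h, \<delta> s)"
        using d(2)[OF s hd] by (simp add: h_def \<delta>_def)
      also have "\<dots> \<le> \<epsilon> * (norm h + (norm (\<rho> s) + B * norm h))"
      proof (intro mult_left_mono order_trans[OF norm_Pair_le] add_left_mono)
        have "norm (\<delta> s) \<le> norm (\<rho> s) + norm (deriv.sol x s h)"
          using norm_triangle_ineq[of "\<rho> s" "deriv.sol x s h"] by (simp add: \<rho>_def)
        also have "norm (deriv.sol x s h) \<le> B * norm h"
          by (rule order_trans[OF norm_blinfun]) (auto intro!: mult_right_mono B s)
        finally show "norm (\<delta> s) \<le> norm (\<rho> s) + B * norm h" by simp
      qed (use \<epsilon> in auto)
      also have "\<dots> \<le> norm (\<rho> s) + \<epsilon> * (1 + B) * norm h"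
        using mult_right_mono[OF \<epsilon>(2) norm_ge_zero[of "\<rho> s"]] by (simp add: algebra_simps)
      finally have 1: "norm ?r \<le> norm (\<rho> s) + \<epsilon> * (1 + B) * norm h" .
      have 2: "norm (Fe s x (sol x s) (\<rho> s)) \<le> K * norm (\<rho> s)"
        by (rule order_trans[OF norm_blinfun]) (auto intro!: mult_right_mono boundFe s)
      have "F s y (sol y s) - F s x (sol x s) -
           (Fx s x (sol x s) + (Fe s x (sol x s) o\<^sub>L deriv.sol x s)) h = ?r + Fe s x (sol x s) (\<rho> s)"
        by (simp add: \<rho>_def blinfun.bilinear_simps)
      then show "norm (F s y (sol y s) - F s x (sol x s) -
           (Fx s x (sol x s) + (Fe s x (sol x s) o\<^sub>L deriv.sol x s)) h)
         \<le> (K + 1) * norm (\<rho> s) + \<epsilon> * (1 + B) * norm h"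
        using norm_triangle_ineq[of ?r "Fe s x (sol x s) (\<rho> s)"] 1 2 by (simp add: algebra_simps)
    qed (use K \<epsilon> B t in auto)
    also have "\<rho> 0 = 0"
      using solves[of y] solves[of x] deriv.solves[of x] by (simp add: \<rho>_def \<delta>_def solves_ivp_def)
    also have "(norm 0 + \<epsilon> * (1 + B) * norm h * T) * exp ((K + 1) * t) \<le> \<epsilon> * (1 + B) * norm h * T * exp ((K + 1) * T)"
      using \<epsilon> B T K t by (auto intro!: mult_left_mono)
    also have "\<dots> = \<epsilon> * (M - 1) * norm h" by (simp add: M_def)
    also have "\<dots> \<le> \<epsilon> * M * norm h" using \<epsilon> by (auto intro!: mult_right_mono)
    also have "\<dots> \<le> e * norm h" using \<epsilon> by (intro mult_right_mono) auto
    finally show "norm (sol y t - sol x t - deriv.sol x t (y - x)) \<le> e * norm (y - x)"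
      by (simp add: \<rho>_def \<delta>_def h_def)
  qed
qed

end

subsection \<open>Parametric integrals and smooth families\<close>

text \<open>The dominating function may change from point to point: the integrands to come are
  bounded uniformly only for bounded \<open>z\<close>. Dominated convergence is applied to the tail
  of a sequence that has entered the neighbourhood \<open>U\<close>.\<close>

lemma continuous_on_integral_param:
  fixes h :: "'p::metric_space \<Rightarrow> 'y \<Rightarrow> 'b::{banach, second_countable_topology}"
  assumes cont: "\<And>y. continuous_on S (\<lambda>p. h p y)"
    and meas: "\<And>p. p \<in> S \<Longrightarrow> h p \<in> borel_measurable M"
    and dom: "\<And>p. p \<in> S \<Longrightarrow> \<exists>U B. open U \<and> p \<in> U \<and> integrable M B \<and>
      (\<forall>q\<in>S \<inter> U. \<forall>y. norm (h q y) \<le> B y)"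
  shows "continuous_on S (\<lambda>p. \<integral>y. h p y \<partial>M)"
  unfolding continuous_on_sequentially
proof (intro allI ballI impI)
  fix x a assume a: "a \<in> S" and x: "(\<forall>n. x n \<in> S) \<and> x \<longlonglongrightarrow> a"
  from dom[OF a] obtain U B where UB: "open U" "a \<in> U" "integrable M B"
    "\<And>q y. q \<in> S \<Longrightarrow> q \<in> U \<Longrightarrow> norm (h q y) \<le> B y" by auto
  from topological_tendstoD[OF conjunct2[OF x] UB(1,2)] obtain N where N: "\<And>n. n \<ge> N \<Longrightarrow> x n \<in> U"
    by (auto simp: eventually_sequentially)
  have "(\<lambda>n. \<integral>y. h (x (n + N)) y \<partial>M) \<longlonglongrightarrow> (\<integral>y. h a y \<partial>M)"
  proof (rule integral_dominated_convergence[where w = B])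
    have "(\<lambda>n. h (x n) y) \<longlonglongrightarrow> h a y" for y
      using cont[of y] a x unfolding continuous_on_sequentially by (auto simp: o_def)
    then show "AE y in M. (\<lambda>n. h (x (n + N)) y) \<longlonglongrightarrow> h a y"
      by (intro AE_I2 LIMSEQ_ignore_initial_segment[of "\<lambda>n. h (x n) y" for y])
    show "AE y in M. norm (h (x (n + N)) y) \<le> B y" for n
      using N x by (auto intro!: UB)
  qed (use a x UB meas in auto)
  then show "((\<lambda>p. \<integral>y. h p y \<partial>M) \<circ> x) \<longlonglongrightarrow> (\<integral>y. h a y \<partial>M)"
    unfolding o_def by (rule LIMSEQ_offset)
qed

text \<open>The mean value inequality on a ball inside \<open>U\<close> bounds the normalised
  remainder \<open>R k y\<close> by \<open>2 * B y\<close>, and it tends to 0 for every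
  \<open>y\<close>, so dominated convergence along sequences applies. Measurability of
  \<open>h'\<close> is asked direction by direction, which avoids measurability of operator-valued
  maps.\<close>

lemma has_derivative_integral_param:
  fixes h :: "'p::euclidean_space \<Rightarrow> 'y \<Rightarrow> 'b::{banach, second_countable_topology}"
  assumes der: "\<And>p y. ((\<lambda>p. h p y) has_derivative blinfun_apply (h' p y)) (at p)"
    and int: "\<And>p. integrable M (h p)"
    and meas: "\<And>p i. (\<lambda>y. h' p y i) \<in> borel_measurable M"
    and dom: "\<exists>U B. open U \<and> p \<in> U \<and> integrable M B \<and> (\<forall>q\<in>U. \<forall>y. norm (h' q y) \<le> B y)"
  shows "((\<lambda>p. \<integral>y. h p y \<partial>M) has_derivative (\<lambda>i. \<integral>y. h' p y i \<partial>M)) (at p)"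
proof -
  from dom obtain U B where U: "open U" "p \<in> U" and B: "integrable M B"
    "\<And>q y. q \<in> U \<Longrightarrow> norm (h' q y) \<le> B y" by auto
  from U obtain r where r: "r > 0" "ball p r \<subseteq> U" by (meson open_contains_ball)
  have int': "integrable M (\<lambda>y. h' p y i)" for i
  proof (rule Bochner_Integration.integrable_bound[OF integrable_mult_left[of "norm i", OF B(1)]])
    show "AE y in M. norm (h' p y i) \<le> norm (B y * norm i)"
    proof (rule AE_I2)
      fix y
      have "norm (h' p y i) \<le> norm (h' p y) * norm i" by (rule norm_blinfun)
      also have "\<dots> \<le> B y * norm i" using B(2) U by (intro mult_right_mono) auto
      finally show "norm (h' p y i) \<le> norm (B y * norm i)" by simp
    qed
  qed (rule meas)
  have bl: "bounded_linear (\<lambda>i. \<integral>y. h' p y i \<partial>M)"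
    unfolding bounded_linear_def bounded_linear_axioms_def linear_iff
  proof (intro conjI allI exI)
    fix i j and c :: real
    show "(\<integral>y. h' p y (i + j) \<partial>M) = (\<integral>y. h' p y i \<partial>M) + (\<integral>y. h' p y j \<partial>M)"
      by (simp add: blinfun.add_right int')
    show "(\<integral>y. h' p y (c *\<^sub>R i) \<partial>M) = c *\<^sub>R (\<integral>y. h' p y i \<partial>M)"
      by (simp add: blinfun.scaleR_right)
    have "norm (\<integral>y. h' p y i \<partial>M) \<le> (\<integral>y. norm (h' p y i) \<partial>M)" by (rule integral_norm_bound)
    also have "\<dots> \<le> (\<integral>y. B y * norm i \<partial>M)"
    proof (rule integral_mono)
      fix y
      have "norm (h' p y i) \<le> norm (h' p y) * norm i" by (rule norm_blinfun)
      also have "\<dots> \<le> B y * norm i" using B(2) U by (intro mult_right_mono) auto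
      finally show "norm (h' p y i) \<le> B y * norm i" .
    qed (use int' B in auto)
    finally show "norm (\<integral>y. h' p y i \<partial>M) \<le> norm i * (\<integral>y. B y \<partial>M)" by (simp add: mult.commute)
  qed
  define R where "R k y = (h (p + k) y - h p y - h' p y k) /\<^sub>R norm k" for k y
  have R_bound: "norm (R k y) \<le> 2 * B y" if k: "k \<noteq> 0" "norm k < r" for k y
  proof -
    have "norm (h (p + k) y - h p y) \<le> B y * norm (p + k - p)"
      using k r B(2) by (intro differentiable_bound[where S = "ball p r" and f' = "\<lambda>q. blinfun_apply (h' q y)"])
        (auto simp: dist_norm norm_blinfun.rep_eq[symmetric] intro: der has_derivative_at_withinI)
    moreover have "norm (h' p y k) \<le> B y * norm k"
      by (rule order_trans[OF norm_blinfun]) (auto intro!: mult_right_mono B U)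
    ultimately have "norm (h (p + k) y - h p y - h' p y k) \<le> 2 * B y * norm k"
      using norm_triangle_ineq4[of "h (p + k) y - h p y" "h' p y k"] by simp
    then have "norm (h (p + k) y - h p y - h' p y k) / norm k \<le> 2 * B y"
      using k by (simp add: divide_le_eq)
    then show ?thesis by (simp add: R_def divide_inverse mult.commute)
  qed
  have R_int: "integrable M (R k)" for k
    unfolding R_def by (intro integrable_scaleR_right Bochner_Integration.integrable_diff int int')
  have R_lim: "(\<lambda>n. R (k n) y) \<longlonglongrightarrow> 0" if "\<And>n. k n \<in> UNIV - {0}" "k \<longlonglongrightarrow> 0" for k y
  proof -
    have "((\<lambda>k. norm (h (p + k) y - h p y - h' p y k) / norm k) \<longlongrightarrow> 0) (at 0)"
      using der[of y p] unfolding has_derivative_at by simp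
    then have "((\<lambda>k. norm (R k y)) \<longlongrightarrow> 0) (at 0)"
      by (simp add: R_def divide_inverse mult.commute)
    then have "((\<lambda>k. R k y) \<longlongrightarrow> 0) (at 0)" by (rule tendsto_norm_zero_cancel)
    then show ?thesis using that unfolding tendsto_at_iff_sequentially by (auto simp: o_def)
  qed
  have "((\<lambda>k. \<integral>y. R k y \<partial>M) \<longlongrightarrow> 0) (at 0)"
    unfolding tendsto_at_iff_sequentially
  proof (intro allI impI)
    fix k :: "nat \<Rightarrow> 'p" assume k: "\<forall>n. k n \<in> UNIV - {0}" "k \<longlonglongrightarrow> 0"
    from tendstoD[OF k(2) \<open>r > 0\<close>] obtain N where N: "\<And>n. n \<ge> N \<Longrightarrow> norm (k n) < r"
      by (auto simp: eventually_sequentially)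
    have "(\<lambda>n. \<integral>y. R (k (n + N)) y \<partial>M) \<longlonglongrightarrow> (\<integral>y. 0 \<partial>M)"
    proof (rule integral_dominated_convergence[where w = "\<lambda>y. 2 * B y"])
      show "AE y in M. (\<lambda>n. R (k (n + N)) y) \<longlonglongrightarrow> 0"
        using R_lim[of k] k by (auto intro!: LIMSEQ_ignore_initial_segment[of "\<lambda>n. R (k n) y" for y])
      show "AE y in M. norm (R (k (n + N)) y) \<le> 2 * B y" for n
        using N k by (auto intro!: R_bound)
    qed (use B R_int in \<open>auto intro: borel_measurable_integrable\<close>)
    then show "((\<lambda>k. \<integral>y. R k y \<partial>M) \<circ> k) \<longlonglongrightarrow> 0"
      unfolding o_def by (auto intro: LIMSEQ_offset)
  qed
  then have "((\<lambda>k. norm (\<integral>y. R k y \<partial>M)) \<longlongrightarrow> 0) (at 0)" by (rule tendsto_norm_zero)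
  moreover have "(\<integral>y. R k y \<partial>M) = ((\<integral>y. h (p + k) y \<partial>M) - (\<integral>y. h p y \<partial>M) - (\<integral>y. h' p y k \<partial>M)) /\<^sub>R norm k" for k
    unfolding R_def by (simp add: int int')
  ultimately show ?thesis
    unfolding has_derivative_at using bl by (simp add: divide_inverse mult.commute)
qed

text \<open>The index \<open>t\<close> carries continuity only, jointly with \<open>x\<close>;
  derivatives are taken in \<open>x\<close> alone. This is the regularity in time that the flow
  equation requires.\<close>

definition C1_family ::
  "'t::topological_space set \<Rightarrow> ('t \<Rightarrow> 'a::real_normed_vector \<Rightarrow> 'b::real_normed_vector) \<Rightarrow> ('t \<Rightarrow> 'a \<Rightarrow> 'a \<Rightarrow>\<^sub>L 'b) \<Rightarrow> bool"
  where "C1_family S f f' \<longleftrightarrow>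
    continuous_on (S \<times> UNIV) (\<lambda>p. f (fst p) (snd p)) \<and>
    continuous_on (S \<times> UNIV) (\<lambda>p. f' (fst p) (snd p)) \<and>
    (\<forall>t\<in>S. \<forall>x. (f t has_derivative blinfun_apply (f' t x)) (at x))"

lemma C1_familyD:
  assumes "C1_family S f f'"
  shows "continuous_on (S \<times> UNIV) (\<lambda>p. f (fst p) (snd p))"
    and "continuous_on (S \<times> UNIV) (\<lambda>p. f' (fst p) (snd p))"
    and "t \<in> S \<Longrightarrow> (f t has_derivative blinfun_apply (f' t x)) (at x)"
  using assms by (auto simp: C1_family_def)

lemma C1_family_linear:
  assumes "C1_family S f f'"
  shows "C1_family S (\<lambda>t x. blinfun_apply L (f t x)) (\<lambda>t x. L o\<^sub>L f' t x)"
  using assms unfolding C1_family_def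
  by (auto intro!: continuous_intros bounded_linear.has_derivative[OF blinfun.bounded_linear_right, THEN has_derivative_eq_rhs])

lemma C1_family_add:
  assumes "C1_family S f f'" "C1_family S g g'"
  shows "C1_family S (\<lambda>t x. f t x + g t x) (\<lambda>t x. f' t x + g' t x)"
  using assms unfolding C1_family_def
  by (auto intro!: continuous_intros derivative_eq_intros simp: blinfun.add_left)

lemma C1_family_sum:
  assumes "\<And>i. i \<in> I \<Longrightarrow> C1_family S (f i) (f' i)"
  shows "C1_family S (\<lambda>t x. \<Sum>i\<in>I. f i t x) (\<lambda>t x. \<Sum>i\<in>I. f' i t x)"
  using assms unfolding C1_family_def
  by (auto intro!: continuous_intros derivative_eq_intros simp: blinfun.sum_left)

lemma (in bounded_bilinear) C1_family:
  assumes f: "C1_family S f f'" and g: "C1_family S g g'"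
  shows "C1_family S (\<lambda>t x. prod (f t x) (g t x))
     (\<lambda>t x. (prod_right (f t x) o\<^sub>L g' t x) + (prod_left (g t x) o\<^sub>L f' t x))"
  unfolding C1_family_def
proof (intro conjI ballI allI)
    show "continuous_on (S \<times> UNIV) (\<lambda>p. prod (f (fst p) (snd p)) (g (fst p) (snd p)))"
      by (intro continuous_on C1_familyD[OF f] C1_familyD[OF g])
    show "continuous_on (S \<times> UNIV) (\<lambda>p. (prod_right (f (fst p) (snd p)) o\<^sub>L g' (fst p) (snd p)) +
        (prod_left (g (fst p) (snd p)) o\<^sub>L f' (fst p) (snd p)))"
      by (intro continuous_intros C1_familyD[OF f] C1_familyD[OF g]
          bounded_linear.continuous_on[OF bounded_linear_prod_left]
          bounded_linear.continuous_on[OF bounded_linear_prod_right])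
    fix t x assume "t \<in> S"
    from FDERIV[OF C1_familyD(3)[OF f this] C1_familyD(3)[OF g this]]
    show "((\<lambda>x. prod (f t x) (g t x)) has_derivative
        blinfun_apply ((prod_right (f t x) o\<^sub>L g' t x) + (prod_left (g t x) o\<^sub>L f' t x))) (at x)"
      by (simp add: blinfun.add_left[abs_def])
qed

lemma C1_family_inverse:
  fixes f :: "'t::topological_space \<Rightarrow> 'a::real_normed_vector \<Rightarrow> real"
  assumes f: "C1_family S f f'" and nz: "\<And>t x. t \<in> S \<Longrightarrow> f t x \<noteq> 0"
  shows "C1_family S (\<lambda>t x. inverse (f t x)) (\<lambda>t x. (- (inverse (f t x))\<^sup>2) *\<^sub>R f' t x)"
  unfolding C1_family_def
proof (intro conjI ballI allI)
  show "continuous_on (S \<times> UNIV) (\<lambda>p. inverse (f (fst p) (snd p)))"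
    using nz by (intro continuous_intros C1_familyD[OF f]) auto
  show "continuous_on (S \<times> UNIV) (\<lambda>p. (- (inverse (f (fst p) (snd p)))\<^sup>2) *\<^sub>R f' (fst p) (snd p))"
    using nz by (intro continuous_intros C1_familyD[OF f]) auto
  fix t x assume "t \<in> S"
  then show "((\<lambda>x. inverse (f t x)) has_derivative
      blinfun_apply ((- (inverse (f t x))\<^sup>2) *\<^sub>R f' t x)) (at x)"
    using nz by (auto intro!: derivative_eq_intros C1_familyD[OF f]
        simp: blinfun.bilinear_simps power2_eq_square mult_ac)
qed

text \<open>An operator is the sum of its columns, each put back by the rank-one embedding
  \<open>E i\<close>, which sends \<open>u\<close> to the operator
  \<open>h \<mapsto> (h \<bullet> i) u\<close>. A derivative can therefore be differentiated again
  one direction at a time.\<close>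

lemma C1_family_blinfunI:
  fixes f :: "'t::topological_space \<Rightarrow> 'c::real_normed_vector \<Rightarrow> 'a::euclidean_space \<Rightarrow>\<^sub>L 'b::real_normed_vector"
  assumes "\<And>i. i \<in> Basis \<Longrightarrow> \<exists>f'. C1_family S (\<lambda>t x. f t x i) f'"
  shows "\<exists>f'. C1_family S f f'"
proof -
  define E :: "'a \<Rightarrow> 'b \<Rightarrow>\<^sub>L ('a \<Rightarrow>\<^sub>L 'b)"
    where "E i = Blinfun (\<lambda>u. blinfun_scaleR_left u o\<^sub>L blinfun_inner_left i)" for i
  have E: "blinfun_apply (E i) u = blinfun_scaleR_left u o\<^sub>L blinfun_inner_left i" for i u
    unfolding E_def
    by (subst bounded_linear_Blinfun_apply) (auto intro!: bounded_linear_intros)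
  obtain f' where "\<And>i. i \<in> Basis \<Longrightarrow> C1_family S (\<lambda>t x. f t x i) (f' i)"
    using assms by metis
  then have "C1_family S (\<lambda>t x. \<Sum>i\<in>Basis. E i (f t x i)) (\<lambda>t x. \<Sum>i\<in>Basis. E i o\<^sub>L f' i t x)"
    by (intro C1_family_sum C1_family_linear) 
  moreover have "(\<Sum>i\<in>Basis. E i (f t x i)) = f t x" for t x
    by (rule blinfun_euclidean_eqI)
      (simp add: E blinfun.sum_left inner_Basis if_distrib if_distribR cong: if_cong)
  ultimately show ?thesis by auto
qed

subsection \<open>Strongly convex potentials\<close>

lemma integrable_gaussian_real: "s > 0 \<Longrightarrow> integrable lborel (\<lambda>x::real. exp (- (s * x\<^sup>2)))"
proof -
  assume s: "s > 0"
  define \<sigma> where "\<sigma> = sqrt (1 / (2 * s))"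
  have \<sigma>: "\<sigma> > 0" "\<sigma>\<^sup>2 = 1 / (2 * s)" using s by (simp_all add: \<sigma>_def)
  have "integrable lborel (\<lambda>x. sqrt (2 * pi * \<sigma>\<^sup>2) * normal_density 0 \<sigma> x)"
    using \<sigma> by (intro integrable_mult_right) simp
  also have "(\<lambda>x. sqrt (2 * pi * \<sigma>\<^sup>2) * normal_density 0 \<sigma> x) = (\<lambda>x. exp (- (s * x\<^sup>2)))"
    using s \<sigma>(1) by (auto simp: normal_density_def \<sigma>(2) real_sqrt_mult)
  finally show ?thesis .
qed

lemma integrable_gaussian:
  assumes s: "s > 0"
  shows "integrable lborel (\<lambda>x::'a::euclidean_space. exp (- (s * (norm x)\<^sup>2)))"
proof -
  interpret product_sigma_finite "\<lambda>_::'a. lborel :: real measure" ..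
  have "integrable (\<Pi>\<^sub>M b\<in>Basis. lborel) (\<lambda>f. \<Prod>b\<in>(Basis::'a set). exp (- (s * (f b)\<^sup>2)))"
    by (intro product_integrable_prod integrable_gaussian_real s) auto
  also have "(\<lambda>f. \<Prod>b\<in>(Basis::'a set). exp (- (s * (f b)\<^sup>2))) =
      (\<lambda>f. exp (- (s * (norm (\<Sum>b\<in>Basis. f b *\<^sub>R b :: 'a))\<^sup>2)))"
  proof
    fix f :: "'a \<Rightarrow> real"
    have "(norm (\<Sum>b\<in>Basis. f b *\<^sub>R b :: 'a))\<^sup>2 = (\<Sum>b\<in>(Basis::'a set). (f b)\<^sup>2)"
      unfolding power2_norm_eq_inner by (subst euclidean_inner) (simp add: power2_eq_square)
    then show "(\<Prod>b\<in>(Basis::'a set). exp (- (s * (f b)\<^sup>2))) =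
        exp (- (s * (norm (\<Sum>b\<in>Basis. f b *\<^sub>R b :: 'a))\<^sup>2))"
      by (simp add: exp_sum[symmetric] sum_negf sum_distrib_left)
  qed
  finally show ?thesis
    unfolding lborel_eq[where 'a='a]
    by (subst integrable_distr_eq) auto
qed

text \<open>Half of the quadratic term absorbs the linear one:
  \<open>b r \<le> b^2 / (2 s) + s r^2 / 2\<close>. Integrands with a polynomial factor are covered
  too, since a power of \<open>norm x\<close> is dominated by an exponential of
  \<open>norm x\<close>.\<close>

lemma integrable_exp_linear_quadratic:
  assumes s: "s > 0"
  shows "integrable lborel (\<lambda>x::'a::euclidean_space. exp (b * norm x - s * (norm x)\<^sup>2))"
proof (rule Bochner_Integration.integrable_bound)
  show "integrable lborel (\<lambda>x::'a. exp (b\<^sup>2 / (2 * s)) * exp (- (s / 2 * (norm x)\<^sup>2)))"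
    using s by (intro integrable_mult_right integrable_gaussian) auto
  show "AE x in lborel. norm (exp (b * norm x - s * (norm x)\<^sup>2))
      \<le> norm (exp (b\<^sup>2 / (2 * s)) * exp (- (s / 2 * (norm (x::'a))\<^sup>2)))"
  proof (rule AE_I2)
    fix x :: 'a
    have "0 \<le> (b / s - norm x)\<^sup>2 * (s / 2)" using s by simp
    also have "\<dots> = b\<^sup>2 / (2 * s) - b * norm x + s / 2 * (norm x)\<^sup>2"
      using s by (simp add: power2_eq_square field_simps)
    finally show "norm (exp (b * norm x - s * (norm x)\<^sup>2))
      \<le> norm (exp (b\<^sup>2 / (2 * s)) * exp (- (s / 2 * (norm x)\<^sup>2)))"
      by (simp flip: exp_add)
  qed
qed simp

lemma
  fixes f :: "'a::euclidean_space \<Rightarrow> 'b::{banach, second_countable_topology}"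
  assumes [measurable]: "f \<in> borel_measurable borel"
  shows lborel_integral_translation: "(\<integral>x. f (c + x) \<partial>lborel) = (\<integral>x. f x \<partial>lborel)"
    and lborel_integrable_translation_iff: "integrable lborel (\<lambda>x. f (c + x)) \<longleftrightarrow> integrable lborel f"
  using integral_distr[of "(+) c" lborel borel f] integrable_distr_eq[of "(+) c" lborel borel f]
  by (simp_all add: lborel_distr_plus)

lemma integral_pos_lborel:
  fixes f :: "'a::euclidean_space \<Rightarrow> real"
  assumes "integrable lborel f" "\<And>y. f y > 0"
  shows "(\<integral>y. f y \<partial>lborel) > 0"
proof -
  have "(\<integral>y. f y \<partial>lborel) \<noteq> 0"
  proof
    assume "(\<integral>y. f y \<partial>lborel) = 0"
    then have "AE y in lborel. f y = 0"
      using integral_nonneg_eq_0_iff_AE[OF assms(1)] assms(2) by (auto intro: less_imp_le)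
    then have "AE y in (lborel :: 'a measure). False"
      by eventually_elim (use assms(2) in \<open>metis less_irrefl\<close>)
    then show False by (simp add: AE_iff_null emeasure_lborel_UNIV null_sets_def)
  qed
  moreover have "(\<integral>y. f y \<partial>lborel) \<ge> 0" using assms(2) by (intro integral_nonneg_AE) (auto intro: less_imp_le)
  ultimately show ?thesis by simp
qed

text \<open>A coordinate-free interface to the potentials: continuity of \<open>H\<close> gives the
  second derivative of the velocity, its bound \<open>L\<close> gives the Gaussian lower bound and
  the Lipschitz constant of the score, and \<open>\<alpha>\<close> gives the decay.\<close>

locale smooth_potential =
  fixes \<phi> :: "'a::euclidean_space \<Rightarrow> real" and g :: "'a \<Rightarrow> 'a" and H :: "'a \<Rightarrow> 'a \<Rightarrow>\<^sub>L 'a"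
    and L \<alpha> :: real
  assumes der: "(\<phi> has_derivative (\<lambda>h. g x \<bullet> h)) (at x)"
    and der2: "(g has_derivative blinfun_apply (H x)) (at x)"
    and contH: "continuous_on UNIV H"
    and boundH: "norm (H x) \<le> L"
    and \<alpha>: "\<alpha> > 0"
    and strongly_convex: "\<phi> x \<ge> \<phi> x' + g x' \<bullet> (x - x') + \<alpha> / 2 * (norm (x - x'))\<^sup>2"
begin

lemma L_nonneg: "L \<ge> 0"
  using boundH[of 0] norm_ge_zero[of "H 0"] by linarith

lemma continuous_\<phi> [continuous_intros]: "continuous_on S f \<Longrightarrow> continuous_on S (\<lambda>x. \<phi> (f x))"
  by (rule continuous_on_compose2[OF has_derivative_continuous_on[of UNIV, OF has_derivative_at_withinI[OF der]]]) auto

lemma continuous_g [continuous_intros]: "continuous_on S f \<Longrightarrow> continuous_on S (\<lambda>x. g (f x))"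
  by (rule continuous_on_compose2[OF has_derivative_continuous_on[of UNIV, OF has_derivative_at_withinI[OF der2]]]) auto

lemma continuous_H [continuous_intros]: "continuous_on S f \<Longrightarrow> continuous_on S (\<lambda>x. H (f x))"
  by (rule continuous_on_compose2[OF contH]) auto

lemma g_lipschitz: "norm (g x - g y) \<le> L * norm (x - y)"
  by (rule differentiable_bound[where S = UNIV and f' = "\<lambda>x. blinfun_apply (H x)"])
    (auto simp flip: norm_blinfun.rep_eq intro: der2 boundH)

lemma g_growth: "norm (g x) \<le> norm (g 0) + L * norm x"
  using g_lipschitz[of x 0] norm_triangle_ineq2[of "g x" "g 0"] by simp

text \<open>The gradient varies by at most \<open>L * norm (y - x)\<close> on the ball through
  \<open>y\<close>. The mean value inequality loses the factor 1/2 of Taylor's formula, which is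
  harmless: any fixed constant yields a Gaussian minorant.\<close>

lemma quadratic_upper: "\<phi> y \<le> \<phi> x + g x \<bullet> (y - x) + L * (norm (y - x))\<^sup>2"
proof -
  have "norm (\<phi> y - \<phi> x - g x \<bullet> (y - x)) \<le> norm (y - x) * (L * norm (y - x))"
  proof (rule differentiable_bound_linearization[where S = "cball x (norm (y - x))" and f' = "\<lambda>p h. g p \<bullet> h"])
    fix t :: real assume "t \<in> {0..1}"
    then show "x + t *\<^sub>R (y - x) \<in> cball x (norm (y - x))"
      using mult_right_mono[of t 1 "norm (y - x)"] by (auto simp: dist_norm)
  next
    fix p assume p: "p \<in> cball x (norm (y - x))"
    show "onorm ((\<lambda>h. g p \<bullet> h) - (\<lambda>h. g x \<bullet> h)) \<le> L * norm (y - x)"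
    proof (rule onorm_bound)
      fix h
      have "norm (((\<lambda>h. g p \<bullet> h) - (\<lambda>h. g x \<bullet> h)) h) = norm ((g p - g x) \<bullet> h)"
        by (simp add: inner_diff_left)
      also have "\<dots> \<le> norm (g p - g x) * norm h" using Cauchy_Schwarz_ineq2 by simp
      also have "\<dots> \<le> L * norm (y - x) * norm h"
      proof (rule mult_right_mono)
        have "norm (p - x) \<le> norm (y - x)" using p by (simp add: dist_norm norm_minus_commute)
        then show "norm (g p - g x) \<le> L * norm (y - x)"
          using g_lipschitz[of p x] mult_left_mono[OF _ L_nonneg] by (meson order_trans)
      qed simp
      finally show "norm (((\<lambda>h. g p \<bullet> h) - (\<lambda>h. g x \<bullet> h)) h) \<le> L * norm (y - x) * norm h" .
    qed (use L_nonneg in auto)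
  qed (auto intro: has_derivative_at_withinI der)
  then show ?thesis
    unfolding real_norm_def abs_le_iff by (simp add: power2_eq_square algebra_simps)
qed

text \<open>Convexity at 0, with the linear term absorbed by half of the quadratic one:
  \<open>norm (g 0) * norm x\<close> is at most
  \<open>(norm (g 0))^2 / \<alpha> + \<alpha> / 4 * (norm x)^2\<close>.\<close>

lemma quadratic_lower: "\<phi> x \<ge> \<phi> 0 - (norm (g 0))\<^sup>2 / \<alpha> + \<alpha> / 4 * (norm x)\<^sup>2"
proof -
  have "0 \<le> (norm (g 0) / \<alpha> - norm x / 2)\<^sup>2 * \<alpha>" using \<alpha> by simp
  also have "\<dots> = (norm (g 0))\<^sup>2 / \<alpha> - norm (g 0) * norm x + \<alpha> / 4 * (norm x)\<^sup>2"
    using \<alpha> by (simp add: power2_eq_square field_simps)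
  also have "\<dots> \<le> (norm (g 0))\<^sup>2 / \<alpha> + g 0 \<bullet> x + \<alpha> / 4 * (norm x)\<^sup>2"
    using norm_cauchy_schwarz[of "- g 0" x] by simp
  finally show ?thesis using strongly_convex[of 0 x] by simp
qed

lemma integrable_norm:
  "integrable (density lborel (\<lambda>x. ennreal (exp (- \<phi> x)))) (\<lambda>x. norm x)"
proof -
  have [measurable]: "\<phi> \<in> borel_measurable borel"
    by (intro borel_measurable_continuous_onI continuous_\<phi> continuous_on_id)
  define k where "k = \<phi> 0 - (norm (g 0))\<^sup>2 / \<alpha>"
  have "integrable lborel (\<lambda>x. exp (- \<phi> x) *\<^sub>R norm x)"
  proof (rule Bochner_Integration.integrable_bound)
    show "integrable lborel (\<lambda>x::'a. exp (- k) * exp (1 * norm x - \<alpha> / 4 * (norm x)\<^sup>2))"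
      using \<alpha> by (intro integrable_mult_right integrable_exp_linear_quadratic) auto
    show "AE x in lborel. norm (exp (- \<phi> x) *\<^sub>R norm x) \<le> norm (exp (- k) * exp (1 * norm x - \<alpha> / 4 * (norm (x::'a))\<^sup>2))"
    proof (rule AE_I2)
      fix x :: 'a
      have "norm x \<le> exp (norm x)" using exp_ge_add_one_self[of "norm x"] by linarith
      then have "exp (- \<phi> x) * norm x \<le> exp (- (k + \<alpha> / 4 * (norm x)\<^sup>2)) * exp (norm x)"
        using quadratic_lower[of x] by (intro mult_mono) (auto simp: k_def)
      also have "\<dots> = exp (- k) * exp (1 * norm x - \<alpha> / 4 * (norm x)\<^sup>2)"
        by (simp flip: exp_add)
      finally show "norm (exp (- \<phi> x) *\<^sub>R norm x) \<le> norm (exp (- k) * exp (1 * norm x - \<alpha> / 4 * (norm x)\<^sup>2))"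
        by simp
    qed
  qed simp
  then show ?thesis by (subst integrable_density) auto
qed

end

section \<open>The joint density of position and displacement, and its domination\<close>

locale potential_pair =
  p0: smooth_potential \<phi>0 g0 H0 L \<alpha> + p1: smooth_potential \<phi>1 g1 H1 L \<alpha>
  for \<phi>0 \<phi>1 :: "'a::euclidean_space \<Rightarrow> real" and g0 g1 :: "'a \<Rightarrow> 'a"
    and H0 H1 :: "'a \<Rightarrow> 'a \<Rightarrow>\<^sub>L 'a" and L \<alpha> :: real
begin

text \<open>Joint density of \<open>z = (1 - t) x0 + t x1\<close> and \<open>y = x1 - x0\<close>: the linear map
  \<open>(x0, x1) \<mapsto> (z, y)\<close> has determinant 1 for every \<open>t\<close>.\<close>

definition q :: "real \<Rightarrow> 'a \<Rightarrow> 'a \<Rightarrow> real"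
  where "q t z y = exp (- (\<phi>0 (z - t *\<^sub>R y) + \<phi>1 (z + (1 - t) *\<^sub>R y)))"

text \<open>The gradient in \<open>z\<close> of \<open>- ln (q t z y)\<close>, that is, minus the
  score of the joint density; \<open>DG\<close> below is its derivative in \<open>z\<close>.\<close>

definition G :: "real \<Rightarrow> 'a \<Rightarrow> 'a \<Rightarrow> 'a"
  where "G t z y = g0 (z - t *\<^sub>R y) + g1 (z + (1 - t) *\<^sub>R y)"

definition DG :: "real \<Rightarrow> 'a \<Rightarrow> 'a \<Rightarrow> 'a \<Rightarrow>\<^sub>L 'a"
  where "DG t z y = H0 (z - t *\<^sub>R y) + H1 (z + (1 - t) *\<^sub>R y)"

lemma q_pos: "q t z y > 0"
  by (simp add: q_def)

lemma continuous_q [continuous_intros]: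
  "continuous_on S a \<Longrightarrow> continuous_on S b \<Longrightarrow> continuous_on S c \<Longrightarrow> continuous_on S (\<lambda>x. q (a x) (b x) (c x))"
  unfolding q_def by (intro continuous_intros p0.continuous_\<phi> p1.continuous_\<phi>)

lemma continuous_G [continuous_intros]:
  "continuous_on S a \<Longrightarrow> continuous_on S b \<Longrightarrow> continuous_on S c \<Longrightarrow> continuous_on S (\<lambda>x. G (a x) (b x) (c x))"
  unfolding G_def by (intro continuous_intros p0.continuous_g p1.continuous_g)

lemma continuous_DG [continuous_intros]:
  "continuous_on S a \<Longrightarrow> continuous_on S b \<Longrightarrow> continuous_on S c \<Longrightarrow> continuous_on S (\<lambda>x. DG (a x) (b x) (c x))"
  unfolding DG_def by (intro continuous_intros p0.continuous_H p1.continuous_H)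

lemma q_has_derivative: "((\<lambda>z. q t z y) has_derivative (\<lambda>h. - (G t z y \<bullet> h) * q t z y)) (at z)"
proof -
  have "((\<lambda>z. \<phi>0 (z - t *\<^sub>R y)) has_derivative (\<lambda>h. g0 (z - t *\<^sub>R y) \<bullet> h)) (at z)"
    by (rule has_derivative_compose[of "\<lambda>z. z - t *\<^sub>R y" "\<lambda>h. h", OF _ p0.der])
      (auto intro!: derivative_eq_intros)
  moreover have "((\<lambda>z. \<phi>1 (z + (1 - t) *\<^sub>R y)) has_derivative (\<lambda>h. g1 (z + (1 - t) *\<^sub>R y) \<bullet> h)) (at z)"
    by (rule has_derivative_compose[of "\<lambda>z. z + (1 - t) *\<^sub>R y" "\<lambda>h. h", OF _ p1.der])
      (auto intro!: derivative_eq_intros)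
  ultimately show ?thesis
    unfolding q_def G_def by (auto intro!: derivative_eq_intros simp: inner_add_left)
qed

lemma G_has_derivative: "((\<lambda>z. G t z y) has_derivative blinfun_apply (DG t z y)) (at z)"
proof -
  have "((\<lambda>z. g0 (z - t *\<^sub>R y)) has_derivative blinfun_apply (H0 (z - t *\<^sub>R y))) (at z)"
    by (rule has_derivative_compose[of "\<lambda>z. z - t *\<^sub>R y" "\<lambda>h. h", OF _ p0.der2])
      (auto intro!: derivative_eq_intros)
  moreover have "((\<lambda>z. g1 (z + (1 - t) *\<^sub>R y)) has_derivative blinfun_apply (H1 (z + (1 - t) *\<^sub>R y))) (at z)"
    by (rule has_derivative_compose[of "\<lambda>z. z + (1 - t) *\<^sub>R y" "\<lambda>h. h", OF _ p1.der2])
      (auto intro!: derivative_eq_intros)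
  ultimately show ?thesis
    unfolding G_def DG_def by (auto intro!: derivative_eq_intros simp: blinfun.add_left)
qed

lemma norm_DG: "norm (DG t z y) \<le> 2 * L"
  unfolding DG_def using p0.boundH[of "z - t *\<^sub>R y"] p1.boundH[of "z + (1 - t) *\<^sub>R y"]
  by (intro norm_triangle_le) simp

definition Q :: real
  where "Q = exp (- (\<phi>0 0 - (norm (g0 0))\<^sup>2 / \<alpha> + (\<phi>1 0 - (norm (g1 0))\<^sup>2 / \<alpha>)))"

text \<open>The two arguments of the potentials differ by exactly \<open>y\<close>, so they cannot
  both be small when \<open>y\<close> is large, wherever \<open>z\<close> lies:
  \<open>(norm y)^2\<close> is at most twice the sum of their squared norms. This turns the rate
  \<open>\<alpha> / 4\<close> of \<open>quadratic_lower\<close> into \<open>\<alpha> / 8\<close>,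
  and \<open>Q\<close> collects the constants of the two lower bounds.\<close>

lemma q_bound: "q t z y \<le> Q * exp (- (\<alpha> / 8 * (norm y)\<^sup>2))"
proof -
  let ?a = "z - t *\<^sub>R y" and ?b = "z + (1 - t) *\<^sub>R y"
  have "?b - ?a = y" by (simp add: algebra_simps)
  then have "norm y \<le> norm ?a + norm ?b" by (metis add.commute norm_triangle_ineq4)
  then have "(norm y)\<^sup>2 \<le> (norm ?a + norm ?b)\<^sup>2" by (intro power_mono) auto
  also have "\<dots> \<le> 2 * ((norm ?a)\<^sup>2 + (norm ?b)\<^sup>2)"
    using sum_squares_bound[of "norm ?a" "norm ?b"] by (simp add: power2_sum)
  finally have "\<alpha> / 8 * (norm y)\<^sup>2 \<le> \<alpha> / 8 * (2 * ((norm ?a)\<^sup>2 + (norm ?b)\<^sup>2))"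
    using p0.\<alpha> by (intro mult_left_mono) auto
  then have "\<alpha> / 8 * (norm y)\<^sup>2 \<le> \<alpha> / 4 * (norm ?a)\<^sup>2 + \<alpha> / 4 * (norm ?b)\<^sup>2"
    by (simp add: algebra_simps)
  then show ?thesis
    unfolding q_def Q_def using p0.quadratic_lower[of ?a] p1.quadratic_lower[of ?b]
    by (simp flip: exp_add)
qed

text \<open>One affine majorant for every factor that differentiation produces, valid for
  \<open>norm z \<le> r\<close>. The summand 1 makes it at least 1, so that lower powers are bounded
  by higher ones.\<close>

definition P :: "real \<Rightarrow> 'a \<Rightarrow> real"
  where "P r y = norm (g0 0) + norm (g1 0) + 2 * L + 1 + (2 * L + 1) * (r + norm y)"

lemma P_bounds:
  assumes "t \<in> {0..1}" "norm z \<le> r"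
  shows "norm (G t z y) \<le> P r y" "norm (y, 1::real) \<le> P r y" "2 * L \<le> P r y" "1 \<le> P r y"
proof -
  have r: "r \<ge> 0" using assms norm_ge_zero order_trans by blast
  have nonneg: "0 \<le> L * r" "0 \<le> L * norm y" using p0.L_nonneg r by auto
  have "norm (z - t *\<^sub>R y) \<le> r + norm y"
    using assms norm_triangle_ineq4[of z "t *\<^sub>R y"] mult_right_mono[of t 1 "norm y"] by auto
  then have 0: "L * norm (z - t *\<^sub>R y) \<le> L * (r + norm y)"
    using p0.L_nonneg by (intro mult_left_mono)
  have "norm (z + (1 - t) *\<^sub>R y) \<le> r + norm y"
    using assms norm_triangle_ineq[of z "(1 - t) *\<^sub>R y"] mult_right_mono[of "1 - t" 1 "norm y"] by auto
  then have 1: "L * norm (z + (1 - t) *\<^sub>R y) \<le> L * (r + norm y)"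
    using p0.L_nonneg by (intro mult_left_mono)
  have P: "P r y = norm (g0 0) + norm (g1 0) + 2 * L + 1 + 2 * (L * (r + norm y)) + r + norm y"
    by (simp add: P_def algebra_simps)
  show "norm (G t z y) \<le> P r y"
    using norm_triangle_ineq[of "g0 (z - t *\<^sub>R y)" "g1 (z + (1 - t) *\<^sub>R y)"]
      p0.g_growth[of "z - t *\<^sub>R y"] p1.g_growth[of "z + (1 - t) *\<^sub>R y"] 0 1 p0.L_nonneg r norm_ge_zero[of y]
    unfolding G_def P by linarith
  show "norm (y, 1::real) \<le> P r y"
    using norm_Pair_le[of y "1::real"] p0.L_nonneg r nonneg norm_ge_zero[of "g0 0"] norm_ge_zero[of "g1 0"]
    unfolding P distrib_left norm_one by linarith
  show "2 * L \<le> P r y" "1 \<le> P r y"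
    using p0.L_nonneg r nonneg unfolding P_def by (simp_all add: algebra_simps)
qed

text \<open>The cube comes from the worst integrand, the second derivative: two factors
  \<open>G\<close>, or one \<open>DG\<close>, make at most \<open>2 P^2\<close>, and the weight
  \<open>W y\<close> contributes one more \<open>P\<close>.\<close>

definition dom :: "real \<Rightarrow> 'a \<Rightarrow> real"
  where "dom r y = 2 * P r y ^ 3 * (Q * exp (- (\<alpha> / 8 * (norm y)\<^sup>2)))"

lemma integrable_dom: "r \<ge> 0 \<Longrightarrow> integrable lborel (dom r)"
proof (rule Bochner_Integration.integrable_bound)
  \<comment> \<open>\<open>54 = 2 * 27\<close>: cubing \<open>P / 3 \<le> exp (P / 3)\<close> gives
    \<open>P^3 \<le> 27 * exp P\<close>, and \<open>dom\<close> carries the factor 2. Splitting the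
    affine \<open>P r y\<close> at \<open>y = 0\<close> leaves \<open>exp (P r 0)\<close>.\<close>
  let ?c = "54 * Q * exp (P r 0)"
  show "integrable lborel (\<lambda>y::'a. ?c * exp ((2 * L + 1) * norm y - \<alpha> / 8 * (norm y)\<^sup>2))"
    using p0.\<alpha> by (intro integrable_mult_right integrable_exp_linear_quadratic) auto
  show "dom r \<in> borel_measurable lborel"
    unfolding dom_def P_def by measurable
  assume r: "r \<ge> 0"
  show "AE y in lborel. norm (dom r y) \<le> norm (?c * exp ((2 * L + 1) * norm y - \<alpha> / 8 * (norm (y::'a))\<^sup>2))"
  proof (rule AE_I2)
    fix y :: 'a
    have P: "1 \<le> P r y" using P_bounds(4)[of 0 0 r y] r by auto
    have "P r y / 3 \<le> exp (P r y / 3)" using exp_ge_add_one_self[of "P r y / 3"] by linarith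
    then have "(P r y / 3) ^ 3 \<le> exp (P r y / 3) ^ 3" using P by (intro power_mono) auto
    also have "exp (P r y / 3) ^ 3 = exp (P r y)" by (simp flip: exp_of_nat_mult)
    finally have "P r y ^ 3 \<le> 27 * exp (P r y)" by (simp add: power_divide)
    moreover have "P r y = P r 0 + (2 * L + 1) * norm y" by (simp add: P_def algebra_simps)
    ultimately have P3: "P r y ^ 3 \<le> 27 * exp (P r 0 + (2 * L + 1) * norm y)" by simp
    have "2 * P r y ^ 3 * (Q * exp (- (\<alpha> / 8 * (norm y)\<^sup>2)))
        \<le> 2 * (27 * exp (P r 0 + (2 * L + 1) * norm y)) * (Q * exp (- (\<alpha> / 8 * (norm y)\<^sup>2)))"
      using P P3 by (intro mult_mono) (auto simp: Q_def)
    moreover have "0 \<le> dom r y" using P by (auto simp: dom_def Q_def)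
    ultimately show "norm (dom r y) \<le> norm (?c * exp ((2 * L + 1) * norm y - \<alpha> / 8 * (norm y)\<^sup>2))"
      by (simp add: dom_def Q_def exp_add diff_conv_add_uminus mult_ac del: add_uminus_conv_diff)
  qed
qed

lemma dom_ge:
  assumes "t \<in> {0..1}" "norm z \<le> r" "x \<le> 2 * P r y ^ 3" "x \<ge> 0"
  shows "x * q t z y \<le> dom r y"
  unfolding dom_def using assms q_bound[of t z y] q_pos[of t z y] P_bounds(4)[OF assms(1,2), of y]
  by (intro mult_mono) auto

lemma integrable_dominated:
  fixes k :: "'a \<Rightarrow> 'b::{banach, second_countable_topology}"
  assumes "continuous_on UNIV k" "\<And>y. norm (k y) \<le> dom r y" "r \<ge> 0"
  shows "integrable lborel k"
  using assms(2) by (intro Bochner_Integration.integrable_bound[OF integrable_dom[OF \<open>r \<ge> 0\<close>]])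
    (auto intro!: borel_measurable_continuous_onI assms(1) AE_I2 order_trans[OF assms(2)])

text \<open>\<open>dom (norm z + 1)\<close> dominates on the unit ball around \<open>z\<close>, for
  all times at once, so both lemmas on parametric integrals apply. The value of the derivative is
  part of the conclusion because its columns are integrals that get differentiated again.\<close>

lemma C1_family_integral:
  fixes k :: "real \<Rightarrow> 'a \<Rightarrow> 'a \<Rightarrow> 'b::euclidean_space" and k' :: "real \<Rightarrow> 'a \<Rightarrow> 'a \<Rightarrow> 'a \<Rightarrow>\<^sub>L 'b"
  assumes cont: "continuous_on UNIV (\<lambda>(t, z, y). k t z y)"
    and cont': "continuous_on UNIV (\<lambda>(t, z, y). k' t z y)"
    and bound: "\<And>t z y r. t \<in> {0..1} \<Longrightarrow> norm z \<le> r \<Longrightarrow> norm (k t z y) \<le> dom r y"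
    and bound': "\<And>t z y r. t \<in> {0..1} \<Longrightarrow> norm z \<le> r \<Longrightarrow> norm (k' t z y) \<le> dom r y"
    and der: "\<And>t z y. ((\<lambda>z. k t z y) has_derivative blinfun_apply (k' t z y)) (at z)"
  shows "\<exists>f'. C1_family {0..1} (\<lambda>t z. \<integral>y. k t z y \<partial>lborel) f' \<and>
    (\<forall>t\<in>{0..1}. \<forall>z i. blinfun_apply (f' t z) i = (\<integral>y. k' t z y i \<partial>lborel))"
proof -
  have cont_comp: "continuous_on S (\<lambda>x. k (a x) (b x) (c x))"
    if "continuous_on S a" "continuous_on S b" "continuous_on S c" for S :: "'s::topological_space set" and a b c
    by (rule continuous_on_compose2[OF cont, of S "\<lambda>x. (a x, b x, c x)", simplified])
      (intro continuous_intros that)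
  have cont'_comp: "continuous_on S (\<lambda>x. k' (a x) (b x) (c x))"
    if "continuous_on S a" "continuous_on S b" "continuous_on S c" for S :: "'s::topological_space set" and a b c
    by (rule continuous_on_compose2[OF cont', of S "\<lambda>x. (a x, b x, c x)", simplified])
      (intro continuous_intros that)
  have deriv: "((\<lambda>z. \<integral>y. k t z y \<partial>lborel) has_derivative (\<lambda>i. \<integral>y. k' t z y i \<partial>lborel)) (at z)"
    if t: "t \<in> {0..1}" for t z
  proof (rule has_derivative_integral_param[OF der])
    show "integrable lborel (k t p)" for p
      by (rule integrable_dominated[of _ "norm p"]) (auto intro!: cont_comp continuous_intros bound t)
    show "(\<lambda>y. k' t p y i) \<in> borel_measurable lborel" for p i
      by (simp, intro borel_measurable_continuous_onI continuous_intros cont'_comp)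
    show "\<exists>U B. open U \<and> z \<in> U \<and> integrable lborel B \<and> (\<forall>p\<in>U. \<forall>y. norm (k' t p y) \<le> B y)"
    proof (intro exI conjI ballI allI)
      show "integrable lborel (dom (norm z + 1))" by (rule integrable_dom) auto
      fix p y assume "p \<in> ball z 1"
      then show "norm (k' t p y) \<le> dom (norm z + 1) y"
        using norm_triangle_ineq2[of p z] by (intro bound' t) (auto simp: dist_norm norm_minus_commute)
    qed auto
  qed
  have cont_int: "continuous_on ({0..1} \<times> UNIV) (\<lambda>p. \<integral>y. m (fst p) (snd p) y \<partial>lborel)"
    if m: "\<And>y. continuous_on ({0..1} \<times> UNIV) (\<lambda>p. m (fst p) (snd p) y)"
      "\<And>t z. continuous_on UNIV (m t z)"
      "\<And>t z y r. t \<in> {0..1} \<Longrightarrow> norm z \<le> r \<Longrightarrow> norm (m t z y) \<le> dom r y"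
    for m :: "real \<Rightarrow> 'a \<Rightarrow> 'a \<Rightarrow> 'b"
  proof (rule continuous_on_integral_param[OF m(1)])
    show "m (fst p) (snd p) \<in> borel_measurable lborel" for p
      by (simp, intro borel_measurable_continuous_onI m)
    fix p :: "real \<times> 'a" assume "p \<in> {0..1} \<times> UNIV"
    show "\<exists>U B. open U \<and> p \<in> U \<and> integrable lborel B \<and>
        (\<forall>q\<in>{0..1} \<times> UNIV \<inter> U. \<forall>y. norm (m (fst q) (snd q) y) \<le> B y)"
    proof (intro exI conjI ballI allI)
      show "open (UNIV \<times> ball (snd p) 1 :: (real \<times> 'a) set)" by (intro open_Times) auto
      show "p \<in> UNIV \<times> ball (snd p) 1" by (auto simp: mem_Times_iff)
      show "integrable lborel (\<lambda>y. dom (norm (snd p) + 1) y)"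
        by (intro integrable_dom) auto
      fix x :: "real \<times> 'a" and y assume "x \<in> {0..1} \<times> UNIV \<inter> UNIV \<times> ball (snd p) 1"
      then show "norm (m (fst x) (snd x) y) \<le> dom (norm (snd p) + 1) y"
        using norm_triangle_ineq2[of "snd x" "snd p"]
        by (intro m(3)) (auto simp: dist_norm norm_minus_commute)
    qed
  qed
  define f' where "f' t z = Blinfun (\<lambda>i. \<integral>y. k' t z y i \<partial>lborel)" for t z
  have f': "blinfun_apply (f' t z) = (\<lambda>i. \<integral>y. k' t z y i \<partial>lborel)" if "t \<in> {0..1}" for t z
    unfolding f'_def by (rule bounded_linear_Blinfun_apply[OF has_derivative_bounded_linear[OF deriv[OF that]]])
  have "C1_family {0..1} (\<lambda>t z. \<integral>y. k t z y \<partial>lborel) f'"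
    unfolding C1_family_def
  proof (intro conjI ballI allI)
    show "continuous_on ({0..1} \<times> UNIV) (\<lambda>p. \<integral>y. k (fst p) (snd p) y \<partial>lborel)"
      by (rule cont_int) (auto intro!: cont_comp continuous_intros bound)
    show "continuous_on ({0..1} \<times> UNIV) (\<lambda>p. f' (fst p) (snd p))"
    proof (rule continuous_on_blinfun_componentwise)
      fix i :: 'a assume i: "i \<in> Basis"
      have "continuous_on ({0..1} \<times> UNIV) (\<lambda>p. \<integral>y. k' (fst p) (snd p) y i \<partial>lborel)"
      proof (rule cont_int)
        fix t r :: real and z y :: 'a assume "t \<in> {0..1}" "norm z \<le> r"
        then show "norm (k' t z y i) \<le> dom r y"
          using norm_blinfun[of "k' t z y" i] bound'[of t z r y] i by simp
      qed (auto intro!: cont'_comp continuous_intros)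
      then show "continuous_on ({0..1} \<times> UNIV) (\<lambda>p. f' (fst p) (snd p) i)"
        by (rule continuous_on_eq) (auto simp: f')
    qed
  qed (simp add: f' deriv)
  then show ?thesis by (intro exI[of _ f']) (simp add: f')
qed

end

text \<open>The derivatives are hidden because closure under products and inverses makes them
  unwieldy; where a formula for the derivative of the velocity is needed, it is rebuilt from that of
  \<open>M\<close>.\<close>

definition C2_family ::
  "'t::topological_space set \<Rightarrow> ('t \<Rightarrow> 'a::real_normed_vector \<Rightarrow> 'b::real_normed_vector) \<Rightarrow> bool"
  where "C2_family S f \<longleftrightarrow> (\<exists>f' f''. C1_family S f f' \<and> C1_family S f' f'')"

lemma C1_family_cong:
  assumes "C1_family S f f'" "\<And>t x. t \<in> S \<Longrightarrow> g t x = f t x"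
  shows "C1_family S g f'"
  unfolding C1_family_def
proof (intro conjI ballI allI)
  show "continuous_on (S \<times> UNIV) (\<lambda>p. g (fst p) (snd p))"
    using C1_familyD(1)[OF assms(1)] by (rule continuous_on_eq) (auto simp: assms)
  fix t x assume t: "t \<in> S"
  then have "g t = f t" using assms(2) by blast
  then show "(g t has_derivative blinfun_apply (f' t x)) (at x)"
    using C1_familyD(3)[OF assms(1) t] by simp
qed (rule C1_familyD(2)[OF assms(1)])

lemma C1_family_bounded_linear:
  assumes "bounded_linear L" "C1_family S f f'"
  shows "\<exists>h'. C1_family S (\<lambda>t x. L (f t x)) h'"
  using C1_family_linear[OF assms(2), of "Blinfun L"] assms(1)
  by (auto simp: bounded_linear_Blinfun_apply)

lemma C2_family_linear:
  assumes "bounded_linear L" and "C2_family S f"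
  shows "C2_family S (\<lambda>t x. L (f t x))"
proof -
  obtain f' f'' where f: "C1_family S f f'" "C1_family S f' f''" using assms by (auto simp: C2_family_def)
  have "C1_family S (\<lambda>t x. L (f t x)) (\<lambda>t x. Blinfun L o\<^sub>L f' t x)"
    using C1_family_linear[OF f(1), of "Blinfun L"] assms(1) by (simp add: bounded_linear_Blinfun_apply)
  moreover have "\<exists>h''. C1_family S (\<lambda>t x. Blinfun L o\<^sub>L f' t x) h''"
    by (rule C1_family_bounded_linear[OF _ f(2), of "\<lambda>u. Blinfun L o\<^sub>L u"]) (auto intro!: bounded_linear_intros)
  ultimately show ?thesis by (auto simp: C2_family_def)
qed

lemma C2_family_bilinear:
  assumes bl: "bounded_bilinear mul" and "C2_family S f" "C2_family S g"
  shows "C2_family S (\<lambda>t x. mul (f t x) (g t x))"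
proof -
  interpret bounded_bilinear mul by fact
  obtain f' f'' where f: "C1_family S f f'" "C1_family S f' f''" using assms by (auto simp: C2_family_def)
  obtain g' g'' where g: "C1_family S g g'" "C1_family S g' g''" using assms by (auto simp: C2_family_def)
  obtain a where a: "C1_family S (\<lambda>t x. prod_right (f t x)) a"
    using C1_family_bounded_linear[OF bounded_linear_prod_right f(1)] by blast
  obtain b where b: "C1_family S (\<lambda>t x. prod_left (g t x)) b"
    using C1_family_bounded_linear[OF bounded_linear_prod_left g(1)] by blast
  obtain h1 where h1: "C1_family S (\<lambda>t x. prod_right (f t x) o\<^sub>L g' t x) h1"
    using bounded_bilinear.C1_family[OF bounded_bilinear_blinfun_compose a g(2)] by blast
  obtain h2 where h2: "C1_family S (\<lambda>t x. prod_left (g t x) o\<^sub>L f' t x) h2"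
    using bounded_bilinear.C1_family[OF bounded_bilinear_blinfun_compose b f(2)] by blast
  show ?thesis
    unfolding C2_family_def
    using C1_family[OF f(1) g(1)] C1_family_add[OF h1 h2] by blast
qed

lemma C2_family_inverse:
  fixes f :: "'t::topological_space \<Rightarrow> 'a::real_normed_vector \<Rightarrow> real"
  assumes "C2_family S f" and nz: "\<And>t x. t \<in> S \<Longrightarrow> f t x \<noteq> 0"
  shows "C2_family S (\<lambda>t x. inverse (f t x))"
proof -
  obtain f' f'' where f: "C1_family S f f'" "C1_family S f' f''" using assms by (auto simp: C2_family_def)
  note inv = C1_family_inverse[OF f(1) nz]
  obtain h1 where h1: "C1_family S (\<lambda>t x. inverse (f t x) * inverse (f t x)) h1"
    using bounded_bilinear.C1_family[OF bounded_bilinear_mult inv inv] by blast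
  obtain h2 where "C1_family S (\<lambda>t x. - (inverse (f t x) * inverse (f t x))) h2"
    using C1_family_bounded_linear[OF bounded_linear_minus[OF bounded_linear_ident] h1] by blast
  from bounded_bilinear.C1_family[OF bounded_bilinear_scaleR this f(2)] inv
  show ?thesis by (auto simp: C2_family_def power2_eq_square)
qed

subsection \<open>Smoothness of the velocity field\<close>

context potential_pair
begin

text \<open>Pairing \<open>y\<close> with 1 makes the first moment and the normaliser two components
  of one vector integral, so that differentiation under the integral is done once for both.\<close>

definition W :: "'a \<Rightarrow> 'a \<times> real" where "W y = (y, 1)"

definition M :: "real \<Rightarrow> 'a \<Rightarrow> 'a \<times> real"
  where "M t z = (\<integral>y. q t z y *\<^sub>R W y \<partial>lborel)"

lemma continuous_W [continuous_intros]: "continuous_on S f \<Longrightarrow> continuous_on S (\<lambda>x. W (f x))"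
  unfolding W_def by (intro continuous_intros)

lemma power_P_mono:
  fixes t :: real and z :: 'a
  assumes "t \<in> {0..1}" "norm z \<le> r" "i \<le> 3"
  shows "P r y ^ i \<le> 2 * P r y ^ 3"
proof -
  have P: "1 \<le> P r y" by (rule P_bounds[OF assms(1,2)])
  have "P r y ^ i \<le> P r y ^ 3" using P assms by (intro power_increasing) auto
  also have "\<dots> \<le> 2 * P r y ^ 3" using P by simp
  finally show ?thesis .
qed

lemma norm_qW:
  assumes "t \<in> {0..1}" "norm z \<le> r"
  shows "norm (q t z y *\<^sub>R W y) \<le> dom r y"
    and "norm (- (G t z y \<bullet> i) *\<^sub>R (q t z y *\<^sub>R W y)) \<le> norm i * dom r y"
proof -
  note PB = P_bounds[OF assms, of y]
  have "norm (q t z y *\<^sub>R W y) = norm (W y) * q t z y" using q_pos[of t z y] by simp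
  also have "\<dots> \<le> dom r y"
    using PB power_P_mono[OF assms, of 1 y] by (intro dom_ge assms) (auto simp: W_def)
  finally show "norm (q t z y *\<^sub>R W y) \<le> dom r y" .
  have "norm (- (G t z y \<bullet> i) *\<^sub>R (q t z y *\<^sub>R W y)) = \<bar>G t z y \<bullet> i\<bar> * norm (W y) * q t z y"
    using q_pos[of t z y] by (simp add: abs_mult)
  also have "\<dots> \<le> (norm (G t z y) * norm i) * norm (W y) * q t z y"
    using q_pos[of t z y] by (intro mult_right_mono Cauchy_Schwarz_ineq2) auto
  also have "\<dots> = norm i * ((norm (G t z y) * norm (W y)) * q t z y)" by simp
  also have "\<dots> \<le> norm i * dom r y"
  proof (intro mult_left_mono dom_ge assms)
    have "norm (G t z y) * norm (W y) \<le> P r y * P r y"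
      using PB by (intro mult_mono) (auto simp: W_def)
    also have "\<dots> \<le> 2 * P r y ^ 3"
      using power_P_mono[OF assms, of 2 y] by (simp add: power2_eq_square)
    finally show "norm (G t z y) * norm (W y) \<le> 2 * P r y ^ 3" .
  qed auto
  finally show "norm (- (G t z y \<bullet> i) *\<^sub>R (q t z y *\<^sub>R W y)) \<le> norm i * dom r y" .
qed

lemma integrable_qW: "t \<in> {0..1} \<Longrightarrow> integrable lborel (\<lambda>y. q t z y *\<^sub>R W y)"
  by (rule integrable_dominated[of _ "norm z"]) (auto intro!: continuous_intros norm_qW simp del: norm_scaleR)

lemma integrable_DqW:
  assumes t: "t \<in> {0..1}"
  shows "integrable lborel (\<lambda>y. - (G t z y \<bullet> i) *\<^sub>R (q t z y *\<^sub>R W y))"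
proof (rule Bochner_Integration.integrable_bound)
  show "integrable lborel (\<lambda>y. norm i * dom (norm z) y)" by (intro integrable_mult_right integrable_dom) auto
  show "(\<lambda>y. - (G t z y \<bullet> i) *\<^sub>R q t z y *\<^sub>R W y) \<in> borel_measurable lborel"
    by (simp, intro borel_measurable_continuous_onI continuous_intros)
  show "AE y in lborel. norm (- (G t z y \<bullet> i) *\<^sub>R q t z y *\<^sub>R W y) \<le> norm (norm i * dom (norm z) y)"
    using norm_qW(2)[OF t order_refl] by (intro AE_I2) (metis abs_ge_self order_trans real_norm_def)
qed

text \<open>Each \<open>z\<close>-derivative falls on \<open>q\<close>, giving a factor
  \<open>- G\<close>, or on an earlier \<open>G\<close>, giving \<open>DG\<close>. After two of them
  the integrand is still polynomial growth times the Gaussian, and the Hessians occur only inside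
  \<open>DG\<close>.\<close>

lemma C2_M:
  "\<exists>M' M''. C1_family {0..1} M M' \<and> C1_family {0..1} M' M'' \<and>
    (\<forall>t\<in>{0..1}. \<forall>z i. blinfun_apply (M' t z) i = (\<integral>y. - (G t z y \<bullet> i) *\<^sub>R (q t z y *\<^sub>R W y) \<partial>lborel))"
proof -
  define k' where "k' t z y = blinfun_scaleR_left (- (q t z y *\<^sub>R W y)) o\<^sub>L blinfun_inner_left (G t z y)" for t z y
  have k': "blinfun_apply (k' t z y) i = - (G t z y \<bullet> i) *\<^sub>R (q t z y *\<^sub>R W y)" for t z y i
    by (simp add: k'_def inner_commute)
  have "\<exists>M'. C1_family {0..1} (\<lambda>t z. \<integral>y. q t z y *\<^sub>R W y \<partial>lborel) M' \<and>
      (\<forall>t\<in>{0..1}. \<forall>z i. blinfun_apply (M' t z) i = (\<integral>y. k' t z y i \<partial>lborel))"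
  proof (rule C1_family_integral)
    show "continuous_on UNIV (\<lambda>(t, z, y). q t z y *\<^sub>R W y)"
      unfolding case_prod_beta' by (intro continuous_intros)
    show "continuous_on UNIV (\<lambda>(t, z, y). k' t z y)"
      unfolding case_prod_beta' k'_def
      by (intro continuous_intros bounded_linear.continuous_on[OF bounded_linear_blinfun_scaleR_left]
          bounded_linear.continuous_on[OF bounded_linear_blinfun_inner_left])
    fix t r :: real and z y :: 'a assume tz: "t \<in> {0..1}" "norm z \<le> r"
    show "norm (q t z y *\<^sub>R W y) \<le> dom r y" by (rule norm_qW[OF tz])
    have "0 \<le> dom r y" using norm_qW(1)[OF tz, of y] norm_ge_zero order_trans by blast
    then show "norm (k' t z y) \<le> dom r y"
      using norm_qW(2)[OF tz, of y] by (intro norm_blinfun_bound) (simp_all only: k' mult.commute)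
  next
    fix t and z y :: 'a
    show "((\<lambda>z. q t z y *\<^sub>R W y) has_derivative blinfun_apply (k' t z y)) (at z)"
      unfolding k'_def by (auto intro!: derivative_eq_intros q_has_derivative simp: inner_commute)
  qed
  then obtain M' where M': "C1_family {0..1} M M'"
    "\<And>t z i. t \<in> {0..1} \<Longrightarrow> blinfun_apply (M' t z) i = (\<integral>y. - (G t z y \<bullet> i) *\<^sub>R (q t z y *\<^sub>R W y) \<partial>lborel)"
    unfolding M_def[abs_def] k' by auto
  have "\<exists>M''. C1_family {0..1} M' M''"
  proof (rule C1_family_blinfunI)
    fix i :: 'a assume i: "i \<in> Basis"
    then have [simp]: "norm i = 1" by simp
    \<comment> \<open>\<open>l t z y h * q t z y\<close> is the second derivative of
      \<open>q\<close> in the directions \<open>i\<close> and \<open>h\<close>: the product of two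
      scores minus the Hessian term.\<close>
    define l where "l t z y = (G t z y \<bullet> i) *\<^sub>R blinfun_inner_left (G t z y) - (blinfun_inner_left i o\<^sub>L DG t z y)" for t z y
    define k'' where "k'' t z y = blinfun_scaleR_left (q t z y *\<^sub>R W y) o\<^sub>L l t z y" for t z y
    have "\<exists>f'. C1_family {0..1} (\<lambda>t z. \<integral>y. - (G t z y \<bullet> i) *\<^sub>R (q t z y *\<^sub>R W y) \<partial>lborel) f' \<and>
      (\<forall>t\<in>{0..1}. \<forall>z j. blinfun_apply (f' t z) j = (\<integral>y. k'' t z y j \<partial>lborel))"
    proof (rule C1_family_integral)
      show "continuous_on UNIV (\<lambda>(t, z, y). - (G t z y \<bullet> i) *\<^sub>R (q t z y *\<^sub>R W y))"
        unfolding case_prod_beta' by (intro continuous_intros)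
      show "continuous_on UNIV (\<lambda>(t, z, y). k'' t z y)"
        unfolding case_prod_beta' k''_def l_def
        by (intro continuous_intros bounded_linear.continuous_on[OF bounded_linear_blinfun_scaleR_left]
            bounded_linear.continuous_on[OF bounded_linear_blinfun_inner_left])
      fix t r :: real and z y :: 'a assume tz: "t \<in> {0..1}" "norm z \<le> r"
      show "norm (- (G t z y \<bullet> i) *\<^sub>R (q t z y *\<^sub>R W y)) \<le> dom r y"
        using norm_qW(2)[OF tz, of y i] by simp
      note PB = P_bounds[OF tz, of y]
      have P0: "0 \<le> P r y" using PB by linarith
      have "norm (l t z y) \<le> 2 * P r y ^ 2"
      proof (rule norm_blinfun_bound)
        fix h
        have "norm (l t z y h) = \<bar>(G t z y \<bullet> i) * (G t z y \<bullet> h) - DG t z y h \<bullet> i\<bar>"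
          by (simp add: l_def blinfun.bilinear_simps inner_commute)
        also have "\<dots> \<le> \<bar>G t z y \<bullet> i\<bar> * \<bar>G t z y \<bullet> h\<bar> + \<bar>DG t z y h \<bullet> i\<bar>"
          using abs_triangle_ineq4 by (metis abs_mult)
        also have "\<dots> \<le> (P r y * 1) * (P r y * norm h) + (2 * L * norm h) * 1"
        proof (intro add_mono mult_mono)
          show "\<bar>G t z y \<bullet> i\<bar> \<le> P r y * 1"
            using Cauchy_Schwarz_ineq2[of "G t z y" i] PB(1) by simp
          show "\<bar>G t z y \<bullet> h\<bar> \<le> P r y * norm h"
            using Cauchy_Schwarz_ineq2[of "G t z y" h] mult_right_mono[OF PB(1) norm_ge_zero[of h]] by linarith
          have "\<bar>DG t z y h \<bullet> i\<bar> \<le> norm (DG t z y h)"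
            using Cauchy_Schwarz_ineq2[of "DG t z y h" i] by simp
          also have "\<dots> \<le> norm (DG t z y) * norm h" by (rule norm_blinfun)
          also have "\<dots> \<le> 2 * L * norm h" by (intro mult_right_mono norm_DG) auto
          finally show "\<bar>DG t z y h \<bullet> i\<bar> \<le> (2 * L * norm h) * 1" by simp
        qed (use P0 in auto)
        also have "\<dots> \<le> P r y ^ 2 * norm h + P r y ^ 2 * norm h"
        proof -
          have "2 * L \<le> P r y ^ 2"
            using PB mult_mono[OF PB(4) PB(3)] P0 p0.L_nonneg by (simp add: power2_eq_square)
          from mult_right_mono[OF this norm_ge_zero[of h]] show ?thesis by (simp add: power2_eq_square mult_ac)
        qed
        finally show "norm (l t z y h) \<le> 2 * P r y ^ 2 * norm h" by (simp add: mult_ac)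
      qed simp
      then have lW: "norm (l t z y) * norm (W y) \<le> 2 * P r y ^ 2 * P r y"
        using PB P0 by (intro mult_mono) (auto simp: W_def)
      have "norm (k'' t z y) \<le> norm (l t z y) * norm (W y) * q t z y"
      proof (rule norm_blinfun_bound)
        fix h
        have "norm (k'' t z y h) = norm (l t z y h) * (norm (W y) * q t z y)"
          using q_pos[of t z y] by (simp add: k''_def abs_mult mult_ac)
        also have "\<dots> \<le> (norm (l t z y) * norm h) * (norm (W y) * q t z y)"
          using q_pos[of t z y] by (intro mult_right_mono norm_blinfun) auto
        finally show "norm (k'' t z y h) \<le> norm (l t z y) * norm (W y) * q t z y * norm h"
          by (simp add: mult_ac)
      qed (use q_pos[of t z y] in simp)
      also have "\<dots> \<le> dom r y"
        using lW by (intro dom_ge tz) (auto simp: power2_eq_square power3_eq_cube)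
      finally show "norm (k'' t z y) \<le> dom r y" .
    next
      fix t and z y :: 'a
      show "((\<lambda>z. - (G t z y \<bullet> i) *\<^sub>R (q t z y *\<^sub>R W y)) has_derivative blinfun_apply (k'' t z y)) (at z)"
        unfolding k''_def l_def
        by (auto intro!: derivative_eq_intros q_has_derivative G_has_derivative
            simp: blinfun.bilinear_simps inner_commute algebra_simps)
    qed
    then show "\<exists>f'. C1_family {0..1} (\<lambda>t z. blinfun_apply (M' t z) i) f'"
      using C1_family_cong M'(2) by (metis (no_types, lifting))
  qed
  then show ?thesis using M' by blast
qed

section \<open>The velocity as a conditional mean, and its global Lipschitz bound\<close>

definition N :: "real \<Rightarrow> 'a \<Rightarrow> 'a" where "N t z = fst (M t z)"
definition D :: "real \<Rightarrow> 'a \<Rightarrow> real" where "D t z = snd (M t z)"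
definition V :: "real \<Rightarrow> 'a \<Rightarrow> 'a" where "V t z = inverse (D t z) *\<^sub>R N t z"

lemma integrable_q: "t \<in> {0..1} \<Longrightarrow> integrable lborel (\<lambda>y. q t z y)"
  and integrable_qy: "t \<in> {0..1} \<Longrightarrow> integrable lborel (\<lambda>y. q t z y *\<^sub>R y)"
  using integrable_qW[of t z]
  by (auto simp: W_def scaleR_Pair dest: integrable_bounded_linear[OF bounded_linear_snd]
      integrable_bounded_linear[OF bounded_linear_fst])

lemma D_eq: "t \<in> {0..1} \<Longrightarrow> D t z = (\<integral>y. q t z y \<partial>lborel)"
  and N_eq: "t \<in> {0..1} \<Longrightarrow> N t z = (\<integral>y. q t z y *\<^sub>R y \<partial>lborel)"
  unfolding D_def N_def M_def
  using integral_bounded_linear[OF bounded_linear_snd integrable_qW[of t z]]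
    integral_bounded_linear[OF bounded_linear_fst integrable_qW[of t z]]
  by (auto simp: W_def scaleR_Pair)

lemma D_pos: "t \<in> {0..1} \<Longrightarrow> D t z > 0"
  by (simp add: D_eq integral_pos_lborel integrable_q q_pos)

lemma C2_V: "C2_family {0..1} V"
proof -
  have M: "C2_family {0..1} M" using C2_M unfolding C2_family_def by blast
  have "C2_family {0..1} N"
    using C2_family_linear[OF bounded_linear_fst M] by (simp add: N_def[abs_def])
  moreover have "C2_family {0..1} D"
    using C2_family_linear[OF bounded_linear_snd M] by (simp add: D_def[abs_def])
  then have "C2_family {0..1} (\<lambda>t z. inverse (D t z))"
    by (rule C2_family_inverse) (use D_pos in \<open>metis less_irrefl\<close>)
  ultimately show ?thesis
    unfolding V_def[abs_def] by (intro C2_family_bilinear[OF bounded_bilinear_scaleR])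
qed

text \<open>\<open>m\<close> is the mode of \<open>y \<mapsto> q t z y\<close>, so the linear terms of the two quadratic bounds cancel.\<close>

lemma mode_exists:
  assumes t: "t \<in> {0..1}"
  obtains m c where "c > 0" "\<And>y. q t z y \<le> c * exp (- (\<alpha> / 4 * (norm (y - m))\<^sup>2))"
    "\<And>y. c * exp (- (L * (norm (y - m))\<^sup>2)) \<le> q t z y"
proof -
  define U where "U y = \<phi>0 (z - t *\<^sub>R y) + \<phi>1 (z + (1 - t) *\<^sub>R y)" for y
  have q: "q t z y = exp (- U y)" for y by (simp add: q_def U_def)
  define k where "k = - ln Q"
  have k: "k + \<alpha> / 8 * (norm y)\<^sup>2 \<le> U y" for y
  proof -
    have "ln (exp (- U y)) \<le> ln (Q * exp (- (\<alpha> / 8 * (norm y)\<^sup>2)))"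
      using q_bound[of t z y] by (subst ln_le_cancel_iff) (auto simp: q Q_def)
    then show ?thesis by (simp add: ln_mult k_def Q_def)
  qed
  \<comment> \<open>Outside this ball the quadratic growth of \<open>U\<close> already exceeds
    \<open>U 0\<close>, so a minimiser over the ball is global. The summand 1 ensures
    \<open>r \<le> r^2\<close>.\<close>
  define r where "r = 1 + 8 / \<alpha> * \<bar>U 0 - k\<bar>"
  have r: "r \<ge> 1" using p0.\<alpha> by (simp add: r_def)
  have r2: "U 0 \<le> k + \<alpha> / 8 * r\<^sup>2"
  proof -
    have "\<bar>U 0 - k\<bar> \<le> \<alpha> / 8 * r" using p0.\<alpha> by (simp add: r_def field_simps)
    also have "\<dots> \<le> \<alpha> / 8 * r\<^sup>2"
      using p0.\<alpha> r by (intro mult_left_mono) (auto simp: power2_eq_square)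
    finally show ?thesis by linarith
  qed
  have "continuous_on (cball 0 r) U"
    unfolding U_def by (intro continuous_intros p0.continuous_\<phi> p1.continuous_\<phi>)
  then obtain m where m: "m \<in> cball 0 r" "\<And>y. y \<in> cball 0 r \<Longrightarrow> U m \<le> U y"
    using continuous_attains_inf[of "cball 0 r" U] r by auto
  have min: "U m \<le> U y" for y
  proof (cases "y \<in> cball 0 r")
    case False
    then have "r\<^sup>2 \<le> (norm y)\<^sup>2" using r by (intro power_mono) auto
    then have "\<alpha> / 8 * r\<^sup>2 \<le> \<alpha> / 8 * (norm y)\<^sup>2" using p0.\<alpha> by (intro mult_left_mono) auto
    with k[of y] r2 m(2)[of 0] r show ?thesis by simp
  qed (rule m)
  let ?x0 = "z - t *\<^sub>R m" and ?x1 = "z + (1 - t) *\<^sub>R m"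
  let ?dU = "\<lambda>h. g0 ?x0 \<bullet> (- (t *\<^sub>R h)) + g1 ?x1 \<bullet> ((1 - t) *\<^sub>R h)"
  have "(U has_derivative ?dU) (at m)"
    unfolding U_def
    by (intro has_derivative_add has_derivative_compose[OF _ p0.der] has_derivative_compose[OF _ p1.der])
      (auto intro!: derivative_eq_intros)
  then have "?dU = (\<lambda>h. 0)"
    using min by (intro differential_zero_maxmin[of m UNIV U]) auto
  then have dU: "?dU h = 0" for h by (rule fun_cong)
  \<comment> \<open>The curvatures of the two potentials along \<open>y\<close> are weighted by
    \<open>t^2\<close> and \<open>(1 - t)^2\<close>. Their sum lies between 1/2 and 1, so the
    Gaussian rates \<open>\<alpha> / 4\<close> and \<open>L\<close> do not depend on
    \<open>t\<close>.\<close>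
  define s where "s = t\<^sup>2 + (1 - t)\<^sup>2"
  have s: "1 / 2 \<le> s" "s \<le> 1"
  proof -
    have "0 \<le> (2 * t - 1)\<^sup>2" by simp
    then show "1 / 2 \<le> s" by (simp add: s_def power2_eq_square algebra_simps)
    have "t * t \<le> t * 1" using t by (intro mult_left_mono) auto
    then show "s \<le> 1" by (simp add: s_def power2_eq_square algebra_simps)
  qed
  have diffs: "(z - t *\<^sub>R y) - ?x0 = - (t *\<^sub>R (y - m))" "(z + (1 - t) *\<^sub>R y) - ?x1 = (1 - t) *\<^sub>R (y - m)" for y
    by (simp_all add: algebra_simps)
  have norms: "(norm (- (t *\<^sub>R (y - m))))\<^sup>2 = t\<^sup>2 * (norm (y - m))\<^sup>2"
    "(norm ((1 - t) *\<^sub>R (y - m)))\<^sup>2 = (1 - t)\<^sup>2 * (norm (y - m))\<^sup>2" for y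
    by (simp_all add: power_mult_distrib)
  have lower: "U m + \<alpha> / 4 * (norm (y - m))\<^sup>2 \<le> U y" for y
  proof -
    have "\<alpha> / 2 * (1 / 2 * (norm (y - m))\<^sup>2) \<le> \<alpha> / 2 * (s * (norm (y - m))\<^sup>2)"
      using s p0.\<alpha> by (intro mult_left_mono mult_right_mono) auto
    also have "\<dots> = \<alpha> / 2 * (t\<^sup>2 * (norm (y - m))\<^sup>2) + \<alpha> / 2 * ((1 - t)\<^sup>2 * (norm (y - m))\<^sup>2)"
      by (simp add: s_def algebra_simps)
    finally show ?thesis
      using p0.strongly_convex[of ?x0 "z - t *\<^sub>R y"] p1.strongly_convex[of ?x1 "z + (1 - t) *\<^sub>R y"] dU[of "y - m"]
      unfolding U_def diffs norms by linarith
  qed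
  have upper: "U y \<le> U m + L * (norm (y - m))\<^sup>2" for y
  proof -
    have "L * (t\<^sup>2 * (norm (y - m))\<^sup>2) + L * ((1 - t)\<^sup>2 * (norm (y - m))\<^sup>2) = L * (s * (norm (y - m))\<^sup>2)"
      by (simp add: s_def algebra_simps)
    also have "\<dots> \<le> L * (1 * (norm (y - m))\<^sup>2)"
      using s p0.L_nonneg by (intro mult_left_mono mult_right_mono) auto
    finally show ?thesis
      using p0.quadratic_upper[of "z - t *\<^sub>R y" ?x0] p1.quadratic_upper[of "z + (1 - t) *\<^sub>R y" ?x1] dU[of "y - m"]
      unfolding U_def diffs norms mult_1 by linarith
  qed
  show ?thesis
    by (rule that[of "exp (- U m)" m]) (use lower upper in \<open>auto simp: q algebra_simps simp flip: exp_add\<close>)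
qed

text \<open>After translation by the mode, the second moment is at most \<open>c * a2\<close> and
  the normaliser at least \<open>c * a0\<close>, with Gaussian integrals that depend only on
  \<open>\<alpha>\<close> and \<open>L\<close>. The unknown height \<open>c\<close> cancels in the
  quotient, which leaves a constant free of \<open>t\<close> and \<open>z\<close>.\<close>

lemma second_moment_bound:
  "\<exists>K\<ge>0. \<forall>t\<in>{0..1}. \<forall>z. \<exists>m. integrable lborel (\<lambda>y. q t z y * (norm (y - m))\<^sup>2) \<and>
    (\<integral>y. q t z y * (norm (y - m))\<^sup>2 \<partial>lborel) \<le> K * D t z"
proof -
  let ?f2 = "\<lambda>u::'a. (norm u)\<^sup>2 * exp (- (\<alpha> / 4 * (norm u)\<^sup>2))"
  \<comment> \<open>\<open>L + 1\<close> instead of \<open>L\<close>, to have an integrable Gaussian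
    even when \<open>L = 0\<close>.\<close>
  let ?f0 = "\<lambda>u::'a. exp (- ((L + 1) * (norm u)\<^sup>2))"
  define a2 where "a2 = (\<integral>u. ?f2 u \<partial>lborel)"
  define a0 where "a0 = (\<integral>u. ?f0 u \<partial>lborel)"
  have i0: "integrable lborel ?f0" using p0.L_nonneg by (intro integrable_gaussian) auto
  have i2: "integrable lborel ?f2"
  proof (rule Bochner_Integration.integrable_bound)
    show "integrable lborel (\<lambda>u::'a. 4 * exp (1 * norm u - \<alpha> / 4 * (norm u)\<^sup>2))"
      using p0.\<alpha> by (intro integrable_mult_right integrable_exp_linear_quadratic) auto
    show "AE u in lborel. norm (?f2 u) \<le> norm (4 * exp (1 * norm u - \<alpha> / 4 * (norm (u::'a))\<^sup>2))"
    proof (rule AE_I2)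
      fix u :: 'a
      have "norm u / 2 \<le> exp (norm u / 2)" using exp_ge_add_one_self[of "norm u / 2"] by linarith
      then have "(norm u / 2)\<^sup>2 \<le> (exp (norm u / 2))\<^sup>2" by (intro power_mono) auto
      also have "\<dots> = exp (norm u)" by (simp add: power2_eq_square flip: exp_add)
      finally have "(norm u)\<^sup>2 \<le> 4 * exp (norm u)" by (simp add: power_divide)
      then have "?f2 u \<le> 4 * exp (norm u) * exp (- (\<alpha> / 4 * (norm u)\<^sup>2))" by (intro mult_right_mono) auto
      then show "norm (?f2 u) \<le> norm (4 * exp (1 * norm u - \<alpha> / 4 * (norm u)\<^sup>2))"
        by (simp add: diff_conv_add_uminus exp_add del: add_uminus_conv_diff)
    qed
  qed simp
  have a0: "a0 > 0" unfolding a0_def by (rule integral_pos_lborel[OF i0]) simp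
  have a2: "a2 \<ge> 0" unfolding a2_def by (rule integral_nonneg_AE) simp
  show ?thesis
  proof (intro exI[of _ "a2 / a0"] conjI ballI allI)
    fix t :: real and z :: 'a assume t: "t \<in> {0..1}"
    obtain m c where m: "c > 0" "\<And>y. q t z y \<le> c * exp (- (\<alpha> / 4 * (norm (y - m))\<^sup>2))"
      "\<And>y. c * exp (- (L * (norm (y - m))\<^sup>2)) \<le> q t z y"
      by (rule mode_exists[OF t, of z]) blast
    let ?h = "\<lambda>y. q t z y * (norm (y - m))\<^sup>2"
    have [measurable]: "?h \<in> borel_measurable borel" "q t z \<in> borel_measurable borel"
      by (intro borel_measurable_continuous_onI continuous_intros)+
    have h: "?h (m + u) \<le> c * ?f2 u" for u
      using mult_right_mono[OF m(2)[of "m + u"], of "(norm u)\<^sup>2"] by (simp add: mult_ac)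
    have ih: "integrable lborel (\<lambda>u. ?h (m + u))"
    proof (rule Bochner_Integration.integrable_bound)
      show "integrable lborel (\<lambda>u. c * ?f2 u)" by (intro integrable_mult_right i2)
      show "AE u in lborel. norm (?h (m + u)) \<le> norm (c * ?f2 u)"
        using h q_pos m(1) by (intro AE_I2) (simp add: less_imp_le abs_of_pos)
    qed simp
    have "(\<integral>y. ?h y \<partial>lborel) = (\<integral>u. ?h (m + u) \<partial>lborel)"
      by (rule lborel_integral_translation[symmetric]) simp
    also have "\<dots> \<le> (\<integral>u. c * ?f2 u \<partial>lborel)"
      by (intro integral_mono ih integrable_mult_right i2 h)
    also have "\<dots> = c * a2" by (simp add: a2_def)
    finally have S2: "(\<integral>y. ?h y \<partial>lborel) \<le> c * a2" .
    have "c * a0 = (\<integral>u. c * ?f0 u \<partial>lborel)" by (simp add: a0_def)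
    also have "\<dots> \<le> (\<integral>u. q t z (m + u) \<partial>lborel)"
    proof (intro integral_mono integrable_mult_right i0)
      show "integrable lborel (\<lambda>u. q t z (m + u))"
        by (subst lborel_integrable_translation_iff) (auto intro: integrable_q t)
      fix u
      have "c * ?f0 u \<le> c * exp (- (L * (norm u)\<^sup>2))" using m(1) by (simp add: algebra_simps)
      then show "c * ?f0 u \<le> q t z (m + u)" using m(3)[of "m + u"] by simp
    qed
    also have "\<dots> = D t z" using lborel_integral_translation[of "q t z" m] by (simp add: D_eq[OF t])
    finally have "c * a0 \<le> D t z" .
    then have "a2 / a0 * (c * a0) \<le> a2 / a0 * D t z" using a0 a2 by (intro mult_left_mono) auto
    then have "c * a2 \<le> a2 / a0 * D t z" using a0 by (simp add: mult_ac)
    moreover have "integrable lborel ?h"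
      by (rule lborel_integrable_translation_iff[THEN iffD1, OF _ ih]) simp
    ultimately show "\<exists>m. integrable lborel (\<lambda>y. q t z y * (norm (y - m))\<^sup>2) \<and>
        (\<integral>y. q t z y * (norm (y - m))\<^sup>2 \<partial>lborel) \<le> a2 / a0 * D t z"
      using S2 by (intro exI[of _ m] conjI) auto
  qed (use a0 a2 in simp)
qed

text \<open>The derivative of \<open>V t\<close> in direction \<open>k\<close> is minus the covariance of \<open>y\<close> and \<open>G t z y \<bullet> k\<close>
  under the normalised density \<open>q t z\<close>.\<close>

lemma V_derivative_bound:
  "\<exists>K\<ge>0. \<forall>t\<in>{0..1}. \<forall>z V' k. (V t has_derivative V') (at z) \<longrightarrow> norm (V' k) \<le> K * norm k"
proof -
  obtain Kv where Kv: "Kv \<ge> 0" "\<And>t z. t \<in> {0..1} \<Longrightarrow> \<exists>m. integrable lborel (\<lambda>y. q t z y * (norm (y - m))\<^sup>2) \<and>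
      (\<integral>y. q t z y * (norm (y - m))\<^sup>2 \<partial>lborel) \<le> Kv * D t z"
    using second_moment_bound by blast
  obtain M' where M': "C1_family {0..1} M M'"
    "\<And>t z i. t \<in> {0..1} \<Longrightarrow> blinfun_apply (M' t z) i = (\<integral>y. - (G t z y \<bullet> i) *\<^sub>R (q t z y *\<^sub>R W y) \<partial>lborel)"
    using C2_M by blast
  show ?thesis
  \<comment> \<open>\<open>2 * L\<close> is the Lipschitz constant of the score in \<open>y\<close>.
    \<open>Kv\<close> comes from the mixed moment \<open>Eeu\<close>, and \<open>(1 + Kv)^2\<close>
    from the product of the first moments \<open>Ee\<close> and \<open>Eu\<close>.\<close>
  proof (intro exI[of _ "2 * L * (Kv + (1 + Kv)\<^sup>2)"] conjI ballI allI impI)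
    fix t :: real and z k :: 'a and V'
    assume t: "t \<in> {0..1}" and V': "(V t has_derivative V') (at z)"
    obtain m where m: "integrable lborel (\<lambda>y. q t z y * (norm (y - m))\<^sup>2)"
      "(\<integral>y. q t z y * (norm (y - m))\<^sup>2 \<partial>lborel) \<le> Kv * D t z"
      using Kv(2)[OF t] by blast
    \<comment> \<open>A covariance does not change when constants are subtracted, so the score is
      centred at its value in \<open>m\<close> and \<open>y\<close> at \<open>m\<close>. All terms
      with \<open>\<gamma>\<close> and \<open>m\<close> cancel in \<open>V'k\<close> below, and what
      is left is small near \<open>m\<close> in both factors.\<close>
    define \<gamma> where "\<gamma> = G t z m \<bullet> k"
    define e where "e y = (G t z y - G t z m) \<bullet> k" for y
    define u where "u y = y - m" for y
    have Gk: "G t z y \<bullet> k = \<gamma> + e y" for y by (simp add: \<gamma>_def e_def inner_diff_left)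
    note iq = integrable_q[OF t, of z] and iqy = integrable_qy[OF t, of z]
    have iGq: "integrable lborel (\<lambda>y. q t z y * (G t z y \<bullet> k))"
      and iGqy: "integrable lborel (\<lambda>y. (q t z y * (G t z y \<bullet> k)) *\<^sub>R y)"
      using integrable_bounded_linear[OF bounded_linear_snd integrable_DqW[OF t, of z k]]
        integrable_bounded_linear[OF bounded_linear_fst integrable_DqW[OF t, of z k]]
      by (simp_all add: W_def mult_ac)
    have iqu: "integrable lborel (\<lambda>y. q t z y *\<^sub>R u y)"
      using Bochner_Integration.integrable_diff[OF iqy integrable_scaleR_left[of m, OF iq]]
      by (simp add: u_def scaleR_diff_right)
    have iqe: "integrable lborel (\<lambda>y. q t z y * e y)"
      using Bochner_Integration.integrable_diff[OF iGq integrable_mult_left[of \<gamma>, OF iq]]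
      by (simp add: Gk algebra_simps)
    have iqeu: "integrable lborel (\<lambda>y. (q t z y * e y) *\<^sub>R u y)"
    proof -
      have "integrable lborel (\<lambda>y. (q t z y * (G t z y \<bullet> k)) *\<^sub>R y - (q t z y * (G t z y \<bullet> k)) *\<^sub>R m
          - \<gamma> *\<^sub>R (q t z y *\<^sub>R u y))"
        using m by (intro Bochner_Integration.integrable_diff iGqy integrable_scaleR_left integrable_scaleR_right iGq iqu) 
      then show ?thesis by (simp add: Gk u_def algebra_simps)
    qed
    define Eu where "Eu = (\<integral>y. q t z y *\<^sub>R u y \<partial>lborel)"
    define Ee where "Ee = (\<integral>y. q t z y * e y \<partial>lborel)"
    define Eeu where "Eeu = (\<integral>y. (q t z y * e y) *\<^sub>R u y \<partial>lborel)"
    define d where "d = D t z"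
    have d: "d > 0" using D_pos[OF t] by (simp add: d_def)
    have N: "N t z = d *\<^sub>R m + Eu"
    proof -
      have "N t z = (\<integral>y. q t z y *\<^sub>R m + q t z y *\<^sub>R u y \<partial>lborel)"
        by (simp add: N_eq[OF t] u_def scaleR_diff_right)
      also have "\<dots> = d *\<^sub>R m + Eu" by (simp add: iq iqu d_def D_eq[OF t] Eu_def)
      finally show ?thesis .
    qed
    have D': "snd (M' t z k) = - (\<gamma> * d + Ee)"
    proof -
      have "snd (M' t z k) = (\<integral>y. - (\<gamma> * q t z y + q t z y * e y) \<partial>lborel)"
        unfolding M'(2)[OF t] integral_bounded_linear[OF bounded_linear_snd integrable_DqW[OF t], symmetric]
        by (simp add: W_def Gk algebra_simps)
      also have "\<dots> = - (\<gamma> * d + Ee)" by (simp add: iq iqe d_def D_eq[OF t] Ee_def)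
      finally show ?thesis .
    qed
    have N': "fst (M' t z k) = - ((\<gamma> * d) *\<^sub>R m + \<gamma> *\<^sub>R Eu + Ee *\<^sub>R m + Eeu)"
    proof -
      have "fst (M' t z k) = (\<integral>y. - ((\<gamma> * q t z y) *\<^sub>R m + \<gamma> *\<^sub>R (q t z y *\<^sub>R u y)
          + (q t z y * e y) *\<^sub>R m + (q t z y * e y) *\<^sub>R u y) \<partial>lborel)"
        unfolding M'(2)[OF t] integral_bounded_linear[OF bounded_linear_fst integrable_DqW[OF t], symmetric]
        by (simp add: W_def Gk u_def algebra_simps)
      also have "\<dots> = - ((\<gamma> * d) *\<^sub>R m + \<gamma> *\<^sub>R Eu + Ee *\<^sub>R m + Eeu)"
        by (simp add: iq iqe iqu iqeu d_def D_eq[OF t] Ee_def Eu_def Eeu_def del: scaleR_scaleR)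
      finally show ?thesis .
    qed
    have "(M t has_derivative blinfun_apply (M' t z)) (at z)" by (rule C1_familyD(3)[OF M'(1) t])
    then have D_der: "(D t has_derivative (\<lambda>k. snd (M' t z k))) (at z)"
      and N_der: "(N t has_derivative (\<lambda>k. fst (M' t z k))) (at z)"
      unfolding D_def[abs_def] N_def[abs_def] by (rule has_derivative_snd, rule has_derivative_fst)
    have "D t z \<noteq> 0" using D_pos[OF t, of z] by simp
    from has_derivative_scaleR[OF Deriv.has_derivative_inverse[OF this D_der] N_der]
    have "(V t has_derivative (\<lambda>k. inverse d *\<^sub>R fst (M' t z k) +
        (- (inverse d * snd (M' t z k) * inverse d)) *\<^sub>R N t z)) (at z)"
      unfolding V_def[abs_def] d_def .
    from has_derivative_unique[OF V' this]
    have "V' k = inverse d *\<^sub>R fst (M' t z k) + (- (inverse d * snd (M' t z k) * inverse d)) *\<^sub>R N t z" by simp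
    also have "\<dots> = - (inverse d *\<^sub>R Eeu) + (inverse d * Ee) *\<^sub>R (inverse d *\<^sub>R Eu)"
      unfolding N' D' N using d by (simp add: algebra_simps)
    finally have V'k: "V' k = - (inverse d *\<^sub>R Eeu) + (inverse d * Ee) *\<^sub>R (inverse d *\<^sub>R Eu)" .
    have e_le: "\<bar>e y\<bar> \<le> 2 * L * norm k * norm (u y)" for y
    proof -
      have "norm (G t z y - G t z m) \<le> 2 * L * norm (u y)"
      proof -
        have "norm (G t z y - G t z m) \<le>
            norm (g0 (z - t *\<^sub>R y) - g0 (z - t *\<^sub>R m)) + norm (g1 (z + (1 - t) *\<^sub>R y) - g1 (z + (1 - t) *\<^sub>R m))"
          unfolding G_def by (rule norm_diff_triangle_ineq)
        also have "\<dots> \<le> L * norm (- (t *\<^sub>R u y)) + L * norm ((1 - t) *\<^sub>R u y)"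
          using p0.g_lipschitz[of "z - t *\<^sub>R y" "z - t *\<^sub>R m"] p1.g_lipschitz[of "z + (1 - t) *\<^sub>R y" "z + (1 - t) *\<^sub>R m"]
          by (simp add: u_def algebra_simps)
        also have "\<dots> \<le> L * norm (u y) + L * norm (u y)"
          using t p0.L_nonneg by (intro add_mono mult_left_mono) (auto intro!: mult_left_le_one_le)
        finally show ?thesis by simp
      qed
      from mult_right_mono[OF this norm_ge_zero[of k]] show ?thesis
        using Cauchy_Schwarz_ineq2[of "G t z y - G t z m" k] by (simp add: e_def mult_ac)
    qed
    have qn: "norm (q t z y *\<^sub>R x) = q t z y * norm x" for y and x :: 'a
      using q_pos[of t z y] by simp
    \<comment> \<open>The first absolute moment is reduced to the second by
      \<open>norm u \<le> 1 + (norm u)^2\<close>.\<close>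
    have Eu1: "(\<integral>y. q t z y * norm (u y) \<partial>lborel) \<le> (1 + Kv) * d"
    proof -
      have "(\<integral>y. q t z y * norm (u y) \<partial>lborel) \<le> (\<integral>y. q t z y + q t z y * (norm (y - m))\<^sup>2 \<partial>lborel)"
      proof (rule integral_mono)
        show "integrable lborel (\<lambda>y. q t z y * norm (u y))" using integrable_norm[OF iqu] by (simp only: qn)
        fix y
        have "2 * norm (u y) \<le> (norm (u y))\<^sup>2 + 1"
          using sum_squares_bound[of "norm (u y)" 1] by simp
        then have "norm (u y) \<le> 1 + (norm (u y))\<^sup>2"
          using norm_ge_zero[of "u y"] by linarith
        from mult_left_mono[OF this less_imp_le[OF q_pos]]
        show "q t z y * norm (u y) \<le> q t z y + q t z y * (norm (y - m))\<^sup>2"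
          by (simp add: u_def algebra_simps)
      qed (intro Bochner_Integration.integrable_add iq m)
      also have "\<dots> \<le> (1 + Kv) * d" using m iq by (simp add: d_def D_eq[OF t] algebra_simps)
      finally show ?thesis .
    qed
    have Eu: "norm Eu \<le> (1 + Kv) * d"
      using Eu1 integral_norm_bound[of lborel "\<lambda>y. q t z y *\<^sub>R u y"] unfolding Eu_def qn by linarith
    have Ee: "\<bar>Ee\<bar> \<le> 2 * L * norm k * ((1 + Kv) * d)"
    proof -
      have "\<bar>Ee\<bar> \<le> (\<integral>y. \<bar>q t z y * e y\<bar> \<partial>lborel)" unfolding Ee_def by (rule integral_abs_bound)
      also have "\<dots> \<le> (\<integral>y. 2 * L * norm k * (q t z y * norm (u y)) \<partial>lborel)"
      proof (rule integral_mono)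
        show "integrable lborel (\<lambda>y. 2 * L * norm k * (q t z y * norm (u y)))"
          using integrable_norm[OF iqu] by (intro integrable_mult_right) (simp only: qn)
        show "\<bar>q t z y * e y\<bar> \<le> 2 * L * norm k * (q t z y * norm (u y))" for y
          using mult_left_mono[OF e_le[of y] less_imp_le[OF q_pos[of t z y]]] q_pos[of t z y]
          by (simp add: abs_mult mult_ac)
      qed (intro integrable_abs iqe)
      also have "\<dots> \<le> 2 * L * norm k * ((1 + Kv) * d)"
        using Eu1 p0.L_nonneg by (simp add: mult_left_mono)
      finally show ?thesis .
    qed
    have Eeu: "norm Eeu \<le> 2 * L * norm k * (Kv * d)"
    proof -
      have "norm Eeu \<le> (\<integral>y. norm ((q t z y * e y) *\<^sub>R u y) \<partial>lborel)" unfolding Eeu_def by (rule integral_norm_bound)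
      also have "\<dots> \<le> (\<integral>y. 2 * L * norm k * (q t z y * (norm (y - m))\<^sup>2) \<partial>lborel)"
      proof (rule integral_mono)
        show "norm ((q t z y * e y) *\<^sub>R u y) \<le> 2 * L * norm k * (q t z y * (norm (y - m))\<^sup>2)" for y
          using mult_right_mono[OF mult_left_mono[OF e_le[of y] less_imp_le[OF q_pos[of t z y]]] norm_ge_zero[of "u y"]] q_pos[of t z y]
          by (simp add: abs_mult mult_ac power2_eq_square u_def)
      qed (intro integrable_norm iqeu integrable_mult_right m)+
      also have "\<dots> \<le> 2 * L * norm k * (Kv * d)"
        using m p0.L_nonneg by (simp add: mult_left_mono d_def)
      finally show ?thesis .
    qed
    have "norm (V' k) \<le> inverse d * norm Eeu + (inverse d * \<bar>Ee\<bar>) * (inverse d * norm Eu)"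
      unfolding V'k using d by (intro norm_triangle_le) (simp add: abs_mult)
    also have "\<dots> \<le> inverse d * (2 * L * norm k * (Kv * d)) +
        (inverse d * (2 * L * norm k * ((1 + Kv) * d))) * (inverse d * ((1 + Kv) * d))"
      using d Ee Eeu Eu Kv p0.L_nonneg by (intro add_mono mult_mono) auto
    also have "\<dots> = 2 * L * (Kv + (1 + Kv)\<^sup>2) * norm k"
      using d by (simp add: power2_eq_square field_simps)
    finally show "norm (V' k) \<le> 2 * L * (Kv + (1 + Kv)\<^sup>2) * norm k" .
  qed (use Kv p0.L_nonneg in simp)
qed

end

subsection \<open>The law of the interpolation\<close>

lemma lborel_nn_integral_translation:
  fixes f :: "'a::euclidean_space \<Rightarrow> ennreal"
  assumes [measurable]: "f \<in> borel_measurable borel"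
  shows "(\<integral>\<^sup>+x. f (c + x) \<partial>lborel) = (\<integral>\<^sup>+x. f x \<partial>lborel)"
  using nn_integral_distr[of "(+) c" lborel borel f] by (simp add: lborel_distr_plus)

text \<open>The set where they differ is open and Lebesgue null, hence empty.\<close>

lemma continuous_AE_eq_imp_eq:
  fixes f g :: "'a::euclidean_space \<Rightarrow> 'b::t2_space"
  assumes "continuous_on UNIV f" "continuous_on UNIV g" and ae: "AE x in lborel. f x = g x"
  shows "f = g"
proof (rule ccontr)
  assume "f \<noteq> g"
  then have ne: "{x. f x \<noteq> g x} \<noteq> {}" by auto
  have op: "open {x. f x \<noteq> g x}" using assms by (intro open_Collect_neq)
  from ae obtain N where "{x. f x \<noteq> g x} \<subseteq> N" "N \<in> null_sets lborel" by (auto elim!: AE_E simp: null_sets_def)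
  then have "negligible {x. f x \<noteq> g x}"
    by (meson negligible_subset negligible_iff_null_sets null_sets_completionI)
  then show False using open_not_negligible[OF op ne] by simp
qed

locale interpolation = potential_pair \<phi>0 \<phi>1 g0 g1 H0 H1 L \<alpha>
  for \<phi>0 \<phi>1 :: "'a::euclidean_space \<Rightarrow> real" and g0 g1 :: "'a \<Rightarrow> 'a"
    and H0 H1 :: "'a \<Rightarrow> 'a \<Rightarrow>\<^sub>L 'a" and L \<alpha> :: real +
  fixes \<mu>0 \<mu>1 :: "'a measure"
  assumes \<mu>0: "\<mu>0 = density lborel (\<lambda>x. ennreal (exp (- \<phi>0 x)))"
    and \<mu>1: "\<mu>1 = density lborel (\<lambda>x. ennreal (exp (- \<phi>1 x)))"
    and prob0: "prob_space \<mu>0" and prob1: "prob_space \<mu>1"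
begin

lemma sets_\<mu> [measurable_cong, simp]: "sets \<mu>0 = sets borel" "sets \<mu>1 = sets borel"
  by (simp_all add: \<mu>0 \<mu>1)

lemma space_\<mu> [simp]: "space \<mu>0 = UNIV" "space \<mu>1 = UNIV"
  by (simp_all add: \<mu>0 \<mu>1)

sublocale M0: prob_space \<mu>0 by (rule prob0)
sublocale M1: prob_space \<mu>1 by (rule prob1)
sublocale pair_prob_space \<mu>0 \<mu>1 ..

abbreviation \<mu> :: "('a \<times> 'a) measure" where "\<mu> \<equiv> \<mu>0 \<Otimes>\<^sub>M \<mu>1"

definition X :: "real \<Rightarrow> 'a \<times> 'a \<Rightarrow> 'a"
  where "X t \<omega> = (1 - t) *\<^sub>R fst \<omega> + t *\<^sub>R snd \<omega>"

definition Y :: "'a \<times> 'a \<Rightarrow> 'a"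
  where "Y \<omega> = snd \<omega> - fst \<omega>"

lemma measurable_XY [measurable]: "X t \<in> borel_measurable \<mu>" "Y \<in> borel_measurable \<mu>"
  unfolding X_def Y_def by measurable

lemma measurable_\<phi> [measurable]: "\<phi>0 \<in> borel_measurable borel" "\<phi>1 \<in> borel_measurable borel"
  by (intro borel_measurable_continuous_onI p0.continuous_\<phi> p1.continuous_\<phi> continuous_on_id)+

lemma measurable_q [measurable]: "(\<lambda>p. q t (fst p) (snd p)) \<in> borel_measurable (borel \<Otimes>\<^sub>M borel)"
  unfolding q_def by measurable

text \<open>The unimodular change of variables is carried out as two translations with an exchange
  of integrals in between: \<open>b = a + y\<close> for fixed \<open>a\<close>, then
  \<open>a = z - t y\<close> for fixed \<open>y\<close>. No Jacobian is computed, and no value of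
  \<open>t\<close> is special.\<close>

lemma nn_integral_joint_law:
  fixes f :: "'a \<times> 'a \<Rightarrow> ennreal"
  assumes [measurable]: "f \<in> borel_measurable (borel \<Otimes>\<^sub>M borel)"
  shows "(\<integral>\<^sup>+\<omega>. f (X t \<omega>, Y \<omega>) \<partial>\<mu>) = (\<integral>\<^sup>+z. \<integral>\<^sup>+y. ennreal (q t z y) * f (z, y) \<partial>lborel \<partial>lborel)"
proof -
  let ?e0 = "\<lambda>x. ennreal (exp (- \<phi>0 x))" and ?e1 = "\<lambda>x. ennreal (exp (- \<phi>1 x))"
  have "(\<integral>\<^sup>+\<omega>. f (X t \<omega>, Y \<omega>) \<partial>\<mu>) = (\<integral>\<^sup>+a. \<integral>\<^sup>+b. f ((1 - t) *\<^sub>R a + t *\<^sub>R b, b - a) \<partial>\<mu>1 \<partial>\<mu>0)"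
    by (subst M1.nn_integral_fst[symmetric]) (auto simp: X_def Y_def)
  also have "\<dots> = (\<integral>\<^sup>+a. ?e0 a * (\<integral>\<^sup>+b. ?e1 b * f ((1 - t) *\<^sub>R a + t *\<^sub>R b, b - a) \<partial>lborel) \<partial>lborel)"
    unfolding \<mu>0 \<mu>1 by (simp add: nn_integral_density)
  also have "\<dots> = (\<integral>\<^sup>+a. ?e0 a * (\<integral>\<^sup>+y. ?e1 (a + y) * f ((1 - t) *\<^sub>R a + t *\<^sub>R (a + y), a + y - a) \<partial>lborel) \<partial>lborel)"
    by (intro nn_integral_cong arg_cong[where f = "(*) (ennreal (exp (- \<phi>0 a)))" for a]
        lborel_nn_integral_translation[symmetric]) measurable
  also have "\<dots> = (\<integral>\<^sup>+a. \<integral>\<^sup>+y. ?e0 a * ?e1 (a + y) * f (a + t *\<^sub>R y, y) \<partial>lborel \<partial>lborel)"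
    by (intro nn_integral_cong) (simp add: nn_integral_cmult[symmetric] algebra_simps)
  also have "\<dots> = (\<integral>\<^sup>+y. \<integral>\<^sup>+a. ?e0 a * ?e1 (a + y) * f (a + t *\<^sub>R y, y) \<partial>lborel \<partial>lborel)"
    by (rule lborel_pair.Fubini'[symmetric]) simp
  also have "\<dots> = (\<integral>\<^sup>+y. \<integral>\<^sup>+z. ?e0 (- (t *\<^sub>R y) + z) * ?e1 (- (t *\<^sub>R y) + z + y) * f (- (t *\<^sub>R y) + z + t *\<^sub>R y, y) \<partial>lborel \<partial>lborel)"
    by (intro nn_integral_cong lborel_nn_integral_translation[symmetric]) measurable
  also have "\<dots> = (\<integral>\<^sup>+y. \<integral>\<^sup>+z. ennreal (q t z y) * f (z, y) \<partial>lborel \<partial>lborel)"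
    by (intro nn_integral_cong) (simp add: q_def algebra_simps flip: ennreal_mult exp_add)
  also have "\<dots> = (\<integral>\<^sup>+z. \<integral>\<^sup>+y. ennreal (q t z y) * f (z, y) \<partial>lborel \<partial>lborel)"
    by (rule lborel_pair.Fubini') (simp add: case_prod_beta')
  finally show ?thesis .
qed

lemma joint_law:
  "distr \<mu> (borel \<Otimes>\<^sub>M borel) (\<lambda>\<omega>. (X t \<omega>, Y \<omega>)) = density (lborel \<Otimes>\<^sub>M lborel) (\<lambda>p. ennreal (q t (fst p) (snd p)))"
proof (rule measure_eqI)
  have s: "sets (lborel \<Otimes>\<^sub>M lborel) = sets (borel \<Otimes>\<^sub>M borel :: ('a \<times> 'a) measure)"
    by (intro sets_pair_measure_cong) auto
  then show "sets (distr \<mu> (borel \<Otimes>\<^sub>M borel) (\<lambda>\<omega>. (X t \<omega>, Y \<omega>))) =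
      sets (density (lborel \<Otimes>\<^sub>M lborel) (\<lambda>p. ennreal (q t (fst p) (snd p))))" by simp
  fix A :: "('a \<times> 'a) set" assume "A \<in> sets (distr \<mu> (borel \<Otimes>\<^sub>M borel) (\<lambda>\<omega>. (X t \<omega>, Y \<omega>)))"
  then have [measurable]: "A \<in> sets (borel \<Otimes>\<^sub>M borel)" by simp
  have [measurable]: "A \<in> sets (lborel \<Otimes>\<^sub>M lborel)" by (simp add: s)
  have "emeasure (distr \<mu> (borel \<Otimes>\<^sub>M borel) (\<lambda>\<omega>. (X t \<omega>, Y \<omega>))) A =
      (\<integral>\<^sup>+p. indicator A p \<partial>distr \<mu> (borel \<Otimes>\<^sub>M borel) (\<lambda>\<omega>. (X t \<omega>, Y \<omega>)))"
    by simp
  also have "\<dots> = (\<integral>\<^sup>+\<omega>. indicator A (X t \<omega>, Y \<omega>) \<partial>\<mu>)"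
    by (rule nn_integral_distr) measurable
  also have "\<dots> = (\<integral>\<^sup>+z. \<integral>\<^sup>+y. ennreal (q t z y) * indicator A (z, y) \<partial>lborel \<partial>lborel)"
    by (rule nn_integral_joint_law) measurable
  also have "\<dots> = (\<integral>\<^sup>+p. ennreal (q t (fst p) (snd p)) * indicator A p \<partial>(lborel \<Otimes>\<^sub>M lborel))"
    by (subst lborel.nn_integral_fst[symmetric]) simp_all
  also have "\<dots> = emeasure (density (lborel \<Otimes>\<^sub>M lborel) (\<lambda>p. ennreal (q t (fst p) (snd p)))) A"
    by (subst emeasure_density) simp_all
  finally show "emeasure (distr \<mu> (borel \<Otimes>\<^sub>M borel) (\<lambda>\<omega>. (X t \<omega>, Y \<omega>))) A =
      emeasure (density (lborel \<Otimes>\<^sub>M lborel) (\<lambda>p. ennreal (q t (fst p) (snd p)))) A" .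
qed

lemma integral_joint_law:
  fixes f :: "'a \<times> 'a \<Rightarrow> 'b::euclidean_space"
  assumes [measurable]: "f \<in> borel_measurable (borel \<Otimes>\<^sub>M borel)" and int: "integrable \<mu> (\<lambda>\<omega>. f (X t \<omega>, Y \<omega>))"
  shows "(\<integral>\<omega>. f (X t \<omega>, Y \<omega>) \<partial>\<mu>) = (\<integral>z. \<integral>y. q t z y *\<^sub>R f (z, y) \<partial>lborel \<partial>lborel)"
    and "integrable lborel (\<lambda>z. \<integral>y. q t z y *\<^sub>R f (z, y) \<partial>lborel)"
proof -
  have "integrable (distr \<mu> (borel \<Otimes>\<^sub>M borel) (\<lambda>\<omega>. (X t \<omega>, Y \<omega>))) f"
    using int by (subst integrable_distr_eq) auto
  then have i: "integrable (lborel \<Otimes>\<^sub>M lborel) (\<lambda>p. q t (fst p) (snd p) *\<^sub>R f p)"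
    unfolding joint_law by (subst (asm) integrable_density) (auto simp: q_pos less_imp_le)
  have "(\<integral>\<omega>. f (X t \<omega>, Y \<omega>) \<partial>\<mu>) = (\<integral>p. f p \<partial>distr \<mu> (borel \<Otimes>\<^sub>M borel) (\<lambda>\<omega>. (X t \<omega>, Y \<omega>)))"
    by (rule integral_distr[symmetric]) auto
  also have "\<dots> = (\<integral>p. q t (fst p) (snd p) *\<^sub>R f p \<partial>(lborel \<Otimes>\<^sub>M lborel))"
    unfolding joint_law by (rule integral_density) (auto simp: q_pos less_imp_le)
  also have "\<dots> = (\<integral>z. \<integral>y. q t z y *\<^sub>R f (z, y) \<partial>lborel \<partial>lborel)"
    using lborel_pair.integral_fst'[OF i] by simp
  finally show "(\<integral>\<omega>. f (X t \<omega>, Y \<omega>) \<partial>\<mu>) = (\<integral>z. \<integral>y. q t z y *\<^sub>R f (z, y) \<partial>lborel \<partial>lborel)" .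
  show "integrable lborel (\<lambda>z. \<integral>y. q t z y *\<^sub>R f (z, y) \<partial>lborel)"
    using lborel_pair.integrable_fst'[OF i] by simp
qed

lemma integrable_norm_fst: "integrable \<mu> (\<lambda>\<omega>. norm (fst \<omega>))"
proof -
  have "integrable (distr \<mu> \<mu>0 fst) norm"
    unfolding M1.distr_pair_fst \<mu>0 by (rule p0.integrable_norm)
  then show ?thesis by (subst (asm) integrable_distr_eq) auto
qed

lemma integrable_norm_snd: "integrable \<mu> (\<lambda>\<omega>. norm (snd \<omega>))"
proof -
  have "integrable (distr (\<mu>1 \<Otimes>\<^sub>M \<mu>0) \<mu>1 fst) norm"
    unfolding M0.distr_pair_fst \<mu>1 by (rule p1.integrable_norm)
  then have "integrable (\<mu>1 \<Otimes>\<^sub>M \<mu>0) (\<lambda>\<omega>. norm (fst \<omega>))" by (subst (asm) integrable_distr_eq) auto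
  then show ?thesis
    using integrable_product_swap_iff[of "\<lambda>\<omega>. norm (snd \<omega>)"] by (simp add: case_prod_beta')
qed

lemma integrable_Y: "integrable \<mu> Y"
proof (rule Bochner_Integration.integrable_bound)
  show "integrable \<mu> (\<lambda>\<omega>. norm (snd \<omega>) + norm (fst \<omega>))"
    by (intro Bochner_Integration.integrable_add integrable_norm_fst integrable_norm_snd)
qed (auto simp: Y_def intro!: AE_I2 norm_triangle_ineq4)

text \<open>Testing against Borel sets compares the densities \<open>N t\<close> and
  \<open>D t\<close> times \<open>v\<close>, so they agree almost everywhere. Both are continuous,
  hence they agree at every point, and \<open>D t > 0\<close> allows division.\<close>

lemma V_characterisation:
  assumes t: "t \<in> {0..1}" and cont: "continuous_on UNIV v"
    and int: "integrable \<mu> (\<lambda>\<omega>. v (X t \<omega>))"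
    and eq: "\<And>A. A \<in> sets borel \<Longrightarrow>
      (\<integral>\<omega>. indicator A (X t \<omega>) *\<^sub>R Y \<omega> \<partial>\<mu>) = (\<integral>\<omega>. indicator A (X t \<omega>) *\<^sub>R v (X t \<omega>) \<partial>\<mu>)"
  shows "v = V t"
proof -
  have [measurable]: "v \<in> borel_measurable borel" by (rule borel_measurable_continuous_onI[OF cont])
  obtain M' where M': "C1_family {0..1} M M'" using C2_M by blast
  have slice: "continuous_on UNIV (f t)" if "C1_family {0..1} f f'" for f :: "real \<Rightarrow> 'a \<Rightarrow> 'c::real_normed_vector" and f'
    using C1_familyD(3)[OF that t] by (auto intro!: continuous_at_imp_continuous_on has_derivative_continuous)
  have contN: "continuous_on UNIV (N t)" and contD: "continuous_on UNIV (D t)"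
    unfolding N_def[abs_def] D_def[abs_def] by (intro continuous_intros slice[OF M'])+
  have iY: "integrable \<mu> (\<lambda>\<omega>. indicator A (X t \<omega>) *\<^sub>R Y \<omega>)" if [measurable]: "A \<in> sets borel" for A
    by (rule Bochner_Integration.integrable_bound[OF integrable_Y]) (auto intro!: AE_I2 simp: indicator_def)
  have iv: "integrable \<mu> (\<lambda>\<omega>. indicator A (X t \<omega>) *\<^sub>R v (X t \<omega>))" if [measurable]: "A \<in> sets borel" for A
    by (rule Bochner_Integration.integrable_bound[OF int]) (auto intro!: AE_I2 simp: indicator_def)
  have N_int: "(\<integral>y. q t z y *\<^sub>R (indicator A z *\<^sub>R y) \<partial>lborel) = indicator A z *\<^sub>R N t z" for A z
    unfolding N_eq[OF t] integral_scaleR_right[symmetric] by (simp add: mult.commute)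
  have D_int: "(\<integral>y. q t z y *\<^sub>R (indicator A z *\<^sub>R v z) \<partial>lborel) = indicator A z *\<^sub>R (D t z *\<^sub>R v z)" for A z
    by (simp add: D_eq[OF t] integrable_q[OF t] mult.commute)
  have Y_law: "(\<integral>\<omega>. indicator A (X t \<omega>) *\<^sub>R Y \<omega> \<partial>\<mu>) = (\<integral>z. indicator A z *\<^sub>R N t z \<partial>lborel)"
    "integrable lborel (\<lambda>z. indicator A z *\<^sub>R N t z)" if [measurable]: "A \<in> sets borel" for A
    using integral_joint_law[of "\<lambda>p. indicator A (fst p) *\<^sub>R snd p" t] iY[OF that]
    by (simp_all only: fst_conv snd_conv N_int) simp_all
  have v_law: "(\<integral>\<omega>. indicator A (X t \<omega>) *\<^sub>R v (X t \<omega>) \<partial>\<mu>) = (\<integral>z. indicator A z *\<^sub>R (D t z *\<^sub>R v z) \<partial>lborel)"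
    "integrable lborel (\<lambda>z. indicator A z *\<^sub>R (D t z *\<^sub>R v z))" if [measurable]: "A \<in> sets borel" for A
    using integral_joint_law[of "\<lambda>p. indicator A (fst p) *\<^sub>R v (fst p)" t] iv[OF that]
    by (simp_all only: fst_conv snd_conv D_int) simp_all
  have "N t z \<bullet> b = (D t z *\<^sub>R v z) \<bullet> b" if b: "b \<in> Basis" for z b
  proof -
    have "AE z in lborel. N t z \<bullet> b = (D t z *\<^sub>R v z) \<bullet> b"
    proof (rule density_unique_real)
      show "integrable lborel (\<lambda>z. N t z \<bullet> b)" "integrable lborel (\<lambda>z. (D t z *\<^sub>R v z) \<bullet> b)"
        using Y_law(2)[of UNIV] v_law(2)[of UNIV] by (simp_all add: integrable_inner_left del: inner_scaleR_left)
      fix A :: "'a set" assume A: "A \<in> sets lborel"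
      then have A': "A \<in> sets borel" by simp
      have "(LINT z:A|lborel. N t z \<bullet> b) = (\<integral>z. (indicator A z *\<^sub>R N t z) \<bullet> b \<partial>lborel)"
        by (simp add: set_lebesgue_integral_def)
      also have "\<dots> = (\<integral>z. indicator A z *\<^sub>R N t z \<partial>lborel) \<bullet> b"
        using Y_law(2)[OF A'] by (rule integral_inner_left)
      also have "\<dots> = (\<integral>z. (indicator A z *\<^sub>R (D t z *\<^sub>R v z)) \<bullet> b \<partial>lborel)"
        unfolding Y_law(1)[OF A', symmetric] eq[OF A'] v_law(1)[OF A']
        using v_law(2)[OF A'] by (rule integral_inner_left[symmetric])
      also have "\<dots> = (LINT z:A|lborel. (D t z *\<^sub>R v z) \<bullet> b)"
        by (simp add: set_lebesgue_integral_def mult.assoc)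
      finally show "(LINT z:A|lborel. N t z \<bullet> b) = (LINT z:A|lborel. (D t z *\<^sub>R v z) \<bullet> b)" .
    qed
    then have "(\<lambda>z. N t z \<bullet> b) = (\<lambda>z. (D t z *\<^sub>R v z) \<bullet> b)"
      by (rule continuous_AE_eq_imp_eq[rotated 2]) (intro continuous_intros contN contD cont)+
    then show ?thesis by (rule fun_cong)
  qed
  then have "N t z = D t z *\<^sub>R v z" for z by (rule euclidean_eqI)
  then show ?thesis using D_pos[OF t] by (auto simp: V_def less_imp_neq[symmetric])
qed

text \<open>With \<open>z\<close> fixed, the inner integral over \<open>y\<close> is
  \<open>\<psi> z \<bullet> (N t z - D t z *\<^sub>R V t z)\<close>, which vanishes. Integrability
  is a hypothesis because at the place of use it is delivered by differentiation under the
  integral.\<close>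

lemma orthogonality:
  assumes t: "t \<in> {0..1}" and [measurable]: "\<psi> \<in> borel_measurable borel"
    and int: "integrable \<mu> (\<lambda>\<omega>. \<psi> (X t \<omega>) \<bullet> (Y \<omega> - V t (X t \<omega>)))"
  shows "(\<integral>\<omega>. \<psi> (X t \<omega>) \<bullet> (Y \<omega> - V t (X t \<omega>)) \<partial>\<mu>) = 0"
proof -
  obtain V' V'' where V': "C1_family {0..1} V V'" using C2_V by (auto simp: C2_family_def)
  have "continuous_on UNIV (V t)"
    using C1_familyD(3)[OF V' t] by (auto intro!: continuous_at_imp_continuous_on has_derivative_continuous)
  then have [measurable]: "V t \<in> borel_measurable borel" by (rule borel_measurable_continuous_onI)
  have "(\<integral>\<omega>. \<psi> (X t \<omega>) \<bullet> (Y \<omega> - V t (X t \<omega>)) \<partial>\<mu>) =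
      (\<integral>z. \<integral>y. q t z y *\<^sub>R (\<psi> z \<bullet> (y - V t z)) \<partial>lborel \<partial>lborel)"
    using integral_joint_law(1)[of "\<lambda>p. \<psi> (fst p) \<bullet> (snd p - V t (fst p))" t] int by simp
  also have "\<dots> = (\<integral>z. 0 \<partial>(lborel :: 'a measure))"
  proof (rule Bochner_Integration.integral_cong[OF refl])
    fix z
    have "(\<integral>y. q t z y *\<^sub>R (\<psi> z \<bullet> (y - V t z)) \<partial>lborel) =
        (\<integral>y. \<psi> z \<bullet> (q t z y *\<^sub>R y - q t z y *\<^sub>R V t z) \<partial>lborel)"
      by (simp add: inner_diff_right algebra_simps)
    also have "\<dots> = \<psi> z \<bullet> (N t z - D t z *\<^sub>R V t z)"
      using integrable_q[OF t, of z] integrable_qy[OF t, of z]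
      by (simp add: N_eq[OF t] D_eq[OF t])
    also have "\<dots> = 0" using D_pos[OF t, of z] by (simp add: V_def)
    finally show "(\<integral>y. q t z y *\<^sub>R (\<psi> z \<bullet> (y - V t z)) \<partial>lborel) = 0" .
  qed
  finally show ?thesis by simp
qed

end

subsection \<open>Flows of time-dependent fields\<close>

locale flow_field =
  fixes T K :: real and F :: "real \<Rightarrow> 'a::euclidean_space \<Rightarrow> 'a" and F' :: "real \<Rightarrow> 'a \<Rightarrow> 'a \<Rightarrow>\<^sub>L 'a"
  assumes T_nonneg: "T \<ge> 0" and K_nonneg: "K \<ge> 0" and C1: "C1_family {0..T} F F'"
    and boundF': "\<And>t x. t \<in> {0..T} \<Longrightarrow> norm (F' t x) \<le> K"
begin

lemma continuous_F:
  assumes "continuous_on S a" "continuous_on S b" "a ` S \<subseteq> {0..T}"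
  shows "continuous_on S (\<lambda>x. F (a x) (b x))"
  using assms
  by (intro continuous_on_compose2[OF C1_familyD(1)[OF C1], of S "\<lambda>x. (a x, b x)", simplified] continuous_intros) auto

lemma continuous_F':
  assumes "continuous_on S a" "continuous_on S b" "a ` S \<subseteq> {0..T}"
  shows "continuous_on S (\<lambda>x. F' (a x) (b x))"
  using assms
  by (intro continuous_on_compose2[OF C1_familyD(2)[OF C1], of S "\<lambda>x. (a x, b x)", simplified] continuous_intros) auto

text \<open>Writing the trajectory from \<open>x\<close> as \<open>x + sol x\<close> makes the initial value independent of the parameter.\<close>

sublocale C1_param_ivp T K "\<lambda>t x e. F t (x + e)" 0 "\<lambda>t x e. F' t (x + e)" "\<lambda>t x e. F' t (x + e)"
proof
  show "continuous_on ({0..T} \<times> UNIV) (\<lambda>(t, x, e). F t (x + e))"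
    unfolding case_prod_beta' by (intro continuous_F continuous_intros) auto
  show "continuous_on ({0..T} \<times> UNIV) (\<lambda>(t, x, e). F' t (x + e))"
    unfolding case_prod_beta' by (intro continuous_F' continuous_intros) auto
  fix t x e assume t: "t \<in> {0..T}"
  show "((\<lambda>p. F t (fst p + snd p)) has_derivative
      (\<lambda>p. blinfun_apply (F' t (x + e)) (fst p) + blinfun_apply (F' t (x + e)) (snd p))) (at (x, e))"
  proof -
    have 1: "((\<lambda>p. fst p + snd p) has_derivative (\<lambda>p. fst p + snd p)) (at (x, e))"
      by (intro has_derivative_add has_derivative_fst has_derivative_snd has_derivative_ident)
    have 2: "(F t has_derivative blinfun_apply (F' t (x + e))) (at (fst (x, e) + snd (x, e)))"
      using C1_familyD(3)[OF C1 t] by simp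
    from has_derivative_compose[OF 1 2] show ?thesis by (simp add: blinfun.add_right)
  qed
qed (use T_nonneg K_nonneg boundF' in auto)

definition flow :: "real \<Rightarrow> 'a \<Rightarrow> 'a" where "flow t x = x + sol x t"

lemma flow_solves: "solves_ivp T F x (\<lambda>t. flow t x)"
  using solves[of x] has_vector_derivative_add[OF has_vector_derivative_const[of x], of "sol x"]
  unfolding solves_ivp_def flow_def by simp

lemma lip_F: "t \<in> {0..T} \<Longrightarrow> norm (F t x - F t y) \<le> K * norm (x - y)"
  using lip[of t 0 x y] by simp

lemma flow_unique: "solves_ivp T F x f \<Longrightarrow> t \<in> {0..T} \<Longrightarrow> f t = flow t x"
  using ivp_unique[OF _ flow_solves lip_F K_nonneg] by blast

lemma flow_0 [simp]: "flow 0 x = x"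
  using flow_solves[of x] by (simp add: solves_ivp_def)

lemma flow_lipschitz: "t \<in> {0..T} \<Longrightarrow> norm (flow t x - flow t y) \<le> exp (K * T) * norm (x - y)"
proof -
  assume t: "t \<in> {0..T}"
  have "norm (flow t x - flow t y) \<le> (norm (x - y) + 0 * T) * exp (K * t)"
    by (rule ivp_dist_le[OF flow_solves flow_solves lip_F]) (use K_nonneg t in auto)
  also have "\<dots> \<le> norm (x - y) * exp (K * T)" using t K_nonneg by (auto intro!: mult_left_mono)
  finally show ?thesis by (simp add: mult.commute)
qed

lemma continuous_flow:
  assumes "continuous_on S a" "continuous_on S b" "a ` S \<subseteq> {0..T}"
  shows "continuous_on S (\<lambda>x. flow (a x) (b x))"
  unfolding flow_def using assms
  by (intro continuous_intros continuous_on_compose2[OF sol_jointly_continuous_on, of S "\<lambda>x. (a x, b x)", simplified]) auto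

text \<open>The identity is the derivative of the summand \<open>x\<close> in \<open>flow\<close>.
  It restores the initial value of the fundamental solution, as \<open>deriv.sol\<close> starts at
  0.\<close>

definition Dflow :: "real \<Rightarrow> 'a \<Rightarrow> 'a \<Rightarrow>\<^sub>L 'a" where "Dflow t x = id_blinfun + deriv.sol x t"

lemma flow_has_derivative: "t \<in> {0..T} \<Longrightarrow> (flow t has_derivative blinfun_apply (Dflow t x)) (at x)"
  using has_derivative_add[OF has_derivative_ident sol_has_derivative, of t x]
  unfolding flow_def[abs_def] Dflow_def by (simp add: blinfun.add_left[abs_def])

lemma continuous_Dflow:
  assumes "continuous_on S a" "continuous_on S b" "a ` S \<subseteq> {0..T}"
  shows "continuous_on S (\<lambda>x. Dflow (a x) (b x))"
  unfolding Dflow_def using assms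
  by (intro continuous_intros continuous_on_compose2[OF deriv.sol_jointly_continuous_on, of S "\<lambda>x. (a x, b x)", simplified]) auto

text \<open>The variational equation is again an initial value problem depending on the parameter \<open>x\<close>
  in a \<open>C\<^sup>1\<close> fashion, so differentiability in the parameter applies to it once more.\<close>

lemma Dflow_C1:
  assumes C2: "C1_family {0..T} F' F''" and t: "t \<in> {0..T}"
  shows "\<exists>D2. (\<forall>x. (Dflow t has_derivative blinfun_apply (D2 x)) (at x)) \<and> continuous_on UNIV D2"
proof -
  interpret comp: bounded_bilinear "blinfun_compose :: ('a \<Rightarrow>\<^sub>L 'a) \<Rightarrow> ('a \<Rightarrow>\<^sub>L 'a) \<Rightarrow> _"
    by (rule bounded_bilinear_blinfun_compose)
  define A where "A t x = F' t (x + sol x t)" for t x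
  define A' where "A' t x = F'' t (x + sol x t) o\<^sub>L Dflow t x" for t x
  have A'_der: "(A t has_derivative blinfun_apply (A' t x)) (at x)" if "t \<in> {0..T}" for t x
    using has_derivative_compose[OF flow_has_derivative[OF that, of x] C1_familyD(3)[OF C2 that, of "flow t x"]]
    unfolding A_def[abs_def] A'_def flow_def[abs_def] by (rule has_derivative_eq_rhs) auto
  have cont_A: "continuous_on S (\<lambda>x. A (a x) (b x))"
    if "continuous_on S a" "continuous_on S b" "a ` S \<subseteq> {0..T}" for S :: "'s::topological_space set" and a b
    unfolding A_def flow_def[symmetric] by (intro continuous_F' continuous_flow that)
  have cont_A': "continuous_on S (\<lambda>x. A' (a x) (b x))"
    if "continuous_on S a" "continuous_on S b" "a ` S \<subseteq> {0..T}" for S :: "'s::topological_space set" and a b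
    unfolding A'_def flow_def[symmetric] using that
    by (intro continuous_intros continuous_Dflow
        continuous_on_compose2[OF C1_familyD(2)[OF C2], of S "\<lambda>x. (a x, flow (a x) (b x))", simplified] continuous_flow) auto
  \<comment> \<open>The state is now the operator \<open>Y\<close>. The derivative in
    \<open>Y\<close> is composition with \<open>A t x\<close> on the left, of norm at most
    \<open>K\<close>; the derivative in \<open>x\<close> is affine in \<open>Y\<close>, so it has no
    uniform bound.\<close>
  interpret second: C1_param_ivp T K
    "\<lambda>t x Y. F' t (x + sol x t) + (F' t (x + sol x t) o\<^sub>L Y)" 0
    "\<lambda>t x Y. A' t x + (comp.prod_left Y o\<^sub>L A' t x)" "\<lambda>t x Y. comp.prod_right (A t x)"
  proof
    show "continuous_on ({0..T} \<times> UNIV) (\<lambda>(t, x, Y). F' t (x + sol x t) + (F' t (x + sol x t) o\<^sub>L Y))"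
      by (rule deriv.cont)
    show "continuous_on ({0..T} \<times> UNIV) (\<lambda>(t, x, Y). A' t x + (comp.prod_left Y o\<^sub>L A' t x))"
      unfolding case_prod_beta'
      by (intro continuous_intros cont_A' bounded_linear.continuous_on[OF comp.bounded_linear_prod_left]) auto
    show "continuous_on ({0..T} \<times> UNIV) (\<lambda>(t, x, Y). comp.prod_right (A t x))"
      unfolding case_prod_beta'
      by (intro cont_A bounded_linear.continuous_on[OF comp.bounded_linear_prod_right] continuous_intros) auto
  next
    fix t x and Y :: "'a \<Rightarrow>\<^sub>L 'a" assume t: "t \<in> {0..T}"
    have fstA: "((\<lambda>p :: 'a \<times> ('a \<Rightarrow>\<^sub>L 'a). A t (fst p)) has_derivative (\<lambda>p. A' t x (fst p))) (at (x, Y))"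
      using has_derivative_compose[OF has_derivative_fst[OF has_derivative_ident], of "A t" "blinfun_apply (A' t x)" "(x, Y)"]
        A'_der[OF t, of x] by simp
    have sndY: "((\<lambda>p :: 'a \<times> ('a \<Rightarrow>\<^sub>L 'a). snd p) has_derivative snd) (at (x, Y))"
      by (auto intro!: derivative_eq_intros)
    have "((\<lambda>p :: 'a \<times> ('a \<Rightarrow>\<^sub>L 'a). A t (fst p) + (A t (fst p) o\<^sub>L snd p)) has_derivative
      (\<lambda>p. A' t x (fst p) + ((A t x o\<^sub>L snd p) + (A' t x (fst p) o\<^sub>L Y)))) (at (x, Y))"
      using has_derivative_add[OF fstA comp.FDERIV[OF fstA sndY]] by simp
    then show "((\<lambda>p. F' t (fst p + sol (fst p) t) + (F' t (fst p + sol (fst p) t) o\<^sub>L snd p)) has_derivative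
       (\<lambda>p. blinfun_apply (A' t x + (comp.prod_left Y o\<^sub>L A' t x)) (fst p) + blinfun_apply (comp.prod_right (A t x)) (snd p)))
       (at (x, Y))"
      unfolding A_def by (rule has_derivative_eq_rhs) (auto simp: blinfun.add_left)
    show "norm (comp.prod_right (A t x)) \<le> K"
    proof (rule norm_blinfun_bound[OF K_nonneg])
      fix Z :: "'a \<Rightarrow>\<^sub>L 'a"
      have "norm (A t x o\<^sub>L Z) \<le> norm (A t x) * norm Z" by (rule norm_blinfun_compose)
      also have "\<dots> \<le> K * norm Z" unfolding A_def by (intro mult_right_mono boundF' t) auto
      finally show "norm (blinfun_apply (comp.prod_right (A t x)) Z) \<le> K * norm Z" by simp
    qed
  qed (use T_nonneg K_nonneg in auto)
  have "(Dflow t has_derivative blinfun_apply (second.deriv.sol x t)) (at x)" for x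
    using has_derivative_add[OF has_derivative_const second.sol_has_derivative[OF t], of id_blinfun x]
    unfolding Dflow_def[abs_def] by simp
  moreover have "continuous_on UNIV (\<lambda>x. second.deriv.sol x t)"
    by (rule continuous_on_compose2[OF second.deriv.sol_jointly_continuous_on, of _ "\<lambda>x. (t, x)", simplified])
      (use t in \<open>auto intro!: continuous_intros\<close>)
  ultimately show ?thesis by (intro exI[of _ "\<lambda>x. second.deriv.sol x t"] conjI allI)
qed

text \<open>The inverse of the time-\<open>s\<close> map is the flow of the time-reversed field.
  That field satisfies the same hypotheses with the same \<open>K\<close>, so smoothness and the
  Lipschitz constant come from the forward theory instead of an inverse function theorem.\<close>

lemma flow_inverse:
  assumes s: "s \<in> {0..T}"
  obtains \<Psi> \<Psi>' where "\<And>x. \<Psi> (flow s x) = x" "\<And>z. flow s (\<Psi> z) = z"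
    "\<And>z. (\<Psi> has_derivative blinfun_apply (\<Psi>' z)) (at z)" "continuous_on UNIV \<Psi>'"
    "\<And>z z'. norm (\<Psi> z - \<Psi> z') \<le> exp (K * T) * norm (z - z')"
proof -
  interpret rev: flow_field s K "\<lambda>r x. - F (s - r) x" "\<lambda>r x. - F' (s - r) x"
  proof
    show "C1_family {0..s} (\<lambda>r x. - F (s - r) x) (\<lambda>r x. - F' (s - r) x)"
      unfolding C1_family_def
    proof (intro conjI ballI allI)
      show "continuous_on ({0..s} \<times> UNIV) (\<lambda>p. - F (s - fst p) (snd p))"
        using s by (intro continuous_intros continuous_F) auto
      show "continuous_on ({0..s} \<times> UNIV) (\<lambda>p. - F' (s - fst p) (snd p))"
        using s by (intro continuous_intros continuous_F') auto
      fix r x assume "r \<in> {0..s}"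
      then have "s - r \<in> {0..T}" using s by auto
      from has_derivative_minus[OF C1_familyD(3)[OF C1 this]]
      show "((\<lambda>x. - F (s - r) x) has_derivative blinfun_apply (- F' (s - r) x)) (at x)"
        by (rule has_derivative_eq_rhs) (auto simp: blinfun.minus_left)
    qed
  qed (use s K_nonneg boundF' in auto)
  have 1: "rev.flow s (flow s x) = x" for x
    using rev.flow_unique[OF solves_ivp_reverse[OF flow_solves s, of x], of s] s by simp
  have 2: "flow s (rev.flow s z) = z" for z
  proof -
    have "solves_ivp s F (rev.flow s z) (\<lambda>r. rev.flow (s - r) z)"
      by (rule solves_ivp_cong[OF solves_ivp_reverse[OF rev.flow_solves]]) (use s in auto)
    from ivp_unique[OF this solves_ivp_subinterval[OF flow_solves s], of K s]
    show ?thesis using s K_nonneg lip_F by auto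
  qed
  have 3: "norm (rev.flow s z - rev.flow s z') \<le> exp (K * T) * norm (z - z')" for z z'
  proof -
    have "norm (rev.flow s z - rev.flow s z') \<le> exp (K * s) * norm (z - z')"
      using s by (intro rev.flow_lipschitz) auto
    also have "\<dots> \<le> exp (K * T) * norm (z - z')"
      using s K_nonneg by (intro mult_right_mono) (auto intro!: mult_left_mono)
    finally show ?thesis .
  qed
  show ?thesis
    by (rule that[OF 1 2 rev.flow_has_derivative _ 3])
      (use s in \<open>auto intro!: rev.continuous_Dflow continuous_intros\<close>)
qed

end

subsection \<open>Marginal preservation\<close>

text \<open>Domination is imposed on the increments from the one point \<open>s\<close>, not on
  derivatives nearby. This fits the pullback, whose Lipschitz bound is explicit, and
  \<open>at s within S\<close> admits the one-sided derivatives at the end points.\<close>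

lemma has_real_derivative_integral:
  fixes u :: "real \<Rightarrow> 'w \<Rightarrow> real"
  assumes der: "\<And>\<omega>. ((\<lambda>s. u s \<omega>) has_real_derivative u' \<omega>) (at s within S)"
    and s: "s \<in> S" "at s within S \<noteq> bot"
    and int: "\<And>r. r \<in> S \<Longrightarrow> integrable M (u r)" "integrable M B"
    and bound: "\<And>r \<omega>. r \<in> S \<Longrightarrow> \<bar>u r \<omega> - u s \<omega>\<bar> \<le> B \<omega> * \<bar>r - s\<bar>"
    and meas: "u' \<in> borel_measurable M"
  shows "integrable M u'" and "((\<lambda>s. \<integral>\<omega>. u s \<omega> \<partial>M) has_real_derivative (\<integral>\<omega>. u' \<omega> \<partial>M)) (at s within S)"
proof -
  let ?Q = "\<lambda>r \<omega>. (u r \<omega> - u s \<omega>) / (r - s)"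
  have lim: "((\<lambda>r. ?Q r \<omega>) \<longlongrightarrow> u' \<omega>) (at s within S)" for \<omega>
    using der[of \<omega>] unfolding has_field_derivative_iff .
  have Q_bound: "\<bar>?Q r \<omega>\<bar> \<le> B \<omega>" if "r \<in> S" "r \<noteq> s" for r \<omega>
    using bound[OF that(1), of \<omega>] that(2) by (simp add: divide_le_eq)
  have u'_bound: "\<bar>u' \<omega>\<bar> \<le> B \<omega>" for \<omega>
  proof (rule tendsto_upperbound[OF tendsto_rabs[OF lim] _ s(2)])
    show "\<forall>\<^sub>F r in at s within S. \<bar>?Q r \<omega>\<bar> \<le> B \<omega>"
      using Q_bound by (auto simp: eventually_at_filter)
  qed
  show "integrable M u'"
    by (rule Bochner_Integration.integrable_bound[OF int(2) meas])
      (use u'_bound in \<open>auto intro!: AE_I2 order_trans[OF u'_bound]\<close>)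
  have "((\<lambda>r. \<integral>\<omega>. ?Q r \<omega> \<partial>M) \<longlongrightarrow> (\<integral>\<omega>. u' \<omega> \<partial>M)) (at s within S)"
    unfolding tendsto_at_iff_sequentially
  proof (intro allI impI)
    fix x :: "nat \<Rightarrow> real" assume x: "\<forall>i. x i \<in> S - {s}" "x \<longlonglongrightarrow> s"
    have "(\<lambda>n. \<integral>\<omega>. ?Q (x n) \<omega> \<partial>M) \<longlonglongrightarrow> (\<integral>\<omega>. u' \<omega> \<partial>M)"
    proof (rule integral_dominated_convergence[where w = B])
      show "AE \<omega> in M. (\<lambda>n. ?Q (x n) \<omega>) \<longlonglongrightarrow> u' \<omega>"
        using lim x unfolding tendsto_at_iff_sequentially o_def by (intro AE_I2) auto
      show "AE \<omega> in M. norm (?Q (x n) \<omega>) \<le> B \<omega>" for n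
        using Q_bound x(1) by (intro AE_I2) auto
      show "?Q (x n) \<in> borel_measurable M" for n
        using int(1)[of "x n"] int(1)[OF s(1)] x(1) by (auto intro: borel_measurable_integrable)
    qed fact+
    then show "((\<lambda>r. \<integral>\<omega>. ?Q r \<omega> \<partial>M) \<circ> x) \<longlonglongrightarrow> (\<integral>\<omega>. u' \<omega> \<partial>M)" by (simp add: o_def)
  qed
  then show "((\<lambda>s. \<integral>\<omega>. u s \<omega> \<partial>M) has_real_derivative (\<integral>\<omega>. u' \<omega> \<partial>M)) (at s within S)"
    unfolding has_field_derivative_iff
  proof (rule Lim_transform_eventually)
    show "\<forall>\<^sub>F r in at s within S. (\<integral>\<omega>. ?Q r \<omega> \<partial>M) = ((\<integral>\<omega>. u r \<omega> \<partial>M) - (\<integral>\<omega>. u s \<omega> \<partial>M)) / (r - s)"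
      using int(1) s(1) by (auto simp: eventually_at_filter)
  qed
qed

lemma norm_diff_le_vector_derivative:
  fixes f :: "real \<Rightarrow> 'b::real_normed_vector"
  assumes der: "\<And>\<tau>. \<tau> \<in> S \<Longrightarrow> (f has_vector_derivative f' \<tau>) (at \<tau> within S)"
    and bound: "\<And>\<tau>. \<tau> \<in> S \<Longrightarrow> norm (f' \<tau>) \<le> B" and "convex S" "r \<in> S" "s \<in> S"
  shows "norm (f r - f s) \<le> B * \<bar>r - s\<bar>"
proof -
  have "norm (f r - f s) \<le> B * norm (r - s)"
  proof (rule differentiable_bound[OF \<open>convex S\<close> _ _ \<open>r \<in> S\<close> \<open>s \<in> S\<close>])
    fix \<tau> assume \<tau>: "\<tau> \<in> S"
    show "(f has_derivative (\<lambda>h. h *\<^sub>R f' \<tau>)) (at \<tau> within S)"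
      using der[OF \<tau>] by (simp add: has_vector_derivative_def)
    show "onorm (\<lambda>h. h *\<^sub>R f' \<tau>) \<le> B"
    proof (rule onorm_bound)
      show "0 \<le> B" by (rule order_trans[OF norm_ge_zero bound[OF \<tau>]])
      show "norm (h *\<^sub>R f' \<tau>) \<le> B * norm h" for h
        using mult_left_mono[OF bound[OF \<tau>] abs_ge_zero[of h]] by (simp add: mult.commute)
    qed
  qed
  then show ?thesis by simp
qed

context flow_field
begin

lemma
  assumes s: "s \<in> {0..T}"
  shows inv_flow_flow: "inv (flow s) (flow s x) = x"
    and flow_inv_flow: "flow s (inv (flow s) z) = z"
    and inv_flow_lipschitz: "norm (inv (flow s) z - inv (flow s) z') \<le> exp (K * T) * norm (z - z')"
    and inv_flow_C1: "\<exists>\<Psi>'. (\<forall>z. (inv (flow s) has_derivative blinfun_apply (\<Psi>' z)) (at z)) \<and> continuous_on UNIV \<Psi>'"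
proof -
  obtain \<Psi> \<Psi>' where \<Psi>: "\<And>x. \<Psi> (flow s x) = x" "\<And>z. flow s (\<Psi> z) = z"
    "\<And>z. (\<Psi> has_derivative blinfun_apply (\<Psi>' z)) (at z)" "continuous_on UNIV \<Psi>'"
    "\<And>z z'. norm (\<Psi> z - \<Psi> z') \<le> exp (K * T) * norm (z - z')"
    using flow_inverse[OF s] by blast
  have inv: "inv (flow s) = \<Psi>"
    by (rule inv_equality) (use \<Psi> in auto)
  show "inv (flow s) (flow s x) = x" "flow s (inv (flow s) z) = z"
    "norm (inv (flow s) z - inv (flow s) z') \<le> exp (K * T) * norm (z - z')"
    "\<exists>\<Psi>'. (\<forall>z. (inv (flow s) has_derivative blinfun_apply (\<Psi>' z)) (at z)) \<and> continuous_on UNIV \<Psi>'"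
    unfolding inv using \<Psi> by auto
qed

lemma inv_flow_0: "inv (flow 0) x = x"
  using inv_flow_flow[of 0 x] T_nonneg by simp

lemma continuous_inv_flow:
  assumes "s \<in> {0..T}"
  shows "continuous_on UNIV (inv (flow s))"
proof -
  obtain \<Psi>' where "\<And>z. (inv (flow s) has_derivative blinfun_apply (\<Psi>' z)) (at z)"
    using inv_flow_C1[OF assms] by blast
  then show ?thesis by (intro continuous_at_imp_continuous_on ballI has_derivative_continuous)
qed

end

locale interpolation_flow =
  interpolation \<phi>0 \<phi>1 g0 g1 H0 H1 L \<alpha> \<mu>0 \<mu>1 + flow_field 1 K V V'
  for \<phi>0 \<phi>1 :: "'a::euclidean_space \<Rightarrow> real" and g0 g1 :: "'a \<Rightarrow> 'a"
    and H0 H1 :: "'a \<Rightarrow> 'a \<Rightarrow>\<^sub>L 'a" and L \<alpha> :: real and \<mu>0 \<mu>1 :: "'a measure"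
    and K :: real and V' :: "real \<Rightarrow> 'a \<Rightarrow> 'a \<Rightarrow>\<^sub>L 'a"
begin

text \<open>The law of \<open>pullback s\<close> will turn out not to depend on \<open>s\<close>, which is marginal preservation.\<close>

definition pullback :: "real \<Rightarrow> 'a \<times> 'a \<Rightarrow> 'a" where "pullback s \<omega> = inv (flow s) (X s \<omega>)"

lemma flow_pullback: "s \<in> {0..1} \<Longrightarrow> flow s (pullback s \<omega>) = X s \<omega>"
  unfolding pullback_def by (rule flow_inv_flow)

lemma X_diff: "X r \<omega> - X s \<omega> = (r - s) *\<^sub>R Y \<omega>"
  by (simp add: X_def Y_def algebra_simps)

lemma flow_vector_derivative:
  "t \<in> {0..1} \<Longrightarrow> ((\<lambda>t. flow t x) has_vector_derivative V t (flow t x)) (at t within {0..1})"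
  using flow_solves[of x] by (simp add: solves_ivp_def)

text \<open>With \<open>y = pullback s \<omega>\<close>, the paths \<open>X\<close> and the
  trajectory from \<open>y\<close> meet at time \<open>s\<close>. One moves with velocity
  \<open>Y \<omega>\<close>, the other with \<open>V\<close> along the trajectory, so they are of
  order \<open>\<bar>r - s\<bar>\<close> apart at time \<open>r\<close>; the Lipschitz inverse flow
  carries this gap back to time 0.\<close>

lemma pullback_lipschitz:
  "\<exists>B. integrable \<mu> B \<and> (\<forall>\<omega>. \<forall>r\<in>{0..1}. \<forall>s\<in>{0..1}. norm (pullback r \<omega> - pullback s \<omega>) \<le> B \<omega> * \<bar>r - s\<bar>)"
proof -
  have "bounded ((\<lambda>t. flow t 0) ` {0..1})" "bounded ((\<lambda>t. V t 0) ` {0..1})"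
    by (intro compact_imp_bounded compact_continuous_image continuous_flow continuous_F continuous_intros; simp)+
  then obtain a b where a: "\<And>t. t \<in> {0..1} \<Longrightarrow> norm (flow t 0) \<le> a" and b: "\<And>t. t \<in> {0..1} \<Longrightarrow> norm (V t 0) \<le> b"
    unfolding bounded_iff by (metis imageI)
  define e where "e = exp K"
  \<comment> \<open>A bound for \<open>V\<close> along the trajectory from \<open>y\<close>:
    \<open>a\<close> and \<open>b\<close> bound the trajectory from 0 and the field at 0, the inner
    \<open>e\<close> is the Lipschitz constant of the inverse flow and bounds \<open>y\<close>, and
    the outer \<open>e\<close> is that of the forward flow. The result is affine in the norms of the
    two end points, hence integrable.\<close>
  define B1 where "B1 \<omega> = b + K * (a + e * (e * (norm (fst \<omega>) + norm (snd \<omega>) + a)))" for \<omega> :: "'a \<times> 'a"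
  define B where "B \<omega> = e * (norm (Y \<omega>) + B1 \<omega>)" for \<omega>
  have e: "e > 0" by (simp add: e_def)
  have "integrable \<mu> B"
    unfolding B_def B1_def using integrable_norm_fst integrable_norm_snd integrable_norm[OF integrable_Y]
    by (intro integrable_mult_right Bochner_Integration.integrable_add) auto
  moreover have "norm (pullback r \<omega> - pullback s \<omega>) \<le> B \<omega> * \<bar>r - s\<bar>" if r: "r \<in> {0..1}" and s: "s \<in> {0..1}" for r s \<omega>
  proof -
    define y where "y = pullback s \<omega>"
    have y: "flow s y = X s \<omega>" unfolding y_def by (rule flow_pullback[OF s])
    have "norm (X s \<omega>) \<le> norm (fst \<omega>) + norm (snd \<omega>)"
      unfolding X_def using s
      by (intro norm_triangle_le add_mono) (auto intro!: mult_left_le_one_le)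
    then have "norm (X s \<omega> - flow s 0) \<le> norm (fst \<omega>) + norm (snd \<omega>) + a"
      using norm_triangle_ineq4[of "X s \<omega>" "flow s 0"] a[OF s] by linarith
    then have "norm y \<le> e * (norm (fst \<omega>) + norm (snd \<omega>) + a)"
      using inv_flow_lipschitz[OF s, of "X s \<omega>" "flow s 0"] e
      unfolding y_def pullback_def inv_flow_flow[OF s] e_def
      by (simp add: order_trans[OF _ mult_left_mono])
    have flow_le: "norm (flow \<tau> y) \<le> a + e * (e * (norm (fst \<omega>) + norm (snd \<omega>) + a))" if \<tau>: "\<tau> \<in> {0..1}" for \<tau>
    proof -
      have "norm (flow \<tau> y) \<le> norm (flow \<tau> 0) + norm (flow \<tau> y - flow \<tau> 0)"
        using norm_triangle_ineq[of "flow \<tau> 0" "flow \<tau> y - flow \<tau> 0"] by simp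
      also have "\<dots> \<le> a + e * norm y"
        using a[OF \<tau>] flow_lipschitz[OF \<tau>, of y 0] by (intro add_mono) (auto simp: e_def)
      also have "\<dots> \<le> a + e * (e * (norm (fst \<omega>) + norm (snd \<omega>) + a))"
        using \<open>norm y \<le> _\<close> e by (intro add_left_mono mult_left_mono) auto
      finally show ?thesis .
    qed
    have "norm (V \<tau> (flow \<tau> y)) \<le> B1 \<omega>" if \<tau>: "\<tau> \<in> {0..1}" for \<tau>
    proof -
      have "norm (V \<tau> (flow \<tau> y)) \<le> norm (V \<tau> 0) + norm (V \<tau> (flow \<tau> y) - V \<tau> 0)"
        using norm_triangle_ineq[of "V \<tau> 0" "V \<tau> (flow \<tau> y) - V \<tau> 0"] by simp
      also have "\<dots> \<le> b + K * norm (flow \<tau> y)"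
        using b[OF \<tau>] lip_F[OF \<tau>, of "flow \<tau> y" 0] by simp
      also have "\<dots> \<le> B1 \<omega>"
        unfolding B1_def using flow_le[OF \<tau>] K_nonneg by (intro add_left_mono mult_left_mono) auto
      finally show ?thesis .
    qed
    then have "norm (flow r y - flow s y) \<le> B1 \<omega> * \<bar>r - s\<bar>"
      using r s by (intro norm_diff_le_vector_derivative[OF flow_vector_derivative]) auto
    moreover have eq: "X r \<omega> - flow r y = (r - s) *\<^sub>R Y \<omega> - (flow r y - flow s y)"
      unfolding X_diff[symmetric] y by simp
    have "norm (X r \<omega> - flow r y) \<le> norm ((r - s) *\<^sub>R Y \<omega>) + norm (flow r y - flow s y)"
      unfolding eq by (rule norm_triangle_ineq4)
    ultimately have "norm (X r \<omega> - flow r y) \<le> norm (Y \<omega>) * \<bar>r - s\<bar> + B1 \<omega> * \<bar>r - s\<bar>"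
      by (simp add: mult.commute)
    then have "e * norm (X r \<omega> - flow r y) \<le> B \<omega> * \<bar>r - s\<bar>"
      unfolding B_def using e by (simp add: mult.assoc distrib_right[symmetric] mult_left_mono)
    moreover have "norm (pullback r \<omega> - pullback s \<omega>) \<le> e * norm (X r \<omega> - flow r y)"
      using inv_flow_lipschitz[OF r, of "X r \<omega>" "flow r y"]
      unfolding y_def[symmetric] e_def inv_flow_flow[OF r] by (simp add: pullback_def)
    ultimately show ?thesis by linarith
  qed
  ultimately show ?thesis by blast
qed

text \<open>With \<open>y' = pullback r \<omega>\<close> one has
  \<open>flow r y' = X r \<omega>\<close> exactly. Thus \<open>flow s y' - X s \<omega>\<close> is
  the increment of \<open>X\<close> from \<open>s\<close> to \<open>r\<close> minus that of the
  trajectory from \<open>y'\<close>. The former is \<open>(r - s) *\<^sub>R Y \<omega>\<close>, the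
  latter is \<open>(r - s) *\<^sub>R V s (X s \<omega>)\<close> up to a small error, because
  \<open>y'\<close> tends to \<open>pullback s \<omega>\<close> and \<open>V\<close> along
  trajectories is jointly continuous.\<close>

lemma pullback_derivative:
  assumes s: "s \<in> {0..1}"
  shows "((\<lambda>r. flow s (pullback r \<omega>)) has_vector_derivative Y \<omega> - V s (X s \<omega>)) (at s within {0..1})"
  unfolding has_vector_derivative_def has_derivative_within_alt
proof (intro conjI allI impI bounded_linear_scaleR_left)
  fix e :: real assume e: "e > 0"
  define y where "y = pullback s \<omega>"
  let ?V0 = "V s (X s \<omega>)"
  have y: "flow s y = X s \<omega>" unfolding y_def by (rule flow_pullback[OF s])
  have "continuous_on ({0..1} \<times> UNIV) (\<lambda>p. V (fst p) (flow (fst p) (snd p)))"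
    by (intro continuous_F continuous_flow continuous_intros) auto
  then obtain d where "d > 0" "\<forall>p\<in>{0..1} \<times> UNIV. dist p (s, y) < d \<longrightarrow>
      dist (V (fst p) (flow (fst p) (snd p))) (V s (flow s y)) < e"
    using e s unfolding continuous_on_iff by (metis SigmaI UNIV_I fst_conv snd_conv)
  then have d: "d > 0" "\<And>\<tau> y'. \<tau> \<in> {0..1} \<Longrightarrow> dist (\<tau>, y') (s, y) < d \<Longrightarrow> dist (V \<tau> (flow \<tau> y')) ?V0 < e"
    unfolding y by auto
  obtain B where B: "\<And>r s. r \<in> {0..1} \<Longrightarrow> s \<in> {0..1} \<Longrightarrow> norm (pullback r \<omega> - pullback s \<omega>) \<le> B \<omega> * \<bar>r - s\<bar>"
    using pullback_lipschitz by blast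
  show "\<exists>d>0. \<forall>r\<in>{0..1}. norm (r - s) < d \<longrightarrow>
    norm (flow s (pullback r \<omega>) - flow s (pullback s \<omega>) - (r - s) *\<^sub>R (Y \<omega> - ?V0)) \<le> e * norm (r - s)"
  \<comment> \<open>By the Lipschitz bound on the pullback, this radius keeps the time shift and the
    shift of the starting point together below \<open>d\<close>.\<close>
  proof (intro exI[of _ "d / (2 + \<bar>B \<omega>\<bar>)"] conjI ballI impI)
    show "d / (2 + \<bar>B \<omega>\<bar>) > 0" using d by simp
    fix r :: real assume r: "r \<in> {0..1}" and rs: "norm (r - s) < d / (2 + \<bar>B \<omega>\<bar>)"
    define y' where "y' = pullback r \<omega>"
    have y': "flow r y' = X r \<omega>" unfolding y'_def by (rule flow_pullback[OF r])
    define m where "m = \<bar>r - s\<bar>"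
    have "norm (y' - y) \<le> \<bar>B \<omega>\<bar> * m"
      using B[OF r s] unfolding y'_def y_def m_def by (rule order_trans) (auto intro: mult_right_mono)
    moreover have "m * (2 + \<bar>B \<omega>\<bar>) < d" using rs by (simp add: m_def pos_less_divide_eq)
    then have "\<bar>B \<omega>\<bar> * m + 2 * m < d" by (simp add: algebra_simps)
    moreover have "0 \<le> m" by (simp add: m_def)
    ultimately have "m + norm (y' - y) < d" by linarith
    then have small: "\<bar>r - s\<bar> + norm (y' - y) < d" by (simp only: m_def)
    let ?I = "closed_segment s r"
    have I: "?I \<subseteq> {0..1}" using r s by (intro closed_segment_subset) auto
    have near: "norm (V \<tau> (flow \<tau> y') - ?V0) \<le> e" if "\<tau> \<in> ?I" for \<tau>
    proof -
      have "\<bar>\<tau> - s\<bar> \<le> \<bar>r - s\<bar>"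
        using that by (auto simp: closed_segment_eq_real_ivl split: if_splits)
      then have "dist (\<tau>, y') (s, y) < d"
        using small norm_Pair_le[of "\<tau> - s" "y' - y"] by (simp add: dist_norm)
      from d(2)[OF _ this] show ?thesis using that I by (auto simp: dist_norm)
    qed
    \<comment> \<open>Subtracting the uniform motion with velocity \<open>?V0\<close> leaves a path
      whose velocity has norm at most \<open>e\<close>.\<close>
    have "norm ((flow s y' - s *\<^sub>R ?V0) - (flow r y' - r *\<^sub>R ?V0)) \<le> e * \<bar>s - r\<bar>"
    proof (rule norm_diff_le_vector_derivative[where S = ?I])
      fix \<tau> assume \<tau>: "\<tau> \<in> ?I"
      have "((\<lambda>\<tau>. flow \<tau> y') has_vector_derivative V \<tau> (flow \<tau> y')) (at \<tau> within ?I)"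
        using I \<tau> by (intro has_vector_derivative_within_subset[OF flow_vector_derivative]) auto
      moreover have "((\<lambda>\<tau>. \<tau> *\<^sub>R ?V0) has_vector_derivative ?V0) (at \<tau> within ?I)"
        by (auto intro!: derivative_eq_intros)
      ultimately show "((\<lambda>\<tau>. flow \<tau> y' - \<tau> *\<^sub>R ?V0) has_vector_derivative V \<tau> (flow \<tau> y') - ?V0) (at \<tau> within ?I)"
        by (rule has_vector_derivative_diff)
    qed (use near in auto)
    also have "(flow s y' - s *\<^sub>R ?V0) - (flow r y' - r *\<^sub>R ?V0) =
        flow s y' - X s \<omega> - (X r \<omega> - X s \<omega>) + (r - s) *\<^sub>R ?V0"
      unfolding y' by (simp add: algebra_simps)
    also have "\<dots> = flow s y' - flow s y - (r - s) *\<^sub>R (Y \<omega> - ?V0)"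
      unfolding X_diff y by (simp add: algebra_simps)
    finally show "norm (flow s (pullback r \<omega>) - flow s (pullback s \<omega>) - (r - s) *\<^sub>R (Y \<omega> - ?V0)) \<le> e * norm (r - s)"
      by (simp add: y_def y'_def abs_minus_commute)
  qed
qed

text \<open>The bound on \<open>\<gamma>\<close> makes \<open>g\<close> Lipschitz, so the integrable
  Lipschitz constant of the pullback dominates the difference quotients. The same domination
  supplies the integrability under which \<open>orthogonality\<close> makes the derivative
  vanish.\<close>

lemma integral_pullback_constant:
  fixes g :: "'a \<Rightarrow> real"
  assumes g: "\<And>x. (g has_derivative (\<lambda>h. \<gamma> x \<bullet> h)) (at x)" and cont: "continuous_on UNIV \<gamma>"
    and bounds: "\<And>x. \<bar>g x\<bar> \<le> C" "\<And>x. norm (\<gamma> x) \<le> C'" and t: "t \<in> {0..1}"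
  shows "(\<integral>\<omega>. g (pullback t \<omega>) \<partial>\<mu>) = (\<integral>\<omega>. g (X 0 \<omega>) \<partial>\<mu>)"
proof -
  have [measurable]: "g \<in> borel_measurable borel"
    using g by (intro borel_measurable_continuous_onI continuous_at_imp_continuous_on) (auto intro: has_derivative_continuous)
  have meas_inv [measurable]: "inv (flow s) \<in> borel_measurable borel" if "s \<in> {0..1}" for s
    using that by (intro borel_measurable_continuous_onI continuous_inv_flow)
  have meas_pb: "pullback s \<in> borel_measurable \<mu>" if "s \<in> {0..1}" for s
    unfolding pullback_def by (rule measurable_compose[OF measurable_XY(1) meas_inv[OF that]])
  have int: "integrable \<mu> (\<lambda>\<omega>. g (pullback s \<omega>))" if "s \<in> {0..1}" for s
    by (rule integrable_const_bound[where B = C]) (use bounds meas_pb[OF that] in \<open>auto intro!: AE_I2\<close>)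
  have g_lip: "\<bar>g x - g y\<bar> \<le> C' * norm (x - y)" for x y
  proof -
    have "norm (g x - g y) \<le> C' * norm (x - y)"
    proof (rule differentiable_bound[where S = UNIV])
      show "onorm (\<lambda>h. \<gamma> x \<bullet> h) \<le> C'" for x
      proof (rule onorm_bound)
        show "0 \<le> C'" using bounds(2)[of x] norm_ge_zero order_trans by blast
        show "norm (\<gamma> x \<bullet> h) \<le> C' * norm h" for h
          using Cauchy_Schwarz_ineq2[of "\<gamma> x" h] mult_right_mono[OF bounds(2)[of x] norm_ge_zero[of h]] by simp
      qed
    qed (use g in auto)
    then show ?thesis by simp
  qed
  have C': "C' \<ge> 0" using bounds(2)[of 0] norm_ge_zero order_trans by blast
  obtain B where B: "integrable \<mu> B" "\<And>r s \<omega>. r \<in> {0..1} \<Longrightarrow> s \<in> {0..1} \<Longrightarrow> norm (pullback r \<omega> - pullback s \<omega>) \<le> B \<omega> * \<bar>r - s\<bar>"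
    using pullback_lipschitz by blast
  have "((\<lambda>s. \<integral>\<omega>. g (pullback s \<omega>) \<partial>\<mu>) has_real_derivative 0) (at s within {0..1})" if s: "s \<in> {0..1}" for s
  proof -
    obtain \<Psi>' where \<Psi>': "\<And>z. (inv (flow s) has_derivative blinfun_apply (\<Psi>' z)) (at z)" "continuous_on UNIV \<Psi>'"
      using inv_flow_C1[OF s] by blast
    \<comment> \<open>The gradient of \<open>g\<close> composed with \<open>inv (flow s)\<close>:
      the adjoint of \<open>\<Psi>' x\<close> applied to \<open>\<gamma>\<close>, written out in the
      basis.\<close>
    define \<psi> where "\<psi> x = (\<Sum>b\<in>Basis. (\<gamma> (inv (flow s) x) \<bullet> \<Psi>' x b) *\<^sub>R b)" for x
    have \<psi>: "\<gamma> (inv (flow s) x) \<bullet> \<Psi>' x h = \<psi> x \<bullet> h" for x h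
    proof -
      have "\<gamma> (inv (flow s) x) \<bullet> \<Psi>' x (\<Sum>b\<in>Basis. (h \<bullet> b) *\<^sub>R b) = \<psi> x \<bullet> h"
        by (simp only: blinfun.sum_right blinfun.scaleR_right \<psi>_def inner_sum_left inner_sum_right
            inner_scaleR_left inner_scaleR_right) (simp add: mult.commute inner_commute)
      then show ?thesis by (simp add: euclidean_representation)
    qed
    have "continuous_on UNIV \<psi>"
      unfolding \<psi>_def
      by (intro continuous_intros continuous_on_compose2[OF cont] continuous_inv_flow s \<Psi>') auto
    then have [measurable]: "\<psi> \<in> borel_measurable borel" by (rule borel_measurable_continuous_onI)
    have "continuous_on UNIV (V s)" by (rule continuous_F) (use s in auto)
    then have [measurable]: "V s \<in> borel_measurable borel" by (rule borel_measurable_continuous_onI)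
    let ?u' = "\<lambda>\<omega>. \<psi> (X s \<omega>) \<bullet> (Y \<omega> - V s (X s \<omega>))"
    have der: "((\<lambda>r. g (pullback r \<omega>)) has_real_derivative ?u' \<omega>) (at s within {0..1})" for \<omega>
    proof -
      have p: "((\<lambda>r. flow s (pullback r \<omega>)) has_derivative (\<lambda>h. h *\<^sub>R (Y \<omega> - V s (X s \<omega>)))) (at s within {0..1})"
        using pullback_derivative[OF s] by (simp add: has_vector_derivative_def)
      have "((\<lambda>x. g (inv (flow s) x)) has_derivative (\<lambda>h. \<psi> (X s \<omega>) \<bullet> h)) (at (flow s (pullback s \<omega>)))"
        using has_derivative_compose[OF \<Psi>'(1) g] unfolding \<psi>[symmetric] flow_pullback[OF s] .
      from has_derivative_compose[OF p this]
      have "((\<lambda>r. g (pullback r \<omega>)) has_derivative (\<lambda>h. \<psi> (X s \<omega>) \<bullet> (h *\<^sub>R (Y \<omega> - V s (X s \<omega>))))) (at s within {0..1})"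
        by (simp only: inv_flow_flow[OF s])
      then show ?thesis
        unfolding has_field_derivative_def by (rule has_derivative_eq_rhs) (auto simp: mult.commute)
    qed
    have nontriv: "at s within {0..1} \<noteq> bot"
      using s by (subst trivial_limit_within) (auto simp: islimpt_Icc)
    have ubound: "\<bar>g (pullback r \<omega>) - g (pullback s \<omega>)\<bar> \<le> (C' * B \<omega>) * \<bar>r - s\<bar>" if "r \<in> {0..1}" for r \<omega>
      using g_lip[of "pullback r \<omega>" "pullback s \<omega>"] mult_left_mono[OF B(2)[OF that s, of \<omega>] C'] by (simp add: mult.assoc)
    have meas': "?u' \<in> borel_measurable \<mu>" by measurable
    note deriv = has_real_derivative_integral[OF der s nontriv int integrable_mult_right[OF B(1)] ubound meas']
    from deriv(2) orthogonality[OF s _ deriv(1)] show ?thesis by simp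
  qed
  then obtain c where c: "\<And>s. s \<in> {0..1} \<Longrightarrow> (\<integral>\<omega>. g (pullback s \<omega>) \<partial>\<mu>) = c"
    using has_field_derivative_zero_constant[of "{0..1::real}" "\<lambda>s. \<integral>\<omega>. g (pullback s \<omega>) \<partial>\<mu>"] by auto
  have "pullback 0 \<omega> = X 0 \<omega>" for \<omega> by (simp add: pullback_def inv_flow_0)
  then show ?thesis using c[OF t] c[of 0] by simp
qed

end

subsection \<open>Test functions determining a law\<close>

text \<open>Squaring removes the kink of the positive part at 0, which yields a C^1 penalty for
  leaving an orthant.\<close>

lemma max_0_square_derivative: "((\<lambda>s::real. (max 0 s)\<^sup>2) has_real_derivative 2 * max 0 s) (at s)"
proof -
  consider "s < 0" | "s > 0" | "s = 0" by linarith
  then show ?thesis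
  proof cases
    case 1
    have "((\<lambda>s::real. 0) has_real_derivative 2 * max 0 s) (at s)" using 1 by simp
    then show ?thesis
      by (rule DERIV_cong_ev[THEN iffD1, rotated 3])
         (use 1 eventually_nhds_in_open[of "{..<0}" s] in \<open>auto elim!: eventually_mono\<close>)
  next
    case 2
    have "((\<lambda>s::real. s\<^sup>2) has_real_derivative 2 * max 0 s) (at s)"
      using 2 by (auto intro!: derivative_eq_intros)
    then show ?thesis
      by (rule DERIV_cong_ev[THEN iffD1, rotated 3])
         (use 2 eventually_nhds_in_open[of "{0<..}" s] in \<open>auto elim!: eventually_mono\<close>)
  next
    case 3
    have "((\<lambda>h::real. (max 0 h)\<^sup>2 / h) \<longlongrightarrow> 0) (at 0)"
    proof (rule tendsto_0_le)
      show "((\<lambda>h::real. h) \<longlongrightarrow> 0) (at 0)" by simp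
      show "\<forall>\<^sub>F h::real in at 0. norm ((max 0 h)\<^sup>2 / h) \<le> norm h * 1"
        by (auto simp: max_def power2_eq_square)
    qed
    then show ?thesis using 3 by (simp add: has_field_derivative_iff)
  qed
qed

text \<open>\<open>S\<close> vanishes exactly on the orthant below \<open>a\<close>, so
  \<open>exp (- (Suc k * S x))\<close> converges to its indicator, and orthants form an
  intersection-stable generator of the Borel sets. The gradient bound \<open>C\<close> may depend on
  the test function, as it must for functions that steepen with \<open>k\<close>.\<close>

lemma prob_measure_eqI_C1:
  fixes A B :: "'a::ordered_euclidean_space measure"
  assumes A: "prob_space A" "sets A = sets borel" and B: "prob_space B" "sets B = sets borel"
    and eq: "\<And>g \<gamma> C. (\<And>x. (g has_derivative (\<lambda>h. \<gamma> x \<bullet> h)) (at x)) \<Longrightarrow> continuous_on UNIV \<gamma> \<Longrightarrow>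
      (\<And>x. \<bar>g x\<bar> \<le> 1) \<Longrightarrow> (\<And>x. norm (\<gamma> x) \<le> C) \<Longrightarrow> (\<integral>x. g x \<partial>A) = (\<integral>x. g x \<partial>B)"
  shows "A = B"
proof -
  interpret A: prob_space A by (rule A(1))
  interpret B: prob_space B by (rule B(1))
  have spaces: "space A = UNIV" "space B = UNIV"
    using sets_eq_imp_space_eq[OF A(2)] sets_eq_imp_space_eq[OF B(2)] by simp_all
  have measA [measurable_cong]: "sets A = sets borel" and measB [measurable_cong]: "sets B = sets borel" by fact+
  have "measure A {..a} = measure B {..a}" for a
  proof -
    define S where "S x = (\<Sum>b\<in>Basis. (max 0 ((x - a) \<bullet> b))\<^sup>2)" for x
    define g where "g k x = exp (- (real (Suc k) * S x))" for k x
    define \<gamma> where "\<gamma> k x = (- (real (Suc k) * g k x)) *\<^sub>R (\<Sum>b\<in>Basis. (2 * max 0 ((x - a) \<bullet> b)) *\<^sub>R b)" for k x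
    have S_nonneg: "S x \<ge> 0" for x by (simp add: S_def sum_nonneg)
    have S_eq_0: "S x = 0 \<longleftrightarrow> x \<le> a" for x
      unfolding S_def by (subst sum_nonneg_eq_0_iff) (auto simp: eucl_le[where 'a='a] inner_diff_left max_def)
    have cont_S: "continuous_on UNIV S" unfolding S_def by (intro continuous_intros)
    have cont_g: "continuous_on UNIV (g k)" for k
      unfolding g_def by (intro continuous_intros continuous_on_compose2[OF cont_S]) auto
    then have [measurable]: "g k \<in> borel_measurable borel" for k by (rule borel_measurable_continuous_onI)
    have same: "(\<integral>x. g k x \<partial>A) = (\<integral>x. g k x \<partial>B)" for k
    proof (rule eq)
      fix x
      have term_der: "((\<lambda>x. (max 0 ((x - a) \<bullet> b))\<^sup>2) has_derivative (\<lambda>h. 2 * max 0 ((x - a) \<bullet> b) * (h \<bullet> b))) (at x)" for b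
      proof -
        have "((\<lambda>x. (x - a) \<bullet> b) has_derivative (\<lambda>h. h \<bullet> b)) (at x)"
          by (auto intro!: derivative_eq_intros)
        from has_derivative_compose[OF this max_0_square_derivative[unfolded has_field_derivative_def]]
        show ?thesis .
      qed
      have "(S has_derivative (\<lambda>h. \<Sum>b\<in>Basis. 2 * max 0 ((x - a) \<bullet> b) * (h \<bullet> b))) (at x)"
        unfolding S_def by (intro has_derivative_sum term_der)
      moreover have "\<gamma> k x \<bullet> h = - (real (Suc k) * g k x) * (\<Sum>b\<in>Basis. 2 * max 0 ((x - a) \<bullet> b) * (h \<bullet> b))" for h
        by (simp only: \<gamma>_def inner_scaleR_left inner_sum_left) (simp only: inner_commute[of _ h])
      ultimately show "(g k has_derivative (\<lambda>h. \<gamma> k x \<bullet> h)) (at x)"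
        unfolding g_def by (auto intro!: derivative_eq_intros)
      show "\<bar>g k x\<bar> \<le> 1" using S_nonneg[of x] by (simp add: g_def)
      \<comment> \<open>The decay of \<open>g\<close> beats the linear growth of its gradient
        factor: \<open>m \<le> 1 + m^2 \<le> 1 + Suc k * S x \<le> exp (Suc k * S x)\<close>, where
        the middle step uses that \<open>Suc k\<close> is at least 1.\<close>
      have "g k x * max 0 ((x - a) \<bullet> b) \<le> 1" if b: "b \<in> Basis" for b
      proof -
        let ?m = "max 0 ((x - a) \<bullet> b)"
        have m2: "?m\<^sup>2 \<le> S x" unfolding S_def using b by (intro member_le_sum) auto
        have "?m \<le> 1 + ?m\<^sup>2"
          using sum_squares_bound[of ?m 1] by (simp add: max_def split: if_splits)
        also have "\<dots> \<le> 1 + real (Suc k) * S x"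
          using m2 S_nonneg[of x] mult_right_mono[of 1 "real (Suc k)" "S x"] by simp
        also have "\<dots> \<le> exp (real (Suc k) * S x)" by (rule exp_ge_add_one_self)
        finally have "g k x * ?m \<le> g k x * exp (real (Suc k) * S x)" by (intro mult_left_mono) (simp_all add: g_def)
        also have "\<dots> = 1" by (simp add: g_def flip: exp_add)
        finally show ?thesis .
      qed
      have g_pos: "g k x > 0" by (simp add: g_def)
      have "norm (\<gamma> k x) = real (Suc k) * g k x * norm (\<Sum>b\<in>(Basis::'a set). (2 * max 0 ((x - a) \<bullet> b)) *\<^sub>R b)"
        unfolding \<gamma>_def using g_pos by simp
      also have "\<dots> \<le> real (Suc k) * g k x * (\<Sum>b\<in>(Basis::'a set). norm ((2 * max 0 ((x - a) \<bullet> b)) *\<^sub>R b))"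
        using g_pos by (intro mult_left_mono norm_sum) auto
      also have "\<dots> = (\<Sum>b\<in>(Basis::'a set). 2 * real (Suc k) * (g k x * max 0 ((x - a) \<bullet> b)))"
        by (simp add: sum_distrib_left mult_ac del: of_nat_Suc)
      also have "\<dots> \<le> (\<Sum>b\<in>(Basis::'a set). 2 * real (Suc k) * 1)"
        using \<open>\<And>b. b \<in> Basis \<Longrightarrow> g k x * max 0 ((x - a) \<bullet> b) \<le> 1\<close> by (intro sum_mono mult_left_mono) auto
      finally show "norm (\<gamma> k x) \<le> (\<Sum>b\<in>(Basis::'a set). 2 * real (Suc k) * 1)" .
    next
      show "continuous_on UNIV (\<gamma> k)"
        unfolding \<gamma>_def by (intro continuous_intros continuous_on_compose2[OF cont_g]) auto
    qed
    have lim: "(\<lambda>k. \<integral>x. g k x \<partial>N) \<longlonglongrightarrow> measure N {..a}"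
      if N: "prob_space N" and sets_N [measurable_cong]: "sets N = sets borel" for N
    proof -
      interpret N: prob_space N by (rule N)
      have "(\<lambda>k. \<integral>x. g k x \<partial>N) \<longlonglongrightarrow> (\<integral>x. indicator {..a} x \<partial>N)"
      proof (rule integral_dominated_convergence[where w = "\<lambda>_. 1"])
        show "AE x in N. (\<lambda>k. g k x) \<longlonglongrightarrow> indicator {..a} x"
        proof (rule AE_I2)
          fix x
          show "(\<lambda>k. g k x) \<longlonglongrightarrow> indicator {..a} x"
          proof (cases "S x = 0")
            case False
            then have "S x > 0" using S_nonneg[of x] by linarith
            then have "filterlim (\<lambda>k. real (Suc k) * S x) at_top sequentially"
              by (intro filterlim_at_top_mult_tendsto_pos[OF tendsto_const] filterlim_compose[OF filterlim_real_sequentially filterlim_Suc])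
            then have "(\<lambda>k. exp (- (real (Suc k) * S x))) \<longlonglongrightarrow> 0"
              by (intro filterlim_compose[OF exp_at_bot] filterlim_compose[OF filterlim_uminus_at_bot_at_top])
            then show ?thesis using False S_eq_0[of x] by (simp add: g_def)
          qed (use S_eq_0[of x] in \<open>simp add: g_def\<close>)
        qed
        show "AE x in N. norm (g k x) \<le> 1" for k using S_nonneg by (intro AE_I2) (simp add: g_def)
      qed auto
      then show ?thesis by simp
    qed
    show ?thesis
      by (rule LIMSEQ_unique[OF lim[OF A, unfolded same] lim[OF B]])
  qed
  then have eq': "emeasure A {..a} = emeasure B {..a}" for a
    by (simp add: A.emeasure_eq_measure B.emeasure_eq_measure)
  show ?thesis
  proof (rule measure_eqI_generator_eq[where \<Omega> = UNIV and E = "range (\<lambda>a. {..a})" and A = "\<lambda>n. {..real n *\<^sub>R One}"])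
    show "Int_stable (range (\<lambda>a::'a. {..a}))"
    proof (clarsimp simp: Int_stable_def)
      fix a b :: 'a
      have "{..a} \<inter> {..b} = {..inf a b}" by auto
      then show "{..a} \<inter> {..b} \<in> range atMost" by simp
    qed
    have s: "sets (borel :: 'a measure) = sigma_sets UNIV (range (\<lambda>a. {..a}))"
      by (subst borel_eq_atMost) simp
    show "sets A = sigma_sets UNIV (range (\<lambda>a. {..a}))" "sets B = sigma_sets UNIV (range (\<lambda>a. {..a}))"
      using A(2) B(2) s by simp_all
    have "\<exists>n. x \<le> real n *\<^sub>R One" for x :: 'a
    proof -
      obtain n where n: "norm x \<le> real n" using real_arch_simple by blast
      have "x \<bullet> b \<le> real n" if "b \<in> Basis" for b
        using Basis_le_norm[OF that, of x] n by linarith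
      then show ?thesis by (auto simp: eucl_le[where 'a='a])
    qed
    then show "(\<Union>n. {..real n *\<^sub>R One}) = (UNIV :: 'a set)" by auto
    show "emeasure A {..real n *\<^sub>R One} \<noteq> \<infinity>" for n by simp
  qed (use eq' in auto)
qed

subsection \<open>Multivariate calculus with partial derivatives\<close>

lemma has_real_derivative_along_axis:
  fixes f :: "real^'n::finite \<Rightarrow> real"
  assumes "has_partial i f (x + s *\<^sub>R axis i 1)"
  shows "((\<lambda>s. f (x + s *\<^sub>R axis i 1)) has_real_derivative partial i f (x + s *\<^sub>R axis i 1)) (at s)"
proof -
  have "((\<lambda>r. f (x + s *\<^sub>R axis i 1 + r *\<^sub>R axis i 1)) has_real_derivative partial i f (x + s *\<^sub>R axis i 1)) (at 0)"
    unfolding partial_def using assms[unfolded has_partial_def]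
    by (simp add: DERIV_deriv_iff_real_differentiable)
  then have "((\<lambda>r. f (x + (r + s) *\<^sub>R axis i 1)) has_real_derivative partial i f (x + s *\<^sub>R axis i 1)) (at 0)"
    by (simp add: algebra_simps)
  then show ?thesis
    using DERIV_at_within_shift[of "\<lambda>s. f (x + s *\<^sub>R axis i 1)" _ s 0 UNIV] by (simp add: add.commute)
qed

text \<open>The path from \<open>y\<close> to \<open>x\<close> is walked along one coordinate axis
  at a time, so partial derivatives in one variable are enough and the distance is measured in the
  l1 norm.\<close>

lemma lipschitz_of_bounded_partials:
  fixes f :: "real^'n::finite \<Rightarrow> real"
  assumes diff: "\<And>i x. has_partial i f x" and bound: "\<And>i x. \<bar>partial i f x\<bar> \<le> B"
  shows "\<bar>f x - f y\<bar> \<le> B * (\<Sum>i\<in>UNIV. \<bar>x $ i - y $ i\<bar>)"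
proof -
  have step: "\<bar>f (z + s *\<^sub>R axis i 1) - f z\<bar> \<le> B * \<bar>s\<bar>" for z s i
  proof -
    have "norm (f (z + s *\<^sub>R axis i 1) - f (z + 0 *\<^sub>R axis i 1)) \<le> B * norm (s - 0)"
      by (rule field_differentiable_bound[where S = UNIV and f = "\<lambda>s. f (z + s *\<^sub>R axis i 1)"])
        (auto intro: has_real_derivative_along_axis diff bound)
    then show ?thesis by simp
  qed
  have "\<bar>f (y + (\<Sum>i\<in>I. (x $ i - y $ i) *\<^sub>R axis i 1)) - f y\<bar> \<le> B * (\<Sum>i\<in>I. \<bar>x $ i - y $ i\<bar>)" for I
  proof (induction I rule: infinite_finite_induct)
    case (insert i I)
    then show ?case
      using step[of "y + (\<Sum>i\<in>I. (x $ i - y $ i) *\<^sub>R axis i 1)" "x $ i - y $ i" i]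
      by (simp add: algebra_simps) 
  qed auto
  from this[of UNIV] show ?thesis
    by (simp add: basis_expansion[of "x - y", simplified scalar_mult_eq_scaleR, simplified])
qed

lemma partial_eq_derivative:
  fixes f :: "real^'n::finite \<Rightarrow> real"
  assumes "(f has_derivative f') (at x)"
  shows "partial i f x = f' (axis i 1)"
proof -
  interpret bounded_linear f' using assms by (rule has_derivative_bounded_linear)
  have line: "((\<lambda>s. x + s *\<^sub>R axis i 1) has_derivative (\<lambda>h. h *\<^sub>R axis i 1)) (at 0)"
    by (auto intro!: derivative_eq_intros)
  have "((\<lambda>s. f (x + s *\<^sub>R axis i 1)) has_derivative (\<lambda>h. f' (h *\<^sub>R axis i 1))) (at 0)"
    by (rule has_derivative_compose[OF line]) (use assms in simp)
  then have "((\<lambda>s. f (x + s *\<^sub>R axis i 1)) has_real_derivative f' (axis i 1)) (at 0)"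
    unfolding has_field_derivative_def by (rule has_derivative_eq_rhs) (simp add: scaleR mult.commute fun_eq_iff)
  then show ?thesis unfolding partial_def by (rule DERIV_imp_deriv)
qed

lemma linear_eq_sum_axis:
  fixes f :: "real^'n::finite \<Rightarrow> 'b::real_vector"
  assumes "linear f"
  shows "f h = (\<Sum>i\<in>UNIV. h $ i *\<^sub>R f (axis i 1))"
proof -
  have "f h = f (\<Sum>i\<in>UNIV. h $ i *\<^sub>R axis i 1)"
    using basis_expansion[of h] by (simp add: scalar_mult_eq_scaleR)
  then show ?thesis by (simp add: linear_sum[OF assms] linear_scale[OF assms])
qed

section \<open>Regularity of the potentials from the hypotheses\<close>

lemma U2D:
  assumes "U2 \<beta> C C\<beta> \<phi>"
  shows "\<phi> differentiable (at x)" "grad \<phi> differentiable (at x)"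
    and "length is < nat \<lceil>\<beta>\<rceil> - 1 \<Longrightarrow> has_partial i (pderivs is \<phi>) x"
    and "2 \<le> length is \<Longrightarrow> length is \<le> nat \<lceil>\<beta>\<rceil> - 1 \<Longrightarrow> \<bar>pderivs is \<phi> x\<bar> \<le> C (length is)"
    and "length is = nat \<lceil>\<beta>\<rceil> - 1 \<Longrightarrow> x \<noteq> y \<Longrightarrow>
      \<bar>pderivs is \<phi> x - pderivs is \<phi> y\<bar> \<le> C\<beta> * norm (x - y) powr (\<beta> - of_int \<lceil>\<beta>\<rceil> + 1)"
  using assms unfolding U2_def differentiable_on_def by blast+

text \<open>If second derivatives are the top order, the Hoelder condition applies to them directly.
  Otherwise third partial derivatives exist and are bounded by \<open>C 3\<close>, which makes the
  second ones Lipschitz.\<close>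

lemma continuous_second_partial:
  assumes "U2 \<beta> C C\<beta> \<phi>" and "\<beta> > 2"
  shows "continuous_on UNIV (pderivs [j, i] (\<phi> :: real^'n::finite \<Rightarrow> real))"
  unfolding continuous_on_def
proof
  fix y :: "real^'n"
  let ?f = "pderivs [j, i] \<phi>"
  obtain b where b: "\<And>x. x \<noteq> y \<Longrightarrow> \<bar>?f x - ?f y\<bar> \<le> b x" and b_lim: "(b \<longlongrightarrow> 0) (at y)"
  proof (cases "nat \<lceil>\<beta>\<rceil> - 1 = 2")
    case True
    let ?b = "\<lambda>x. C\<beta> * norm (x - y) powr (\<beta> - of_int \<lceil>\<beta>\<rceil> + 1)"
    have "(?b \<longlongrightarrow> C\<beta> * 0) (at y)"
      \<comment> \<open>The exponent is positive because the ceiling of \<open>\<beta>\<close> is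
        less than \<open>\<beta> + 1\<close>.\<close>
      by (intro tendsto_mult tendsto_const tendsto_zero_powrI) (auto intro!: tendsto_eq_intros, linarith)
    moreover have "\<bar>?f x - ?f y\<bar> \<le> ?b x" if "x \<noteq> y" for x
      by (rule U2D(5)[OF assms(1)]) (use that True in auto)
    ultimately show ?thesis by (intro that[of ?b]) auto
  next
    case False
    then have ge3: "nat \<lceil>\<beta>\<rceil> - 1 \<ge> 3" using assms(2) by linarith
    let ?b = "\<lambda>x. C 3 * (\<Sum>i\<in>UNIV. \<bar>x $ i - y $ i\<bar>)"
    have "\<bar>?f x - ?f y\<bar> \<le> ?b x" for x
    proof (rule lipschitz_of_bounded_partials)
      show "has_partial l ?f x" for l x
        by (rule U2D(3)[OF assms(1)]) (use ge3 in auto)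
      show "\<bar>partial l ?f x\<bar> \<le> C 3" for l x
        using U2D(4)[OF assms(1), of "[l, j, i]" x] ge3 by (simp add: eval_nat_numeral)
    qed
    moreover have "(?b \<longlongrightarrow> 0) (at y)" by (auto intro!: tendsto_eq_intros)
    ultimately show ?thesis by (intro that[of ?b]) auto
  qed
  have "((\<lambda>x. ?f x - ?f y) \<longlongrightarrow> 0) (at y)"
    by (rule Lim_null_comparison[OF _ b_lim]) (use b in \<open>auto simp: eventually_at_filter\<close>)
  then show "(?f \<longlongrightarrow> ?f y) (at y within UNIV)" by (simp add: LIM_zero_iff)
qed

text \<open>\<open>grad\<close> and \<open>pderivs\<close> are defined by derivatives along axes.
  Total differentiability of \<open>\<phi>\<close> and \<open>grad \<phi>\<close> identifies them
  with the Frechet derivatives, so the entries of \<open>H\<close> are the second partial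
  derivatives, and its continuity and bound can be read off entrywise.\<close>

lemma smooth_potential_of_U2_U3:
  fixes \<phi> :: "real^'n::finite \<Rightarrow> real"
  assumes U2: "U2 \<beta> C C\<beta> \<phi>" and U3: "U3 \<alpha> \<phi>" and "\<beta> > 2" "\<alpha> > 0"
  shows "\<exists>H. smooth_potential \<phi> (grad \<phi>) H (\<Sum>b\<in>(Basis::(real^'n) set). real CARD('n) * C 2) \<alpha>"
proof -
  have ge: "nat \<lceil>\<beta>\<rceil> - 1 \<ge> 2" using assms by linarith
  have \<phi>_der: "(\<phi> has_derivative (\<lambda>h. grad \<phi> x \<bullet> h)) (at x)" for x
  proof -
    obtain D where D: "(\<phi> has_derivative D) (at x)"
      using U2D(1)[OF U2] unfolding differentiable_def by blast
    have "D h = grad \<phi> x \<bullet> h" for h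
      unfolding linear_eq_sum_axis[OF has_derivative_linear[OF D], of h] inner_vec_def grad_def
      by (simp add: partial_eq_derivative[OF D] mult.commute)
    then have "D = (\<lambda>h. grad \<phi> x \<bullet> h)" by (rule ext)
    with D show ?thesis by simp
  qed
  define H where "H x = Blinfun (frechet_derivative (grad \<phi>) (at x))" for x
  have g_der: "(grad \<phi> has_derivative blinfun_apply (H x)) (at x)" for x
  proof -
    have d: "(grad \<phi> has_derivative frechet_derivative (grad \<phi>) (at x)) (at x)"
      using U2D(2)[OF U2] by (simp add: frechet_derivative_works)
    show ?thesis
      unfolding H_def bounded_linear_Blinfun_apply[OF has_derivative_bounded_linear[OF d]] by (rule d)
  qed
  have entry: "H x (axis j 1) $ i = pderivs [j, i] \<phi> x" for x i j
  proof -
    have "((\<lambda>x. grad \<phi> x $ i) has_derivative (\<lambda>h. H x h $ i)) (at x)"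
      by (rule bounded_linear.has_derivative[OF bounded_linear_vec_nth g_der])
    then have "partial j (\<lambda>x. grad \<phi> x $ i) x = H x (axis j 1) $ i" by (rule partial_eq_derivative)
    then show ?thesis by (simp add: grad_def)
  qed
  have bound: "\<bar>pderivs [j, i] \<phi> x\<bar> \<le> C 2" for i j x
    using U2D(4)[OF U2, of "[j, i]" x] ge by (simp add: numeral_2_eq_2 del: pderivs.simps)
  have "smooth_potential \<phi> (grad \<phi>) H (\<Sum>b\<in>(Basis::(real^'n) set). real CARD('n) * C 2) \<alpha>"
  proof
    show "continuous_on UNIV H"
    proof (rule continuous_on_blinfun_componentwise)
      fix b :: "real^'n" assume "b \<in> Basis"
      then obtain j where b: "b = axis j 1" by (auto simp: Basis_vec_def)
      have "continuous_on UNIV (\<lambda>x. \<chi> i. H x b $ i)"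
        unfolding b entry by (intro continuous_on_vec_lambda continuous_second_partial[OF U2 \<open>\<beta> > 2\<close>])
      then show "continuous_on UNIV (\<lambda>x. H x b)" by simp
    qed
    fix x
    \<comment> \<open>Origin of the constant: the operator norm is at most the sum of the column
      norms, and each column has \<open>CARD('n)\<close> entries of size at most
      \<open>C 2\<close>.\<close>
    have "norm (H x) \<le> (\<Sum>b\<in>Basis. norm (H x b))" by (rule norm_blinfun_euclidean_le)
    also have "\<dots> \<le> (\<Sum>b\<in>(Basis::(real^'n) set). real CARD('n) * C 2)"
    proof (rule sum_mono)
      fix b :: "real^'n" assume "b \<in> Basis"
      then obtain j where b: "b = axis j 1" by (auto simp: Basis_vec_def)
      have "norm (H x b) \<le> (\<Sum>i\<in>UNIV. \<bar>H x b $ i\<bar>)" by (rule norm_le_l1_cart)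
      also have "\<dots> \<le> (\<Sum>i\<in>(UNIV :: 'n set). C 2)" unfolding b entry by (intro sum_mono bound)
      finally show "norm (H x b) \<le> real CARD('n) * C 2" by simp
    qed
    finally show "norm (H x) \<le> (\<Sum>b\<in>(Basis::(real^'n) set). real CARD('n) * C 2)" .
    show "\<phi> x \<ge> \<phi> x' + grad \<phi> x' \<bullet> (x - x') + \<alpha> / 2 * (norm (x - x'))\<^sup>2" for x'
      using U3 by (simp add: U3_def)
  qed (use \<phi>_der g_der \<open>\<alpha> > 0\<close> in auto)
  then show ?thesis by blast
qed

theorem theorem6:
  fixes \<phi>0 \<phi>1 :: "real^'n::finite \<Rightarrow> real"
    and \<beta> \<alpha> C\<beta> :: real and C :: "nat \<Rightarrow> real"
    and v :: "real \<Rightarrow> real^'n \<Rightarrow> real^'n"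
  assumes prob0: "prob_space (meas_of_pot \<phi>0)"
    and prob1: "prob_space (meas_of_pot \<phi>1)"
    and beta: "\<beta> > 2"
    and U2_0: "U2 \<beta> C C\<beta> \<phi>0" and U2_1: "U2 \<beta> C C\<beta> \<phi>1"
    and alpha: "\<alpha> > 0"
    and U3_0: "U3 \<alpha> \<phi>0" and U3_1: "U3 \<alpha> \<phi>1"
    and vel: "is_cond_velocity (meas_of_pot \<phi>0) (meas_of_pot \<phi>1) v"
  shows "(\<forall>x. \<exists>f. ode_sol v x f)
       \<and> (\<forall>x f g. ode_sol v x f \<and> ode_sol v x g \<longrightarrow> (\<forall>t\<in>{0..1}. f t = g t))
       \<and> (\<forall>\<R>. (\<forall>x. ode_sol v x (\<lambda>t. \<R> t x)) \<longrightarrow>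
            C2 (\<R> 1) \<and>
            (\<forall>t\<in>{0..1}. distr (meas_of_pot \<phi>0) borel (\<R> t) =
                          distr (meas_of_pot \<phi>0 \<Otimes>\<^sub>M meas_of_pot \<phi>1) borel (interp t)))"
proof -
  let ?L = "\<Sum>b\<in>(Basis::(real^'n) set). real CARD('n) * C 2"
  obtain H0 H1 where H: "smooth_potential \<phi>0 (grad \<phi>0) H0 ?L \<alpha>" "smooth_potential \<phi>1 (grad \<phi>1) H1 ?L \<alpha>"
    using smooth_potential_of_U2_U3[OF U2_0 U3_0 beta alpha] smooth_potential_of_U2_U3[OF U2_1 U3_1 beta alpha] by blast
  have pp: "potential_pair \<phi>0 \<phi>1 (grad \<phi>0) (grad \<phi>1) H0 H1 ?L \<alpha>"
    by (intro potential_pair.intro H)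
  interpret interpolation \<phi>0 \<phi>1 "grad \<phi>0" "grad \<phi>1" H0 H1 ?L \<alpha> "meas_of_pot \<phi>0" "meas_of_pot \<phi>1"
    by (intro interpolation.intro pp interpolation_axioms.intro prob0 prob1) (simp_all add: meas_of_pot_def)
  obtain V' V'' where V': "C1_family {0..1} V V'" "C1_family {0..1} V' V''"
    using C2_V by (auto simp: C2_family_def)
  obtain K where K: "K \<ge> 0" "\<And>t z F k. t \<in> {0..1} \<Longrightarrow> (V t has_derivative F) (at z) \<Longrightarrow> norm (F k) \<le> K * norm k"
    using V_derivative_bound by blast
  have norm_V': "norm (V' t z) \<le> K" if "t \<in> {0..1}" for t z
    by (rule norm_blinfun_bound[OF K(1) K(2)[OF that C1_familyD(3)[OF V'(1) that]]])
  interpret flow_field 1 K V V'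
    by standard (use K(1) V'(1) norm_V' in auto)
  interpret interpolation_flow \<phi>0 \<phi>1 "grad \<phi>0" "grad \<phi>1" H0 H1 ?L \<alpha> "meas_of_pot \<phi>0" "meas_of_pot \<phi>1" K V' ..
  have X: "interp t = X t" for t by (auto simp: interp_def X_def fun_eq_iff)
  \<comment> \<open>Continuity of the version \<open>v t\<close> makes this an equality at every
    point, for each time including the end points.\<close>
  have v: "v t = V t" if t: "t \<in> {0..1}" for t
    using vel[unfolded is_cond_velocity_def, rule_format, OF t]
    by (intro V_characterisation t) (auto simp: X Y_def[abs_def])
  have sol: "ode_sol v x f \<longleftrightarrow> solves_ivp 1 V x f" for x f
    unfolding ode_sol_def solves_ivp_def using v by auto
  show ?thesis
  proof (intro conjI allI impI)
    fix x
    show "\<exists>f. ode_sol v x f" unfolding sol using flow_solves by blast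
  next
    fix x f g assume "ode_sol v x f \<and> ode_sol v x g"
    then show "\<forall>t\<in>{0..1}. f t = g t" unfolding sol using flow_unique by metis
  next
    fix \<R> assume "\<forall>x. ode_sol v x (\<lambda>t. \<R> t x)"
    \<comment> \<open>Uniqueness at each starting point identifies the whole maps, but only for
      times in the unit interval; nothing is known of \<open>\<R> t\<close> for other
      \<open>t\<close>.\<close>
    then have \<R>: "\<R> t = flow t" if "t \<in> {0..1}" for t
      unfolding sol using flow_unique that by blast
    show "C2 (\<R> 1)"
    proof -
      obtain D2 where "\<And>x. (Dflow 1 has_derivative blinfun_apply (D2 x)) (at x)" "continuous_on UNIV D2"
        using Dflow_C1[OF V'(2), of 1] by auto
      then show ?thesis
        unfolding C2_def using \<R>[of 1] flow_has_derivative[of 1] by auto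
    qed
    show "\<forall>t\<in>{0..1}. distr (meas_of_pot \<phi>0) borel (\<R> t) = distr \<mu> borel (interp t)"
    proof
      fix t :: real assume t: "t \<in> {0..1}"
      have [measurable]: "flow t \<in> borel_measurable borel" "inv (flow t) \<in> borel_measurable borel"
        using t by (intro borel_measurable_continuous_onI continuous_inv_flow continuous_flow continuous_intros; auto)+
      have [measurable]: "pullback t \<in> borel_measurable \<mu>" unfolding pullback_def[abs_def] by measurable
      have "distr \<mu> borel (pullback t) = distr \<mu> borel (X 0)"
      proof (rule prob_measure_eqI_C1)
        show "prob_space (distr \<mu> borel (pullback t))" "prob_space (distr \<mu> borel (X 0))"
          by (intro prob_space_distr; measurable)+
        fix g :: "real^'n \<Rightarrow> real" and \<gamma> and B
        assume g: "\<And>x. (g has_derivative (\<lambda>h. \<gamma> x \<bullet> h)) (at x)" "continuous_on UNIV \<gamma>"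
          "\<And>x. \<bar>g x\<bar> \<le> 1" "\<And>x. norm (\<gamma> x) \<le> B"
        have [measurable]: "g \<in> borel_measurable borel"
          using g(1) by (intro borel_measurable_continuous_onI continuous_at_imp_continuous_on) (auto intro: has_derivative_continuous)
        show "(\<integral>x. g x \<partial>distr \<mu> borel (pullback t)) = (\<integral>x. g x \<partial>distr \<mu> borel (X 0))"
          using integral_pullback_constant[OF g t] by (simp add: integral_distr)
      qed simp_all
      also have "\<dots> = meas_of_pot \<phi>0"
      proof -
        have "distr \<mu> borel (X 0) = distr \<mu> (meas_of_pot \<phi>0) fst"
          by (rule distr_cong) (auto simp: X_def)
        then show ?thesis by (simp add: M1.distr_pair_fst)
      qed
      \<comment> \<open>Pushing the constant law of the pullback forward by \<open>flow t\<close>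
        undoes the pullback and returns \<open>X t\<close>.\<close>
      finally have "distr (meas_of_pot \<phi>0) borel (flow t) = distr (distr \<mu> borel (pullback t)) borel (flow t)" by simp
      also have "\<dots> = distr \<mu> borel (flow t \<circ> pullback t)" by (rule distr_distr) measurable
      also have "flow t \<circ> pullback t = X t" using flow_pullback[OF t] by auto
      finally show "distr (meas_of_pot \<phi>0) borel (\<R> t) = distr \<mu> borel (interp t)"
        by (simp add: \<R>[OF t] X)
    qed
  qed
qed

end
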